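(* Let $\Gamma \subseteq \Gamma_0(4)$ be a congruence subgroup of $\mathrm{SL}_2(\mathbb{Z})$ of level $N$, and let $\theta(z) := y^{1/4}\sum_{m\in\mathbb{Z}} \exp(2\pi i m^2 z)$ ($z = x+iy \in \mathbb{H}$) be the Jacobi theta function, so that $|\theta|^2$ is a function on $\Gamma\backslash\mathbb{H}$. Fix $\delta>0$ and a measurable function $\varphi$ on $\Gamma\backslash\mathbb{H}$ satisfying $\varphi(z) \ll \mathrm{ht}(z)^{1/2-\delta}$. Then for integers $n \geq 1$ coprime to $N$, \[ \langle |\theta|^2, T_n\varphi\rangle = \langle |\theta|^2, 1\rangle\langle 1,\varphi\rangle + O(\tau(n) n^{-1/2}), \] where the implied constant depends on $\varphi$ (and on $\Gamma,\delta$) but not on $n$.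
   Context: $\mathbb{H}$ is the upper half-plane. The inner product is the normalized Petersson inner product $\langle \varphi_1,\varphi_2\rangle := \frac{1}{\mathrm{vol}(\Gamma\backslash\mathbb{H})}\int_{\Gamma\backslash\mathbb{H}} \overline{\varphi_1(z)}\varphi_2(z)\,\frac{dx\,dy}{y^2}$ (it converges absolutely for the functions in question). The height is $\mathrm{ht}(z) := \max_{\gamma\in\mathrm{SL}_2(\mathbb{Z})}\Im(\gamma z)$. $T_n$ denotes the Hecke operator at $n$ on $\Gamma\backslash\mathbb{H}$, normalized as an average so that $T_n 1 = 1$; e.g. for $\Gamma = \mathrm{SL}_2(\mathbb{Z})$, $T_n f(z)$ is the average of $f((az+b)/d)$ over all factorizations $n = ad$ and integers $0\le b<d$. $\tau(n)$ is the number of divisors of $n$. *)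

theory Defs
  imports "HOL-Analysis.Analysis" "HOL-Algebra.Group" "HOL-Number_Theory.Cong"
begin

definition upper_half_plane :: "complex set" where
  "upper_half_plane = {z. Im z > 0}"

definition hyp_measure :: "complex measure" where
  "hyp_measure = density (lebesgue_on upper_half_plane) (\<lambda>z. ennreal (1 / (Im z)\<^sup>2))"

definition SL2Z :: "(int^2^2) monoid" where
  "SL2Z = \<lparr>carrier = {A. det A = 1}, mult = (**), one = mat 1\<rparr>"

definition moebius :: "int^2^2 \<Rightarrow> complex \<Rightarrow> complex" where
  "moebius A z = (of_int (A$1$1) * z + of_int (A$1$2)) / (of_int (A$2$1) * z + of_int (A$2$2))"

definition mat_cong :: "nat \<Rightarrow> int^2^2 \<Rightarrow> int^2^2 \<Rightarrow> bool" where
  "mat_cong N A B \<longleftrightarrow> (\<forall>i j. [A$i$j = B$i$j] (mod int N))"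

definition principal_congruence_subgroup :: "nat \<Rightarrow> (int^2^2) set" where
  "principal_congruence_subgroup N = {A \<in> carrier SL2Z. mat_cong N A (mat 1)}"

definition Gamma0 :: "nat \<Rightarrow> (int^2^2) set" where
  "Gamma0 M = {A \<in> carrier SL2Z. int M dvd A$2$1}"

definition congruence_subgroup_of_level :: "(int^2^2) set \<Rightarrow> nat \<Rightarrow> bool" where
  "congruence_subgroup_of_level \<Gamma> N \<longleftrightarrow>
     subgroup \<Gamma> SL2Z \<and> N \<ge> 1 \<and> principal_congruence_subgroup N \<subseteq> \<Gamma> \<and>
     (\<forall>M\<ge>1. principal_congruence_subgroup M \<subseteq> \<Gamma> \<longrightarrow> N \<le> M)"

(* Functions on the quotient of the upper half-plane by \<Gamma> are represented by \<Gamma>-invariant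
   functions on the upper half-plane; values off the upper half-plane are irrelevant. *)
definition invariant_under :: "(int^2^2) set \<Rightarrow> (complex \<Rightarrow> complex) \<Rightarrow> bool" where
  "invariant_under \<Gamma> f \<longleftrightarrow> (\<forall>\<gamma>\<in>\<Gamma>. \<forall>z\<in>upper_half_plane. f (moebius \<gamma> z) = f z)"

definition fundamental_domain :: "(int^2^2) set \<Rightarrow> complex set \<Rightarrow> bool" where
  "fundamental_domain \<Gamma> D \<longleftrightarrow>
     D \<in> sets hyp_measure \<and>
     (AE z in hyp_measure. \<exists>!w. w \<in> D \<and> (\<exists>\<gamma>\<in>\<Gamma>. w = moebius \<gamma> z))"

(* Integration over the quotient is integration over a fundamental domain. For \<Gamma>-invariant
   integrands the value does not depend on which one is chosen. *)
definition petersson :: "(int^2^2) set \<Rightarrow> (complex \<Rightarrow> complex) \<Rightarrow> (complex \<Rightarrow> complex) \<Rightarrow> complex" where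
  "petersson \<Gamma> f g =
     (let D = (SOME D. fundamental_domain \<Gamma> D)
      in (LINT z:D|hyp_measure. cnj (f z) * g z) / of_real (measure hyp_measure D))"

definition ht :: "complex \<Rightarrow> real" where
  "ht z = (GREATEST h. \<exists>\<gamma>\<in>carrier SL2Z. h = Im (moebius \<gamma> z))"

definition jacobi_theta :: "complex \<Rightarrow> complex" where
  "jacobi_theta z = of_real (Im z powr (1/4)) *
     (\<Sum>\<^sub>\<infinity>m\<in>(UNIV :: int set). exp (2 * of_real pi * \<i> * (of_int m)\<^sup>2 * z))"

(* The integral matrices of determinant n that lie, modulo N, in the double coset of diag(1, n)
   with respect to the image of \<Gamma>. For the groups Gamma_0(N) and Gamma_1(N) this is the usual
   set of matrices (a b; c d) with determinant n, N dividing c, and gcd(a, N) = 1, respectively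
   a = 1 (mod N); for SL_2(Z), where N = 1, it is the set of all integral matrices of
   determinant n. *)
definition hecke_matrices :: "(int^2^2) set \<Rightarrow> nat \<Rightarrow> nat \<Rightarrow> (int^2^2) set" where
  "hecke_matrices \<Gamma> N n =
     {\<alpha>. det \<alpha> = int n \<and>
        (\<exists>\<gamma>\<in>\<Gamma>. \<exists>\<gamma>'\<in>\<Gamma>. mat_cong N (\<gamma> ** \<alpha> ** \<gamma>') (vector [vector [1, 0], vector [0, int n]]))}"

definition hecke_cosets :: "(int^2^2) set \<Rightarrow> nat \<Rightarrow> nat \<Rightarrow> (int^2^2) set set" where
  "hecke_cosets \<Gamma> N n = (\<lambda>\<alpha>. (\<lambda>\<gamma>. \<gamma> ** \<alpha>) ` \<Gamma>) ` hecke_matrices \<Gamma> N n"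

(* Here N is the level of \<Gamma> and n is coprime to N. For \<Gamma>-invariant f the summand does not
   depend on the representative of the coset. For \<Gamma> = SL_2(Z) the cosets are represented by
   the matrices (a b; 0 d) with a d = n and 0 \<le> b < d. *)
definition hecke :: "(int^2^2) set \<Rightarrow> nat \<Rightarrow> nat \<Rightarrow> (complex \<Rightarrow> complex) \<Rightarrow> complex \<Rightarrow> complex" where
  "hecke \<Gamma> N n f z =
     (\<Sum>c\<in>hecke_cosets \<Gamma> N n. f (moebius (SOME \<alpha>. \<alpha> \<in> c) z)) / of_nat (card (hecke_cosets \<Gamma> N n))"

end

theory Submission
  imports Defs "HOL-Probability.Probability"
begin

text \<open>
  By Poisson summation in one of its two summation variables, \<open>|\<theta>(z)|\<^sup>2\<close> becomes a weighted theta series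
  \<open>\<Theta>\<^sub>t(z) = 1/2 \<Sum> \<chi>(c, d) exp(- (\<pi>/4) t |c z + d|\<^sup>2 / Im z)\<close> over \<open>(c, d) \<in> \<int>\<^sup>2\<close>, at \<open>t = 1\<close>; here \<open>\<chi>\<close> only
  depends on \<open>(c, d)\<close> modulo \<open>4\<close> and is invariant under \<open>\<Gamma>\<^sub>0(4)\<close>. Undone on the other variable, the same
  summation gives \<open>\<Theta>\<^sub>t = \<Theta>\<^bsub>1/t\<^esub> / t\<close>. In terms of lattices, applying the adjoint of \<open>T\<^sub>n\<close> sums over the
  sublattices of index \<open>n\<close> in \<open>\<int>\<^sup>2\<close>, and counting those that contain a given vector shows that it maps
  \<open>\<Theta>\<^sub>1\<close> to \<open>\<sigma>(n)\<^sup>-\<^sup>1 \<Sum> a \<Theta>\<^bsub>a/d\<^esub>\<close>, summed over \<open>n = a d\<close>. Reduction theory gives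
  \<open>\<Theta>\<^sub>t = 1/2 + O((ht(z) / t)\<^sup>1\<^sup>/\<^sup>2)\<close> for \<open>t \<ge> 1\<close>, so with the functional equation each term is
  \<open>max(a, d) / 2 + O((n ht(z))\<^sup>1\<^sup>/\<^sup>2)\<close>. As \<open>\<Sum> max(a, d) = 2 \<sigma>(n) + O(\<tau>(n) n\<^sup>1\<^sup>/\<^sup>2)\<close>, the average is
  \<open>1 + O(\<tau>(n) n\<^sup>-\<^sup>1\<^sup>/\<^sup>2 ht(z)\<^sup>1\<^sup>/\<^sup>2)\<close>. Pairing with \<open>\<phi>\<close> is harmless because \<open>ht\<^sup>1\<^sup>-\<^sup>\<delta>\<close> is integrable
  over the quotient.
\<close>

subsection \<open>Fourier uniqueness and the theta inversion formula\<close>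

text \<open>The operator \<open>hecke\<close> averages over \<Gamma>-cosets of integral matrices
  with arbitrary representatives, so its adjoint cannot be read off term by term. The sum over
  cosets is therefore replaced by a sum over all matrices, with the indicator of the fundamental
  domain inserted; the price is a factor counting the elements of \<Gamma> that act trivially. This
  is done with [0, \<infinity>]-valued integrals, where sums and integrals may be exchanged before
  anything is known to be integrable; signs and complex values are treated afterwards. Neither the
  covolume nor the index of \<Gamma> is computed: all sublattices of index n come from equally many
  cosets, and that multiplicity cancels against the same factor in the number of Hecke cosets, which
  is itself read off from the adjoint identity for the constant 1. A domain of zero or infinite
  volume makes both sides 0, because \<open>measure\<close> and division by 0 then return 0.
  Coprimality to N enters twice: 4 divides N, so n is odd and multiplication by n leaves \<chi>
  unchanged, and every lattice of index n has a basis congruent to diag(n, 1) modulo N.\<close>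

lemma norm_cis_diff_le: "norm (cis a - cis b) \<le> \<bar>a - b\<bar>"
proof -
  have "norm (cis a - cis b) = norm (cis b * (cis (a - b) - 1))"
    by (simp add: algebra_simps cis_mult)
  also have "\<dots> = norm (iexp (a - b) - 1)"
    by (simp add: norm_mult cis_conv_exp)
  also have "\<dots> \<le> \<bar>a - b\<bar>"
    using iexp_approx1[of "a - b" 0] by simp
  finally show ?thesis .
qed

abbreviation unit_lborel :: "real measure" where
  "unit_lborel \<equiv> restrict_space lborel {0..1}"

lemma integral_cis_unit:
  "integral\<^sup>L unit_lborel (\<lambda>x. cis (2 * pi * real_of_int m * x)) = (if m = 0 then 1 else 0)"
proof (cases "m = 0")
  case True
  have "integral\<^sup>L unit_lborel (\<lambda>x. 1 :: complex) = 1"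
    by (simp add: integral_restrict_space measure_restrict_space)
  then show ?thesis using True by simp
next
  case False
  define w where "w = 2 * pi * real_of_int m"
  have w: "w \<noteq> 0" using False by (simp add: w_def)
  have der: "((\<lambda>x. exp (\<i> * of_real w * of_real x) / (\<i> * of_real w)) has_vector_derivative
      exp (\<i> * of_real w * of_real x)) (at x within {0..1})" for x :: real
  proof -
    have "((\<lambda>z. exp (\<i> * of_real w * z) / (\<i> * of_real w)) has_field_derivative
        exp (\<i> * of_real w * of_real x)) (at (of_real x))"
      using w by (auto intro!: derivative_eq_intros simp: field_simps)
    from has_vector_derivative_real_field[OF this] show ?thesis .
  qed
  have "(LBINT x. indicat_real {0..1} x *\<^sub>R exp (\<i> * of_real w * of_real x)) =
      exp (\<i> * of_real w * of_real 1) / (\<i> * of_real w) - exp (\<i> * of_real w * of_real 0) / (\<i> * of_real w)"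
    by (rule integral_FTC_Icc[OF _ der]) (auto intro!: continuous_intros)
  also have "exp (\<i> * of_real w * of_real 1) = (1::complex)"
  proof -
    have "exp (\<i> * of_real w * of_real 1) = cis (2 * pi * real_of_int m)"
      by (simp add: cis_conv_exp w_def)
    also have "\<dots> = 1" using cis_multiple_2pi[of "real_of_int m"] by simp
    finally show ?thesis .
  qed
  finally have "(LBINT x. indicat_real {0..1} x *\<^sub>R exp (\<i> * of_real w * of_real x)) = 0" by simp
  then show ?thesis using False
    by (simp add: integral_restrict_space set_lebesgue_integral_def cis_conv_exp w_def mult_ac)
qed

lemma finite_unit_lborel: "finite_measure unit_lborel"
  by (rule finite_measureI) (simp add: emeasure_restrict_space)

lemma integrable_unit_bounded:
  fixes f :: "real \<Rightarrow> 'a::{banach,second_countable_topology}"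
  assumes "f \<in> borel_measurable unit_lborel" "\<And>x. x \<in> {0..1} \<Longrightarrow> norm (f x) \<le> B"
  shows "integrable unit_lborel f"
proof -
  interpret finite_measure unit_lborel by (rule finite_unit_lborel)
  show ?thesis using assms
    by (intro integrable_const_bound[where B=B]) (auto simp: space_restrict_space AE_restrict_space_iff)
qed

lemma measurable_unit_lborel:
  "f \<in> borel_measurable borel \<Longrightarrow> f \<in> borel_measurable unit_lborel"
  by (simp add: measurable_restrict_space1)

text \<open>A crude form of Jordan's inequality: up to pi/3 the derivative of sin is at least 1/2,
  and beyond it sin is at least 1/2 while y is at most 2. The chord estimate below recovers the loss
  from pi >= 2.\<close>

lemma sin_ge_quarter:
  fixes y :: real
  assumes "0 \<le> y" "y \<le> pi/2" shows "y \<le> 4 * sin y"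
proof (cases "y \<le> pi/3")
  case True
  show ?thesis
  proof (cases "y = 0")
    case False
    then have "0 < y" using assms by simp
    from MVT2[OF this, of sin cos] obtain z where z: "0 < z" "z < y" "sin y - sin 0 = (y - 0) * cos z"
      by (auto intro: DERIV_sin)
    have "cos (pi/3) \<le> cos z"
      using z True by (intro cos_monotone_0_pi_le) auto
    then have "y * (1/2) \<le> y * cos z"
      using \<open>0 < y\<close> by (intro mult_left_mono) (auto simp: cos_60)
    then show ?thesis using z \<open>0 < y\<close> by simp
  qed simp
next
  case False
  have "sin (pi/3) \<le> sin y" 
    using False assms by (intro sin_monotone_2pi_le) auto
  moreover have "1/2 \<le> sin (pi/3)" by (simp add: sin_60)
  moreover have "y \<le> 2" using assms pi_less_4 by simp
  ultimately show ?thesis by linarith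
qed

text \<open>The chord from 1 to \<open>cis (2 * pi * x)\<close> has length 2 sin(pi x), to be
  compared with the distance from x to the nearest integer. This controls the denominator of the
  quotient in the uniqueness argument.\<close>

lemma norm_cis_minus_1_ge:
  fixes x :: real
  assumes "0 \<le> x" "x \<le> 1"
  shows "min x (1 - x) \<le> norm (cis (2 * pi * x) - 1)"
proof -
  have eq: "norm (cis (2 * pi * x) - 1) = 2 * sin (pi * x)"
  proof -
    have "(norm (cis (2 * pi * x) - 1))\<^sup>2 = (cos (2 * (pi * x)) - 1)\<^sup>2 + (sin (2 * (pi * x)))\<^sup>2"
      by (simp add: cmod_power2 mult_ac)
    also have "\<dots> = (cos (2 * (pi * x)))\<^sup>2 + (sin (2 * (pi * x)))\<^sup>2 + 1 - 2 * cos (2 * (pi * x))"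
      by (simp add: power2_eq_square algebra_simps)
    also have "\<dots> = 2 - 2 * cos (2 * (pi * x))" by simp
    also have "\<dots> = (2 * sin (pi * x))\<^sup>2"
      by (simp only: cos_double_sin) (simp add: power2_eq_square)
    finally have "(norm (cis (2 * pi * x) - 1))\<^sup>2 = (2 * sin (pi * x))\<^sup>2" .
    moreover have "0 \<le> sin (pi * x)" using assms by (intro sin_ge_zero) auto
    ultimately show ?thesis by (meson power2_eq_imp_eq norm_ge_zero mult_nonneg_nonneg zero_le_numeral)
  qed
  show ?thesis
  proof (cases "x \<le> 1/2")
    case True
    have "pi * x \<le> 4 * sin (pi * x)" using True assms by (intro sin_ge_quarter) auto
    moreover have "2 * x \<le> pi * x" using assms pi_ge_two by (intro mult_right_mono) auto
    ultimately show ?thesis unfolding eq by linarith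
  next
    case False
    have "pi * (1 - x) \<le> 4 * sin (pi * (1 - x))" using False assms by (intro sin_ge_quarter) auto
    moreover have "sin (pi * (1 - x)) = sin (pi * x)" by (simp add: right_diff_distrib)
    moreover have "2 * (1 - x) \<le> pi * (1 - x)" using assms pi_ge_two by (intro mult_right_mono) auto
    ultimately have "1 - x \<le> 2 * sin (pi * x)"
      by simp
    then show ?thesis unfolding eq by (rule min.coboundedI2)
  qed
qed

text \<open>Chernoff's argument: dividing by \<open>cis (2 * pi * x) - 1\<close> turns the vanishing of the
  coefficients into constancy of the coefficients of the quotient, which Bessel's inequality
  only allows if the constant is zero.\<close>

lemma constant_coefficients_vanish:
  fixes g :: "real \<Rightarrow> complex" and S' :: "int set"
  assumes meas: "g \<in> borel_measurable unit_lborel"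
    and bound: "\<And>x. x \<in> {0..1} \<Longrightarrow> norm (g x) \<le> K"
    and S: "infinite S'"
    and coeff: "\<And>m. m \<in> S' \<Longrightarrow> integral\<^sup>L unit_lborel (\<lambda>x. g x * cis (- (2 * pi * real_of_int m * x))) = A"
  shows "A = 0"
proof (rule ccontr)
  assume "A \<noteq> 0"
  \<comment> \<open>Bessel's inequality: with h the sum of the characters in T, the integral of |g -
    A h|^2 is nonnegative and equals the integral of |g|^2 minus card T |A|^2. Since T can be
    arbitrarily large, A must be 0.\<close>
  have fin_bound: "real (card T) * (norm A)\<^sup>2 \<le> K\<^sup>2" if T: "finite T" "T \<subseteq> S'" for T
  proof -
    define h where "h = (\<lambda>x. \<Sum>m\<in>T. cis (2 * pi * real_of_int m * x))"
    have h_meas [measurable]: "h \<in> borel_measurable unit_lborel"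
      unfolding h_def cis_conv_exp by (intro measurable_unit_lborel) measurable
    note meas [measurable]
    have cnj_meas: "cnj \<in> borel_measurable borel"
      by (intro borel_measurable_continuous_onI continuous_intros)
    have [measurable]: "(\<lambda>x. cnj (g x)) \<in> borel_measurable unit_lborel" "(\<lambda>x. cnj (h x)) \<in> borel_measurable unit_lborel"
      by (rule measurable_compose[OF _ cnj_meas], measurable)+
    have nh: "norm (h x) \<le> real (card T)" for x
      unfolding h_def by (rule order_trans[OF norm_sum]) simp
    have cnjh: "cnj (h x) = (\<Sum>m\<in>T. cis (- (2 * pi * real_of_int m * x)))" for x
      by (simp add: h_def cis_cnj)
    have cm [measurable]: "(\<lambda>x. cis (a * x)) \<in> borel_measurable unit_lborel" for a
      unfolding cis_conv_exp by (intro measurable_unit_lborel) measurable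
    have cm' [measurable]: "(\<lambda>x. cis (- (a * x))) \<in> borel_measurable unit_lborel" for a
      using cm[of "-a"] by simp
    have Kn: "0 \<le> K" using order_trans[OF norm_ge_zero bound[of 0]] by simp
    have gh: "integral\<^sup>L unit_lborel (\<lambda>x. g x * cnj (h x)) = of_nat (card T) * A"
    proof -
      have "integral\<^sup>L unit_lborel (\<lambda>x. g x * cnj (h x)) =
         (\<Sum>m\<in>T. integral\<^sup>L unit_lborel (\<lambda>x. g x * cis (- (2 * pi * real_of_int m * x))))"
        unfolding cnjh sum_distrib_left
        by (intro Bochner_Integration.integral_sum integrable_unit_bounded[where B=K])
           (auto simp: norm_mult bound)
      also have "\<dots> = (\<Sum>m\<in>T. A)" using T by (intro sum.cong) (auto simp: coeff)
      finally show ?thesis by simp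
    qed
    have hh: "integral\<^sup>L unit_lborel (\<lambda>x. h x * cnj (h x)) = of_nat (card T)"
    proof -
      have "integral\<^sup>L unit_lborel (\<lambda>x. h x * cnj (h x)) =
        integral\<^sup>L unit_lborel (\<lambda>x. \<Sum>m\<in>T. \<Sum>k\<in>T. cis (2 * pi * real_of_int (m - k) * x))"
        unfolding cnjh unfolding h_def sum_product cis_mult by (simp add: left_diff_distrib right_diff_distrib)
      also have "\<dots> = (\<Sum>m\<in>T. \<Sum>k\<in>T. integral\<^sup>L unit_lborel (\<lambda>x. cis (2 * pi * real_of_int (m - k) * x)))"
      proof -
        have i: "integrable unit_lborel (\<lambda>x. cis (2 * pi * real_of_int (m - k) * x))" for m k
          by (intro integrable_unit_bounded[where B=1] cm) simp
        show ?thesis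
          by (simp add: i del: of_int_diff)
      qed
      also have "\<dots> = (\<Sum>m\<in>T. \<Sum>k\<in>T. if m = k then 1 else 0)"
        unfolding integral_cis_unit by simp
      also have "\<dots> = of_nat (card T)" using T(1) by simp
      finally show ?thesis .
    qed
    have hg: "integral\<^sup>L unit_lborel (\<lambda>x. cnj (g x) * h x) = of_nat (card T) * cnj A"
      using Bochner_Integration.integral_cnj[of unit_lborel "\<lambda>x. g x * cnj (h x)"] gh by simp
    have i1: "integrable unit_lborel (\<lambda>x. g x * cnj (g x))"
      by (rule integrable_unit_bounded[where B="K*K"]) (auto simp: norm_mult bound Kn intro!: mult_mono)
    have i2: "integrable unit_lborel (\<lambda>x. g x * cnj (h x))" 
      by (rule integrable_unit_bounded[where B="K*card T"]) (auto simp: norm_mult bound Kn nh intro!: mult_mono)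
    have i3: "integrable unit_lborel (\<lambda>x. cnj (g x) * h x)"
      by (rule integrable_unit_bounded[where B="K*card T"]) (auto simp: norm_mult bound Kn nh intro!: mult_mono)
    have i4: "integrable unit_lborel (\<lambda>x. h x * cnj (h x))" 
      by (rule integrable_unit_bounded[where B="card T*card T"]) (auto simp: norm_mult Kn nh intro!: mult_mono)
    have "integral\<^sup>L unit_lborel (\<lambda>x. (g x - A * h x) * cnj (g x - A * h x)) =
       integral\<^sup>L unit_lborel (\<lambda>x. g x * cnj (g x) - cnj A * (g x * cnj (h x)) - A * (cnj (g x) * h x)
          + A * cnj A * (h x * cnj (h x)))"
      by (simp add: algebra_simps)
    also have "\<dots> = integral\<^sup>L unit_lborel (\<lambda>x. g x * cnj (g x)) - cnj A * (of_nat (card T) * A)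
       - A * (of_nat (card T) * cnj A) + A * cnj A * of_nat (card T)"
      using i1 i2 i3 i4 by (simp add: gh hg hh)
    also have "\<dots> = integral\<^sup>L unit_lborel (\<lambda>x. g x * cnj (g x)) - of_nat (card T) * (A * cnj A)"
      by (simp add: algebra_simps)
    finally have eq: "integral\<^sup>L unit_lborel (\<lambda>x. (g x - A * h x) * cnj (g x - A * h x)) = \<dots>" .
    have nn: "0 \<le> Re (integral\<^sup>L unit_lborel (\<lambda>x. u x * cnj (u x)))" for u :: "real \<Rightarrow> complex"
    proof -
      have "integral\<^sup>L unit_lborel (\<lambda>x. u x * cnj (u x)) = integral\<^sup>L unit_lborel (\<lambda>x. of_real ((norm (u x))\<^sup>2))"
        by (intro Bochner_Integration.integral_cong refl) (simp only: complex_norm_square)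
      also have "\<dots> = of_real (integral\<^sup>L unit_lborel (\<lambda>x. (norm (u x))\<^sup>2))"
        by (simp only: integral_complex_of_real)
      finally show ?thesis by simp
    qed
    have gK: "Re (integral\<^sup>L unit_lborel (\<lambda>x. g x * cnj (g x))) \<le> K\<^sup>2"
    proof -
      have *: "norm (integral\<^sup>L unit_lborel (\<lambda>x. g x * cnj (g x))) \<le> integral\<^sup>L unit_lborel (\<lambda>x. norm (g x * cnj (g x)))"
        by (rule integral_norm_bound)
      also have "\<dots> \<le> integral\<^sup>L unit_lborel (\<lambda>x. K\<^sup>2)"
        using i1 by (intro integral_mono integrable_norm)
         (auto simp: norm_mult bound Kn power2_eq_square space_restrict_space 
              intro!: mult_mono finite_measure.integrable_const[OF finite_unit_lborel])
      also have "\<dots> = K\<^sup>2" by (simp add: integral_restrict_space measure_restrict_space)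
      finally show ?thesis using complex_Re_le_cmod order_trans by blast
    qed
    have "0 \<le> Re (integral\<^sup>L unit_lborel (\<lambda>x. g x * cnj (g x)) - of_nat (card T) * (A * cnj A))"
      unfolding eq[symmetric] by (rule nn)
    also have "\<dots> = Re (integral\<^sup>L unit_lborel (\<lambda>x. g x * cnj (g x))) - card T * (norm A)\<^sup>2"
      by (simp add: complex_norm_square[symmetric])
    finally show ?thesis using gK by linarith
  qed
  obtain n :: nat where n: "K\<^sup>2 / (norm A)\<^sup>2 < n" using reals_Archimedean2 by blast
  obtain T where "finite T" "T \<subseteq> S'" "card T = n"
    using infinite_arbitrarily_large[OF S] by metis
  with fin_bound[of T] n \<open>A \<noteq> 0\<close> show False by (simp add: field_simps)
qed

text \<open>Apart from frequency 0, the Fourier coefficients of \<open>d - d 0\<close> vanish. For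
  its quotient g by \<open>cis (2 * pi * x) - 1\<close> this says that neighbouring coefficients
  agree, except for one jump of size \<open>d 0\<close> between -1 and 0. Being constant on each
  side of the jump, they vanish on both sides, and so does the jump. The Lipschitz bound at 0 is
  what keeps g bounded.\<close>

lemma fourier_uniqueness_at_0:
  fixes d :: "real \<Rightarrow> complex"
  assumes per: "\<And>x. d (x + 1) = d x"
    and lip: "\<And>x. x \<in> {-1..1} \<Longrightarrow> norm (d x - d 0) \<le> L * \<bar>x\<bar>"
    and meas [measurable]: "d \<in> borel_measurable unit_lborel"
    and coeff: "\<And>m::int. integral\<^sup>L unit_lborel (\<lambda>x. d x * cis (- (2 * pi * real_of_int m * x))) = 0"
  shows "d 0 = 0"
proof -
  define g where "g = (\<lambda>x. (d x - d 0) / (cis (2 * pi * x) - 1))"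
  have cm [measurable]: "(\<lambda>x. cis (a * x)) \<in> borel_measurable unit_lborel" for a
    unfolding cis_conv_exp by (intro measurable_unit_lborel) measurable
  have cm' [measurable]: "(\<lambda>x. cis (- (a * x))) \<in> borel_measurable unit_lborel" for a
    using cm[of "-a"] by simp
  have g_meas [measurable]: "g \<in> borel_measurable unit_lborel"
    unfolding g_def by measurable
  have L: "0 \<le> L" using order_trans[OF norm_ge_zero lip[of 1]] by simp
  \<comment> \<open>Near x = 1 the Lipschitz bound at 0 is used at x - 1, by periodicity.\<close>
  have dlip: "norm (d x - d 0) \<le> L * min x (1 - x)" if "x \<in> {0..1}" for x
  proof -
    have "norm (d x - d 0) \<le> L * \<bar>x\<bar>" "norm (d (x - 1) - d 0) \<le> L * \<bar>x - 1\<bar>"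
      using lip[of x] lip[of "x - 1"] that by simp_all
    moreover have "d (x - 1) = d x" using per[of "x - 1"] by simp
    ultimately show ?thesis using that by (auto simp: min_def)
  qed
  have g_bound: "norm (g x) \<le> L" if x: "x \<in> {0..1}" for x
  proof (cases "cis (2 * pi * x) = 1")
    case False
    have "norm (d x - d 0) \<le> L * norm (cis (2 * pi * x) - 1)"
      using order_trans[OF dlip[OF x] mult_left_mono[OF norm_cis_minus_1_ge L]] x by auto
    then show ?thesis using False by (simp add: g_def norm_divide field_simps)
  qed (simp add: g_def L)
  \<comment> \<open>Where the denominator vanishes, division returns g x = 0; the identity survives
    because x is then an endpoint and \<open>d x = d 0\<close>.\<close>
  have g_mult: "g x * (cis (2 * pi * x) - 1) = d x - d 0" if x: "x \<in> {0..1}" for x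
  proof (cases "cis (2 * pi * x) = 1")
    case True
    then have "min x (1 - x) \<le> 0" using norm_cis_minus_1_ge[of x] x by auto
    then have "min x (1 - x) = 0" using x by (auto simp: min_def)
    then show ?thesis using dlip[OF x] True by simp
  qed (simp add: g_def)
  define c where "c = (\<lambda>m::int. integral\<^sup>L unit_lborel (\<lambda>x. g x * cis (- (2 * pi * real_of_int m * x))))"
  have d_bound: "norm (d x) \<le> L + norm (d 0)" if "x \<in> {0..1}" for x
  proof -
    have "norm (d x - d 0) \<le> L" using lip[of x] that L mult_left_mono[of x 1 L] by auto
    then show ?thesis using norm_triangle_sub[of "d x" "d 0"] by linarith
  qed
  have step: "c (m - 1) - c m = (if m = 0 then - d 0 else 0)" for m
  proof -
    have "c (m - 1) - c m = integral\<^sup>L unit_lborel (\<lambda>x. g x * cis (- (2 * pi * real_of_int (m - 1) * x))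
         - g x * cis (- (2 * pi * real_of_int m * x)))"
      unfolding c_def
      by (intro Bochner_Integration.integral_diff[symmetric] integrable_unit_bounded[where B=L])
         (auto simp: norm_mult g_bound)
    also have "\<dots> = integral\<^sup>L unit_lborel (\<lambda>x. d x * cis (- (2 * pi * real_of_int m * x)) -
          d 0 * cis (- (2 * pi * real_of_int m * x)))"
    proof (intro Bochner_Integration.integral_cong refl)
      fix x assume "x \<in> space unit_lborel"
      then have x: "x \<in> {0..1}" by (simp add: space_restrict_space)
      have "cis (- (2 * pi * real_of_int (m - 1) * x)) = cis (2 * pi * x) * cis (- (2 * pi * real_of_int m * x))"
        by (simp add: cis_mult algebra_simps)
      moreover have "g x * (w * v) - g x * v = d x * v - d 0 * v" if "g x * (w - 1) = d x - d 0" for w v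
        using arg_cong[OF that, of "\<lambda>t. t * v"] by (simp add: algebra_simps)
      ultimately show "g x * cis (- (2 * pi * real_of_int (m - 1) * x)) - g x * cis (- (2 * pi * real_of_int m * x)) =
         d x * cis (- (2 * pi * real_of_int m * x)) - d 0 * cis (- (2 * pi * real_of_int m * x))"
        using g_mult[OF x] by simp
    qed
    also have "\<dots> = 0 - d 0 * integral\<^sup>L unit_lborel (\<lambda>x. cis (- (2 * pi * real_of_int m * x)))"
      unfolding coeff[of m, symmetric] 
      by (subst Bochner_Integration.integral_diff)
         (auto intro!: integrable_unit_bounded[where B="L + norm (d 0)"] simp: norm_mult d_bound L)
    also have "integral\<^sup>L unit_lborel (\<lambda>x. cis (- (2 * pi * real_of_int m * x))) = (if m = 0 then 1 else 0)"
      using integral_cis_unit[of "-m"] by simp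
    finally show ?thesis by auto
  qed
  have pos: "c (int k) = c 0" for k
  proof (induction k)
    case (Suc k)
    have "c (int (Suc k)) = c (int k)"
      using step[of "1 + int k"] by simp
    then show ?case using Suc by simp
  qed simp
  have neg: "c (- 1 - int k) = c (-1)" for k
  proof (induction k)
    case (Suc k)
    have "c (- 1 - int (Suc k)) = c (- 1 - int k)"
      using step[of "- 1 - int k"] by (simp add: algebra_simps)
    then show ?case using Suc by simp
  qed simp
  have inf1: "infinite (range int)" by (simp add: finite_image_iff)
  have inf2: "infinite (range (\<lambda>k. - 1 - int k))" 
    by (subst finite_image_iff) (auto simp: inj_on_def)
  have "c 0 = 0"
  proof (rule constant_coefficients_vanish[OF g_meas g_bound inf1])
    fix m assume "m \<in> range int"
    then have "c m = c 0" using pos by blast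
    then show "integral\<^sup>L unit_lborel (\<lambda>x. g x * cis (- (2 * pi * real_of_int m * x))) = c 0"
      unfolding c_def .
  qed
  moreover have "c (-1) = 0"
  proof (rule constant_coefficients_vanish[OF g_meas g_bound inf2])
    fix m assume "m \<in> range (\<lambda>k. - 1 - int k)"
    then have "c m = c (-1)" using neg by blast
    then show "integral\<^sup>L unit_lborel (\<lambda>x. g x * cis (- (2 * pi * real_of_int m * x))) = c (-1)"
      unfolding c_def .
  qed
  ultimately show ?thesis using step[of 0] by simp
qed

section \<open>Gaussian sums over the integers and termwise integration\<close>

lemma summable_on_int_inverse_squares:
  assumes "0 < c"
  shows "(\<lambda>k::int. 1 / (1 + c * (real_of_int k)\<^sup>2)) summable_on UNIV"
proof -
  have "(\<lambda>n. 1 / (1 + c * (real n)\<^sup>2)) summable_on UNIV"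
  proof (rule norm_summable_imp_summable_on, rule summable_comparison_test'[where N=1])
    show "summable (\<lambda>n. (1/c) * inverse ((real n)\<^sup>2))"
      by (intro summable_mult inverse_power_summable) simp
    fix n :: nat assume "n \<ge> 1"
    then have "0 < c * (real n)\<^sup>2" using assms by simp
    then show "norm (norm (1 / (1 + c * (real n)\<^sup>2))) \<le> (1/c) * inverse ((real n)\<^sup>2)"
      by (simp add: field_simps abs_of_pos add_pos_pos)
  qed
  then have "(\<lambda>k. 1 / (1 + c * (real_of_int k)\<^sup>2)) summable_on range int"
    "(\<lambda>k. 1 / (1 + c * (real_of_int k)\<^sup>2)) summable_on range (\<lambda>n. - int n)"
    using summable_on_reindex[of int UNIV "\<lambda>k. 1 / (1 + c * (real_of_int k)\<^sup>2)"]
      summable_on_reindex[of "\<lambda>n. - int n" UNIV "\<lambda>k. 1 / (1 + c * (real_of_int k)\<^sup>2)"]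
    by (simp_all add: o_def inj_on_def)
  then have "(\<lambda>k. 1 / (1 + c * (real_of_int k)\<^sup>2)) summable_on (range int \<union> range (\<lambda>n. - int n))"
    by (rule summable_on_union)
  moreover have "range int \<union> range (\<lambda>n. - int n) = UNIV"
    by (metis (no_types, lifting) UNIV_eq_I Un_iff int_cases2 rangeI)
  ultimately show ?thesis by simp
qed

lemma exp_minus_le_inverse: "0 \<le> x \<Longrightarrow> exp (- x) \<le> 1 / (1 + x)" for x :: real
  using exp_ge_add_one_self[of x] by (simp add: exp_minus field_simps)

text \<open>The weight \<open>1 + \<bar>k\<bar>\<close> is what differentiating a Gaussian or a
  character costs in the Lipschitz bounds. With u half the exponent, exp(-2u) <= (1 + u)^(-2); one
  factor 1 + u absorbs the weight, the other gives summability.\<close>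

lemma summable_on_int_gauss:
  assumes "0 < c"
  shows "(\<lambda>k::int. (1 + \<bar>real_of_int k\<bar>) * exp (- (c * (real_of_int k)\<^sup>2))) summable_on UNIV"
proof (rule summable_on_comparison_test)
  define K where "K = 2 * max 1 (2 / c)"
  show "(\<lambda>k::int. K * (1 / (1 + (c/2) * (real_of_int k)\<^sup>2))) summable_on UNIV"
    using assms by (intro summable_on_cmult_right summable_on_int_inverse_squares) simp
  fix k :: int
  define t where "t = \<bar>real_of_int k\<bar>"
  define u where "u = (c/2) * t\<^sup>2"
  have u: "u \<ge> 0" using assms by (simp add: u_def)
  have "1 + t \<le> 2 * (1 + t\<^sup>2)"
  proof -
    have "2 * t \<le> t\<^sup>2 + 1" using zero_le_power2[of "t - 1"] unfolding power2_diff by simp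
    moreover have "0 \<le> t\<^sup>2" by simp
    ultimately show ?thesis by argo
  qed
  also have "\<dots> \<le> K * (1 + u)"
  proof -
    have "1 \<le> max 1 (2/c)" by simp
    moreover have "t\<^sup>2 = (2/c) * u" using assms by (simp add: u_def)
    then have "t\<^sup>2 \<le> max 1 (2/c) * u" using u mult_right_mono[of "2/c" "max 1 (2/c)" u] by simp
    ultimately show ?thesis by (simp add: K_def distrib_left)
  qed
  finally have 1: "1 + t \<le> K * (1 + u)" .
  have "exp (- (c * t\<^sup>2)) = exp (- u) * exp (- u)" by (simp add: u_def flip: exp_add)
  also have "\<dots> \<le> 1 / (1 + u) * (1 / (1 + u))"
    using exp_minus_le_inverse[OF u] u by (intro mult_mono) auto
  finally have "(1 + t) * exp (- (c * t\<^sup>2)) \<le> (K * (1 + u)) * (1 / (1 + u) * (1 / (1 + u)))"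
    using 1 u by (intro mult_mono) (auto simp: K_def)
  also have "\<dots> = K * (1 / (1 + u))" using u by simp
  finally show "(1 + \<bar>real_of_int k\<bar>) * exp (- (c * (real_of_int k)\<^sup>2)) \<le> K * (1 / (1 + (c/2) * (real_of_int k)\<^sup>2))"
    by (simp add: t_def u_def)
qed simp

lemma summable_on_int_gauss':
  assumes "0 < c"
  shows "(\<lambda>k::int. exp (- (c * (real_of_int k)\<^sup>2))) summable_on UNIV"
  by (rule summable_on_comparison_test[OF summable_on_int_gauss[OF assms]]) auto

text \<open>Reindexing by \<open>int_decode\<close> turns the exchange of sum and integral into the
  one for series over the naturals, which needs absolute convergence both pointwise and after
  integration.\<close>

lemma integral_has_sum_int:
  fixes f :: "int \<Rightarrow> 'a \<Rightarrow> complex"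
  assumes int: "\<And>k. integrable M (f k)"
    and ptw: "\<And>x. x \<in> space M \<Longrightarrow> (\<lambda>k. norm (f k x)) summable_on UNIV"
    and sum: "(\<lambda>k. \<integral>x. norm (f k x) \<partial>M) summable_on UNIV"
  shows "((\<lambda>k. integral\<^sup>L M (f k)) has_sum (\<integral>x. (\<Sum>\<^sub>\<infinity>k. f k x) \<partial>M)) UNIV"
proof -
  have nat_sum: "summable (\<lambda>n. g (int_decode n))" if "g summable_on (UNIV :: int set)" "\<And>k. g k \<ge> 0" for g :: "int \<Rightarrow> real"
  proof -
    have "(\<lambda>n. g (int_decode n)) summable_on UNIV"
      using that(1) summable_on_reindex_bij_betw[OF bij_int_decode, of g] by simp
    then show ?thesis using that(2) by (simp add: summable_on_UNIV_nonneg_real_iff)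
  qed
  have eq: "(\<Sum>\<^sub>\<infinity>k. f k x) = (\<Sum>n. f (int_decode n) x)" if "x \<in> space M" for x
  proof -
    have *: "summable (\<lambda>n. norm (f (int_decode n) x))"
      using nat_sum[OF ptw[OF that]] by simp
    have "(\<Sum>\<^sub>\<infinity>k. f k x) = (\<Sum>\<^sub>\<infinity>n. f (int_decode n) x)"
      using infsum_reindex_bij_betw[OF bij_int_decode, of "\<lambda>k. f k x"] by simp
    also have "\<dots> = (\<Sum>n. f (int_decode n) x)"
      using * by (intro infsumI norm_summable_imp_has_sum) (auto intro: summable_norm_cancel)
    finally show ?thesis .
  qed
  have s2: "summable (\<lambda>n. \<integral>x. norm (f (int_decode n) x) \<partial>M)"
    using nat_sum[OF sum] by simp
  have "(\<integral>x. (\<Sum>\<^sub>\<infinity>k. f k x) \<partial>M) = (\<integral>x. (\<Sum>n. f (int_decode n) x) \<partial>M)"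
    using eq by (intro Bochner_Integration.integral_cong) auto
  also have "\<dots> = (\<Sum>n. integral\<^sup>L M (f (int_decode n)))"
    using nat_sum[OF ptw] by (intro integral_suminf int s2) auto
  finally have *: "(\<integral>x. (\<Sum>\<^sub>\<infinity>k. f k x) \<partial>M) = (\<Sum>n. integral\<^sup>L M (f (int_decode n)))" .
  have s3: "summable (\<lambda>n. norm (integral\<^sup>L M (f (int_decode n))))"
    by (rule summable_comparison_test'[OF s2, of 0]) (auto intro: integral_norm_bound)
  have "((\<lambda>n. integral\<^sup>L M (f (int_decode n))) has_sum (\<integral>x. (\<Sum>\<^sub>\<infinity>k. f k x) \<partial>M)) UNIV"
    unfolding * using s3 by (intro norm_summable_imp_has_sum) (auto intro: summable_norm_cancel summable_sums)
  then show ?thesis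
    using has_sum_reindex_bij_betw[OF bij_int_decode, of "\<lambda>k. integral\<^sup>L M (f k)"] by simp
qed

text \<open>A single summable majorant bounds the terms and their Lipschitz constants. Continuity of
  the two sides of the inversion formula and the Lipschitz condition for Fourier uniqueness both
  come from this.\<close>

lemma lipschitz_infsum:
  fixes f :: "int \<Rightarrow> real \<Rightarrow> complex"
  assumes b: "b summable_on UNIV"
    and bound: "\<And>k x. x \<in> X \<Longrightarrow> norm (f k x) \<le> b k"
    and lip: "\<And>k x y. x \<in> X \<Longrightarrow> y \<in> X \<Longrightarrow> norm (f k x - f k y) \<le> b k * \<bar>x - y\<bar>"
    and xy: "x \<in> X" "y \<in> X"
  shows "norm ((\<Sum>\<^sub>\<infinity>k. f k x) - (\<Sum>\<^sub>\<infinity>k. f k y)) \<le> infsum b UNIV * \<bar>x - y\<bar>"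
proof -
  have s: "(\<lambda>k. f k z) summable_on UNIV" if "z \<in> X" for z
    by (rule abs_summable_summable, rule summable_on_comparison_test[OF b]) (auto intro: bound that)
  have bb: "(\<lambda>k. b k * \<bar>x - y\<bar>) summable_on UNIV" using b by (rule summable_on_cmult_left)
  have dn: "(\<lambda>k. norm (f k x - f k y)) summable_on UNIV"
    by (rule summable_on_comparison_test[OF bb]) (auto intro: lip xy)
  have "(\<Sum>\<^sub>\<infinity>k. f k x) - (\<Sum>\<^sub>\<infinity>k. f k y) = (\<Sum>\<^sub>\<infinity>k. f k x - f k y)"
    using infsum_add[OF s[OF xy(1)], of "\<lambda>k. - f k y"] s[OF xy(2)]
    by (simp add: infsum_uminus summable_on_uminus)
  also have "norm \<dots> \<le> (\<Sum>\<^sub>\<infinity>k. norm (f k x - f k y))"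
    by (intro norm_infsum_bound dn)
  also have "\<dots> \<le> (\<Sum>\<^sub>\<infinity>k. b k * \<bar>x - y\<bar>)"
    by (intro infsum_mono bb dn lip xy)
  also have "\<dots> = infsum b UNIV * \<bar>x - y\<bar>"
    using b by (simp add: infsum_cmult_left)
  finally show ?thesis .
qed

text \<open>A rescaling of the characteristic function of the standard normal distribution: with c =
  sqrt(2 pi s), the normal density at c u is exp(-pi s u^2) / sqrt(2 pi).\<close>

lemma gauss_fourier_transform:
  assumes s: "0 < s"
  shows "integrable lborel (\<lambda>u. complex_of_real (exp (- (pi * s * u\<^sup>2))) * cis (- (2 * pi * m * u)))" (is ?A)
    and "(LBINT u. complex_of_real (exp (- (pi * s * u\<^sup>2))) * cis (- (2 * pi * m * u))) =
      complex_of_real (exp (- (pi * m\<^sup>2 / s)) / sqrt s)" (is ?B)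
proof -
  define c where "c = sqrt (2 * pi * s)"
  have c: "c > 0" and c2: "c\<^sup>2 = 2 * pi * s" using s by (auto simp: c_def)
  define t where "t = - (2 * pi * m / c)"
  let ?g = "\<lambda>x. complex_of_real (std_normal_density x) * iexp (t * x)"
  have int_g: "integrable lborel ?g"
  proof (rule Bochner_Integration.integrable_bound)
    show "integrable lborel std_normal_density"
      using integrable_std_normal_moment[of 0] by simp
    show "AE x in lborel. norm (?g x) \<le> norm (std_normal_density x)"
      by (simp add: norm_mult)
  qed measurable
  have "(LBINT x. ?g x) = char std_normal_distribution t"
    unfolding char_def by (subst integral_density) (auto simp: scaleR_conv_of_real)
  then have val: "(LBINT x. ?g x) = complex_of_real (exp (- (t\<^sup>2 / 2)))"
    by (simp add: char_std_normal_distribution)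
  have g: "?g (0 + c * u) = complex_of_real (1 / sqrt (2 * pi)) * 
      (complex_of_real (exp (- (pi * s * u\<^sup>2))) * cis (- (2 * pi * m * u)))" for u
  proof -
    have "(c * u)\<^sup>2 / 2 = pi * s * u\<^sup>2" by (simp add: power_mult_distrib c2)
    moreover have "t * (c * u) = - (2 * pi * m * u)" using c by (simp add: t_def)
    ultimately show ?thesis
      by (simp add: std_normal_density_def cis_conv_exp)
  qed
  have "integrable lborel (\<lambda>u. ?g (0 + c * u))"
    using lborel_integrable_real_affine[OF int_g, of c 0] c by simp
  then have "integrable lborel (\<lambda>u. complex_of_real (sqrt (2 * pi)) * ?g (0 + c * u))"
    by (rule integrable_mult_right)
  then show ?A
    unfolding g mult.assoc[symmetric] of_real_mult[symmetric] by simp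
  have "(LBINT x. ?g x) = \<bar>c\<bar> *\<^sub>R (LBINT u. ?g (0 + c * u))"
    using lborel_integral_real_affine[of c ?g 0] c by simp
  also have "\<dots> = complex_of_real (c / sqrt (2 * pi)) * 
     (LBINT u. complex_of_real (exp (- (pi * s * u\<^sup>2))) * cis (- (2 * pi * m * u)))"
    unfolding g using c by (simp add: scaleR_conv_of_real)
  also have "c / sqrt (2 * pi) = sqrt s" by (simp add: c_def real_sqrt_mult)
  finally have "complex_of_real (sqrt s) * (LBINT u. complex_of_real (exp (- (pi * s * u\<^sup>2))) * cis (- (2 * pi * m * u))) 
     = complex_of_real (exp (- (t\<^sup>2 / 2)))" using val by simp
  moreover have "t\<^sup>2 / 2 = pi * m\<^sup>2 / s"
  proof -
    have "t\<^sup>2 = (2 * pi * m)\<^sup>2 / c\<^sup>2" by (simp add: t_def power_divide)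
    also have "\<dots> / 2 = pi * m\<^sup>2 / s" unfolding c2 using s by (simp add: power2_eq_square field_simps)
    finally show ?thesis .
  qed
  ultimately show ?B using s by (simp add: field_simps)
qed

text \<open>Poisson summation. With a replaced by x + a, both sides are Lipschitz, 1-periodic
  functions of x. The right side is written as a Fourier series; the coefficients of the left side
  unfold to integrals of a Gaussian over the whole line and are the same. The difference d of the
  two sides thus vanishes at 0.\<close>

theorem jacobi_inversion:
  assumes s: "0 < s"
  shows "(\<Sum>\<^sub>\<infinity>k::int. complex_of_real (exp (- (pi * s * (real_of_int k + a)\<^sup>2)))) =
    (\<Sum>\<^sub>\<infinity>m::int. complex_of_real (exp (- (pi * (real_of_int m)\<^sup>2 / s)) / sqrt s) * cis (2 * pi * real_of_int m * a))"
    (is "?L = ?R")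
proof -
  define f where "f = (\<lambda>(k::int) x. complex_of_real (exp (- (pi * s * (real_of_int k + (x + a))\<^sup>2))))"
  define q where "q = (\<lambda>m::int. exp (- (pi * (real_of_int m)\<^sup>2 / s)) / sqrt s)"
  define h where "h = (\<lambda>(m::int) x. complex_of_real (q m) * cis (2 * pi * real_of_int m * (x + a)))"
  define R where "R = 1 + \<bar>a\<bar>"
  define X :: "real set" where "X = {-1..1}"
  \<comment> \<open>The factors dominate both the Gaussian term and its derivative, which brings
    down 2 pi s |k + x + a|; R bounds |x + a| for x in [-1, 1].\<close>
  define bf where "bf = (\<lambda>k::int. (1 + 2 * pi * s) * exp (pi * s * R\<^sup>2) * (1 + R) * 
     ((1 + \<bar>real_of_int k\<bar>) * exp (- ((pi * s / 2) * (real_of_int k)\<^sup>2))))"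
  define bh where "bh = (\<lambda>m::int. (2 * pi / sqrt s) * ((1 + \<bar>real_of_int m\<bar>) * exp (- ((pi / s) * (real_of_int m)\<^sup>2))))"
  have R: "R \<ge> 1" by (simp add: R_def)
  have xaR: "\<bar>x + a\<bar> \<le> R" if "x \<in> X" for x using that by (auto simp: X_def R_def)
  have sum_bf: "bf summable_on UNIV"
    unfolding bf_def using s by (intro summable_on_cmult_right summable_on_int_gauss) simp
  have sum_bh: "bh summable_on UNIV"
    unfolding bh_def using s by (intro summable_on_cmult_right summable_on_int_gauss) simp
  \<comment> \<open>The difference of (k + r)^2 and k^2/2 - r^2 is (k + 2r)^2 / 2, hence
    nonnegative.\<close>
  have exp_f: "exp (- (pi * s * (real_of_int k + r)\<^sup>2)) \<le> exp (pi * s * R\<^sup>2) * exp (- ((pi * s / 2) * (real_of_int k)\<^sup>2))"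
    if "\<bar>r\<bar> \<le> R" for k r
  proof -
    have "r\<^sup>2 \<le> R\<^sup>2" using that R by (simp add: abs_le_square_iff[symmetric])
    moreover have "0 \<le> (real_of_int k + 2 * r)\<^sup>2" by simp
    ultimately have "(real_of_int k)\<^sup>2 / 2 - R\<^sup>2 \<le> (real_of_int k + r)\<^sup>2"
      by (simp add: power2_eq_square algebra_simps)
    then have "(pi * s) * ((real_of_int k)\<^sup>2 / 2 - R\<^sup>2) \<le> (pi * s) * (real_of_int k + r)\<^sup>2"
      using s by (intro mult_left_mono) auto
    then show ?thesis by (simp add: exp_add[symmetric] algebra_simps)
  qed
  have kr: "\<bar>real_of_int k + r\<bar> \<le> (1 + R) * (1 + \<bar>real_of_int k\<bar>)" if "\<bar>r\<bar> \<le> R" for k r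
  proof -
    have "\<bar>real_of_int k + r\<bar> \<le> \<bar>real_of_int k\<bar> + R" using that by linarith
    also have "\<dots> \<le> (1 + R) * (1 + \<bar>real_of_int k\<bar>)" using R by (simp add: algebra_simps)
    finally show ?thesis .
  qed
  have bf_f: "norm (f k x) \<le> bf k" if "x \<in> X" for k x
  proof -
    have "norm (f k x) \<le> exp (pi * s * R\<^sup>2) * exp (- ((pi * s / 2) * (real_of_int k)\<^sup>2))"
      using exp_f[OF xaR[OF that]] by (simp add: f_def)
    also have "\<dots> \<le> ((1 + 2 * pi * s) * (1 + R) * (1 + \<bar>real_of_int k\<bar>)) * (exp (pi * s * R\<^sup>2) * exp (- ((pi * s / 2) * (real_of_int k)\<^sup>2)))"
    proof -
      have "1 * 1 * 1 \<le> (1 + 2 * pi * s) * (1 + R) * (1 + \<bar>real_of_int k\<bar>)"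
        using s R by (intro mult_mono) auto
      then show ?thesis using mult_right_mono[of 1 _ "exp (pi * s * R\<^sup>2) * exp (- ((pi * s / 2) * (real_of_int k)\<^sup>2))"] by simp
    qed
    finally show ?thesis by (simp add: bf_def mult_ac)
  qed
  have lip_f: "norm (f k x - f k y) \<le> bf k * \<bar>x - y\<bar>" if xy: "x \<in> X" "y \<in> X" for k x y
  proof -
    define p where "p = (\<lambda>x. exp (- (pi * s * (real_of_int k + (x + a))\<^sup>2)))"
    define p' where "p' = (\<lambda>x. - (2 * pi * s * (real_of_int k + (x + a))) * p x)"
    have "norm (p x - p y) \<le> bf k * norm (x - y)"
    proof (rule field_differentiable_bound[where S = X and f' = p'])
      show "convex X" by (simp add: X_def)
      fix z assume z: "z \<in> X"
      show "(p has_field_derivative p' z) (at z within X)"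
        unfolding p_def p'_def by (auto intro!: derivative_eq_intros simp: power2_eq_square)
      have "norm (p' z) = (2 * pi * s) * (\<bar>real_of_int k + (z + a)\<bar> * p z)"
        using s by (simp add: p'_def p_def abs_mult)
      also have "\<dots> \<le> (1 + 2 * pi * s) * (((1 + R) * (1 + \<bar>real_of_int k\<bar>)) * (exp (pi * s * R\<^sup>2) * exp (- ((pi * s / 2) * (real_of_int k)\<^sup>2))))"
        unfolding p_def using s R kr[OF xaR[OF z]] exp_f[OF xaR[OF z]] by (intro mult_mono) auto
      also have "\<dots> = bf k" by (simp add: bf_def mult_ac)
      finally show "norm (p' z) \<le> bf k" .
    qed (use xy in auto)
    moreover have "norm (f k x - f k y) = norm (p x - p y)"
      by (simp add: f_def p_def norm_of_real flip: of_real_diff)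
    ultimately show ?thesis by simp
  qed
  have q_bh: "q m * (2 * pi * (1 + \<bar>real_of_int m\<bar>)) = bh m" for m
    by (simp add: q_def bh_def mult_ac)
  have q0: "0 \<le> q m" for m using s by (simp add: q_def)
  have bf_h: "norm (h m x) \<le> bh m" for m x
  proof -
    have "norm (h m x) = q m * 1" using q0 by (simp add: h_def norm_mult)
    also have "\<dots> \<le> q m * (2 * pi * (1 + \<bar>real_of_int m\<bar>))"
    proof (rule mult_left_mono[OF _ q0])
      have "1 * 1 \<le> (2 * pi) * (1 + \<bar>real_of_int m\<bar>)"
        using pi_ge_two by (intro mult_mono) auto
      then show "1 \<le> 2 * pi * (1 + \<bar>real_of_int m\<bar>)" by simp
    qed
    finally show ?thesis unfolding q_bh .
  qed
  have lip_h: "norm (h m x - h m y) \<le> bh m * \<bar>x - y\<bar>" for m x y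
  proof -
    have "norm (h m x - h m y) = q m * norm (cis (2 * pi * real_of_int m * (x + a)) - cis (2 * pi * real_of_int m * (y + a)))"
      using q0 by (simp add: h_def norm_mult flip: right_diff_distrib)
    also have "\<dots> \<le> q m * \<bar>2 * pi * real_of_int m * (x + a) - 2 * pi * real_of_int m * (y + a)\<bar>"
      by (intro mult_left_mono q0 norm_cis_diff_le)
    also have "2 * pi * real_of_int m * (x + a) - 2 * pi * real_of_int m * (y + a) = 2 * pi * real_of_int m * (x - y)"
      by (simp add: algebra_simps)
    also have "\<bar>\<dots>\<bar> = 2 * pi * \<bar>real_of_int m\<bar> * \<bar>x - y\<bar>" by (simp add: abs_mult)
    also have "q m * \<dots> \<le> q m * ((2 * pi * (1 + \<bar>real_of_int m\<bar>)) * \<bar>x - y\<bar>)"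
      by (intro mult_left_mono q0 mult_right_mono) auto
    finally show ?thesis unfolding q_bh[symmetric] by (simp add: mult.assoc)
  qed
  define d where "d = (\<lambda>x. (\<Sum>\<^sub>\<infinity>k. f k x) - (\<Sum>\<^sub>\<infinity>m. h m x))"
  define L where "L = infsum bf UNIV + infsum bh UNIV"
  have lip_d: "norm (d x - d y) \<le> L * \<bar>x - y\<bar>" if "x \<in> X" "y \<in> X" for x y
  proof -
    have 1: "norm ((\<Sum>\<^sub>\<infinity>k. f k x) - (\<Sum>\<^sub>\<infinity>k. f k y)) \<le> infsum bf UNIV * \<bar>x - y\<bar>"
      by (rule lipschitz_infsum[OF sum_bf bf_f lip_f]) (use that in auto)
    have 2: "norm ((\<Sum>\<^sub>\<infinity>k. h k x) - (\<Sum>\<^sub>\<infinity>k. h k y)) \<le> infsum bh UNIV * \<bar>x - y\<bar>"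
      by (rule lipschitz_infsum[OF sum_bh bf_h lip_h]) (use that in auto)
    have "d x - d y = ((\<Sum>\<^sub>\<infinity>k. f k x) - (\<Sum>\<^sub>\<infinity>k. f k y)) - ((\<Sum>\<^sub>\<infinity>k. h k x) - (\<Sum>\<^sub>\<infinity>k. h k y))"
      by (simp add: d_def)
    then have "norm (d x - d y) \<le> norm ((\<Sum>\<^sub>\<infinity>k. f k x) - (\<Sum>\<^sub>\<infinity>k. f k y)) + norm ((\<Sum>\<^sub>\<infinity>k. h k x) - (\<Sum>\<^sub>\<infinity>k. h k y))"
      by (simp only: norm_triangle_ineq4)
    then show ?thesis using 1 2 unfolding L_def distrib_right by linarith
  qed
  have cont_f: "continuous_on X (\<lambda>x. \<Sum>\<^sub>\<infinity>k. f k x)"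
  proof (rule lipschitz_on_continuous_on, rule lipschitz_onI)
    show "dist (\<Sum>\<^sub>\<infinity>k. f k x) (\<Sum>\<^sub>\<infinity>k. f k y) \<le> infsum bf UNIV * dist x y" if "x \<in> X" "y \<in> X" for x y
      unfolding dist_norm real_norm_def by (rule lipschitz_infsum[OF sum_bf bf_f lip_f]) (use that in auto)
    show "0 \<le> infsum bf UNIV"
      using s R by (intro infsum_nonneg) (auto simp: bf_def)
  qed
  have cont_h: "continuous_on X (\<lambda>x. \<Sum>\<^sub>\<infinity>k. h k x)"
  proof (rule lipschitz_on_continuous_on, rule lipschitz_onI)
    show "dist (\<Sum>\<^sub>\<infinity>k. h k x) (\<Sum>\<^sub>\<infinity>k. h k y) \<le> infsum bh UNIV * dist x y" if "x \<in> X" "y \<in> X" for x y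
      unfolding dist_norm real_norm_def by (rule lipschitz_infsum[OF sum_bh bf_h lip_h]) (use that in auto)
    show "0 \<le> infsum bh UNIV"
      using s by (intro infsum_nonneg) (auto simp: bh_def)
  qed
  have cont_d: "continuous_on X d"
    unfolding d_def by (intro continuous_on_diff cont_f cont_h)
  have unitX: "{0..1} \<subseteq> X" by (auto simp: X_def)
  have meas_unit: "g \<in> borel_measurable unit_lborel" if "continuous_on {0..1} g" for g :: "real \<Rightarrow> complex"
  proof -
    have "g \<in> borel_measurable (restrict_space borel {0..1})"
      using that by (rule borel_measurable_continuous_on_restrict)
    moreover have "sets (restrict_space borel {0..1::real}) = sets unit_lborel"
      by (rule sets_restrict_space_cong) simp
    ultimately show ?thesis using measurable_cong_sets by blast
  qed
  have "d 0 = 0"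
  proof (rule fourier_uniqueness_at_0[where L = L])
    fix x
    show "d (x + 1) = d x"
    proof -
      have "(\<Sum>\<^sub>\<infinity>k. f k (x + 1)) = (\<Sum>\<^sub>\<infinity>k. f (k + 1) x)"
        by (simp add: f_def algebra_simps)
      also have "\<dots> = (\<Sum>\<^sub>\<infinity>k. f k x)"
        by (rule infsum_reindex_bij_betw[of "\<lambda>k. k + 1" UNIV UNIV "\<lambda>k. f k x"])
           (auto intro!: bij_betwI[where g = "\<lambda>k. k - 1"])
      finally have 1: "(\<Sum>\<^sub>\<infinity>k. f k (x + 1)) = (\<Sum>\<^sub>\<infinity>k. f k x)" .
      have 2: "h m (x + 1) = h m x" for m
      proof -
        have "cis (2 * pi * real_of_int m * (x + 1 + a)) = cis (2 * pi * real_of_int m * (x + a)) * cis (2 * pi * real_of_int m)"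
          by (simp add: cis_mult algebra_simps)
        also have "cis (2 * pi * real_of_int m) = 1"
          using cis_multiple_2pi[of "real_of_int m"] by simp
        finally show ?thesis by (simp add: h_def)
      qed
      show ?thesis by (simp add: d_def 1 2)
    qed
    show "norm (d x - d 0) \<le> L * \<bar>x\<bar>" if "x \<in> {-1..1}"
      using lip_d[of x 0] that by (simp add: X_def)
  next
    show "d \<in> borel_measurable unit_lborel"
      by (rule meas_unit[OF continuous_on_subset[OF cont_d unitX]])
  next
    fix m :: int
    let ?e = "\<lambda>x. cis (- (2 * pi * real_of_int m * x))"
    have e_cont: "continuous_on {0..1} ?e"
      by (intro continuous_intros)
    have f_cont: "continuous_on {0..1} (\<lambda>x. f k x * ?e x)" for k
      unfolding f_def by (intro continuous_intros)
    have h_cont: "continuous_on {0..1} (\<lambda>x. h k x * ?e x)" for k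
      unfolding h_def by (intro continuous_intros)
    have sp: "x \<in> X" if "x \<in> space unit_lborel" for x 
      using that by (auto simp: space_restrict_space X_def)
    have i_f: "integrable unit_lborel (\<lambda>x. f k x * ?e x)" for k
      by (rule integrable_unit_bounded[where B="bf k"]) (use meas_unit[OF f_cont] unitX in \<open>auto simp: norm_mult bf_f\<close>)
    have i_h: "integrable unit_lborel (\<lambda>x. h k x * ?e x)" for k
      by (rule integrable_unit_bounded[where B="bh k"]) (use meas_unit[OF h_cont] unitX in \<open>auto simp: norm_mult bf_h\<close>)
    have nint: "(\<integral>x. norm (g x) \<partial>unit_lborel) \<le> B" if "integrable unit_lborel g" "\<And>x. x \<in> X \<Longrightarrow> norm (g x) \<le> B" for g :: "real \<Rightarrow> complex" and B
    proof -
      have "(\<integral>x. norm (g x) \<partial>unit_lborel) \<le> (\<integral>x. B \<partial>unit_lborel)"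
        by (intro integral_mono integrable_norm that finite_measure.integrable_const[OF finite_unit_lborel] sp)
      also have "\<dots> = B" by (simp add: integral_restrict_space measure_restrict_space)
      finally show ?thesis .
    qed
    have hs_f: "((\<lambda>k. integral\<^sup>L unit_lborel (\<lambda>x. f k x * ?e x)) has_sum (\<integral>x. (\<Sum>\<^sub>\<infinity>k. f k x * ?e x) \<partial>unit_lborel)) UNIV"
    proof (rule integral_has_sum_int[OF i_f])
      fix x assume "x \<in> space unit_lborel"
      then show "(\<lambda>k. norm (f k x * ?e x)) summable_on UNIV"
        by (intro summable_on_comparison_test[OF sum_bf]) (auto simp: norm_mult bf_f sp)
    next
      show "(\<lambda>k. \<integral>x. norm (f k x * ?e x) \<partial>unit_lborel) summable_on UNIV"
        by (intro summable_on_comparison_test[OF sum_bf] nint i_f) (auto simp: norm_mult bf_f)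
    qed
    have hs_h: "((\<lambda>k. integral\<^sup>L unit_lborel (\<lambda>x. h k x * ?e x)) has_sum (\<integral>x. (\<Sum>\<^sub>\<infinity>k. h k x * ?e x) \<partial>unit_lborel)) UNIV"
    proof (rule integral_has_sum_int[OF i_h])
      fix x assume "x \<in> space unit_lborel"
      then show "(\<lambda>k. norm (h k x * ?e x)) summable_on UNIV"
        by (intro summable_on_comparison_test[OF sum_bh]) (auto simp: norm_mult bf_h)
    next
      show "(\<lambda>k. \<integral>x. norm (h k x * ?e x) \<partial>unit_lborel) summable_on UNIV"
        by (intro summable_on_comparison_test[OF sum_bh] nint i_h) (auto simp: norm_mult bf_h)
    qed
    have coeff_h: "(\<integral>x. (\<Sum>\<^sub>\<infinity>k. h k x * ?e x) \<partial>unit_lborel) = complex_of_real (q m) * cis (2 * pi * real_of_int m * a)"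
    proof -
      have tm: "integral\<^sup>L unit_lborel (\<lambda>x. h k x * ?e x) = (if k = m then complex_of_real (q m) * cis (2 * pi * real_of_int m * a) else 0)" for k
      proof -
        have "h k x * ?e x = (complex_of_real (q k) * cis (2 * pi * real_of_int k * a)) * cis (2 * pi * real_of_int (k - m) * x)" for x
        proof -
          have "cis (2 * pi * real_of_int k * (x + a)) * ?e x = cis (2 * pi * real_of_int k * a) * cis (2 * pi * real_of_int (k - m) * x)"
            by (simp add: cis_mult algebra_simps)
          then show ?thesis by (simp add: h_def mult.assoc)
        qed
        then have "integral\<^sup>L unit_lborel (\<lambda>x. h k x * ?e x) = (complex_of_real (q k) * cis (2 * pi * real_of_int k * a)) * integral\<^sup>L unit_lborel (\<lambda>x. cis (2 * pi * real_of_int (k - m) * x))"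
          by (simp del: of_int_diff)
        then show ?thesis unfolding integral_cis_unit by simp
      qed
      have "((\<lambda>k. if k = m then complex_of_real (q m) * cis (2 * pi * real_of_int m * a) else 0) has_sum (complex_of_real (q m) * cis (2 * pi * real_of_int m * a))) UNIV"
        by (rule has_sum_finite_neutralI[of "{m}"]) auto
      then show ?thesis using hs_h unfolding tm by (rule has_sum_unique[symmetric])
    qed
    have coeff_f: "(\<integral>x. (\<Sum>\<^sub>\<infinity>k. f k x * ?e x) \<partial>unit_lborel) = complex_of_real (q m) * cis (2 * pi * real_of_int m * a)"
    proof -
      define G where "G = (\<lambda>u. complex_of_real (exp (- (pi * s * u\<^sup>2))) * cis (- (2 * pi * real_of_int m * u)))"
      \<comment> \<open>Half-open intervals make every u lie in exactly one of them. The endpoint by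
        which they differ from the closed unit interval is a null set.\<close>
      define J where "J = (\<lambda>(k::int) u. indicat_real {a + k..<a + k + 1} u *\<^sub>R (G u * cis (2 * pi * real_of_int m * a)))"
      have G_int: "integrable lborel G" 
        unfolding G_def by (rule gauss_fourier_transform(1)[OF s])
      have G_val: "integral\<^sup>L lborel G = complex_of_real (q m)"
        unfolding G_def q_def by (rule gauss_fourier_transform(2)[OF s])
      have J_int: "integrable lborel (J k)" for k
        unfolding J_def using G_int by (intro integrable_mult_indicator integrable_mult_left) auto
      have "integral\<^sup>L unit_lborel (\<lambda>x. f k x * ?e x) = integral\<^sup>L lborel (J k)" for k
      proof -
        have eq: "f k x * ?e x = G (real_of_int k + (x + a)) * cis (2 * pi * real_of_int m * a)" for x
        proof -
          have "cis (- (2 * pi * real_of_int m * (real_of_int k + (x + a)))) * cis (2 * pi * real_of_int m * a) = ?e x * cis (- (2 * pi * real_of_int (m * k)))"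
            by (simp add: cis_mult algebra_simps)
          also have "cis (- (2 * pi * real_of_int (m * k))) = 1"
            using cis_multiple_2pi[of "real_of_int (- (m * k))"] by simp
          finally show ?thesis by (simp add: f_def G_def mult.assoc)
        qed
        have "integral\<^sup>L unit_lborel (\<lambda>x. f k x * ?e x) = (LBINT x. indicat_real {0..1} x *\<^sub>R (f k x * ?e x))"
          by (simp add: integral_restrict_space set_lebesgue_integral_def)
        also have "\<dots> = (LBINT x. J k ((a + k) + 1 * x))"
        proof (rule integral_cong_AE)
          have J_meas: "J k \<in> borel_measurable lborel" using J_int by (rule borel_measurable_integrable)
          show "(\<lambda>x. indicat_real {0..1} x *\<^sub>R (f k x * ?e x)) \<in> borel_measurable lborel"
            unfolding f_def cis_conv_exp by measurable
          show "(\<lambda>x. J k ((a + k) + 1 * x)) \<in> borel_measurable lborel"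
            using J_meas by simp
          show "AE x in lborel. indicat_real {0..1} x *\<^sub>R (f k x * ?e x) = J k ((a + k) + 1 * x)"
            using AE_lborel_singleton[of 1]
          proof eventually_elim
            case (elim x)
            then show ?case unfolding eq J_def
              by (auto simp: indicator_def algebra_simps)
          qed
        qed
        also have "\<dots> = integral\<^sup>L lborel (J k)"
          using lborel_integral_real_affine[of 1 "J k" "a + k"] by simp
        finally show ?thesis .
      qed
      note termeq = this
      have one: "\<exists>!k::int. u \<in> {a + k..<a + k + 1}" for u
      proof (rule ex1I[of _ "\<lfloor>u - a\<rfloor>"])
        show "u \<in> {a + \<lfloor>u - a\<rfloor>..<a + \<lfloor>u - a\<rfloor> + 1}" by (auto; linarith)
        fix k :: int assume "u \<in> {a + k..<a + k + 1}"
        then show "k = \<lfloor>u - a\<rfloor>" by (intro floor_unique[symmetric]) auto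
      qed
      have has_J: "((\<lambda>k. J k u) has_sum (G u * cis (2 * pi * real_of_int m * a))) UNIV" for u
      proof -
        from one[of u] obtain k0 :: int where k0: "u \<in> {a + k0..<a + k0 + 1}" "\<And>k. u \<in> {a + real_of_int k..<a + k + 1} \<Longrightarrow> k = k0"
          by metis
        have "J k u = (if k = k0 then G u * cis (2 * pi * real_of_int m * a) else 0)" for k
          unfolding J_def indicator_def using k0 by auto
        then show ?thesis
          by (intro has_sum_finite_neutralI[of "{k0}"]) auto
      qed
      have normJ: "norm (J k u) = indicat_real {a + k..<a + k + 1} u * norm (G u)" for k u
        by (simp add: J_def norm_mult)
      have "((\<lambda>k. integral\<^sup>L lborel (J k)) has_sum (\<integral>u. (\<Sum>\<^sub>\<infinity>k. J k u) \<partial>lborel)) UNIV"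
      proof (rule integral_has_sum_int[OF J_int])
        fix u
        show "(\<lambda>k. norm (J k u)) summable_on UNIV"
          using has_sum_imp_summable[OF has_J[of u]]
          by (subst summable_on_iff_abs_summable_on_complex[symmetric])
      next
        show "(\<lambda>k. \<integral>u. norm (J k u) \<partial>lborel) summable_on UNIV"
        \<comment> \<open>The intervals are disjoint, so no finite partial sum exceeds the integral
          of the norm of G.\<close>
        proof (rule nonneg_bdd_above_summable_on)
          show "bdd_above (sum (\<lambda>k. \<integral>u. norm (J k u) \<partial>lborel) ` {F. F \<subseteq> UNIV \<and> finite F})"
          proof (rule bdd_aboveI2[where M = "\<integral>u. norm (G u) \<partial>lborel"])
            fix F :: "int set" assume "F \<in> {F. F \<subseteq> UNIV \<and> finite F}"
            then have F: "finite F" by simp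
            have "(\<Sum>k\<in>F. \<integral>u. norm (J k u) \<partial>lborel) = (\<integral>u. (\<Sum>k\<in>F. norm (J k u)) \<partial>lborel)"
              by (rule Bochner_Integration.integral_sum[symmetric]) (rule integrable_norm[OF J_int])
            also have "\<dots> \<le> (\<integral>u. norm (G u) \<partial>lborel)"
            proof (intro integral_mono Bochner_Integration.integrable_sum integrable_norm J_int G_int)
              fix u
              from one[of u] obtain k0 :: int where k0: "\<And>k. u \<in> {a + real_of_int k..<a + k + 1} \<Longrightarrow> k = k0"
                by (elim ex1E) blast
              have "norm (J k u) \<le> (if k = k0 then norm (G u) else 0)" for k
                unfolding normJ using k0[of k] by (cases "u \<in> {a + real_of_int k..<a + k + 1}") simp_all
              then have "(\<Sum>k\<in>F. norm (J k u)) \<le> (\<Sum>k\<in>F. if k = k0 then norm (G u) else 0)"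
                by (rule sum_mono)
              also have "\<dots> \<le> norm (G u)" using F by simp
              finally show "(\<Sum>k\<in>F. norm (J k u)) \<le> norm (G u)" .
            qed
            finally show "(\<Sum>k\<in>F. \<integral>u. norm (J k u) \<partial>lborel) \<le> (\<integral>u. norm (G u) \<partial>lborel)" .
          qed
        qed simp
      qed
      moreover have "(\<Sum>\<^sub>\<infinity>k. J k u) = G u * cis (2 * pi * real_of_int m * a)" for u
        using has_J by (rule infsumI)
      ultimately have "((\<lambda>k. integral\<^sup>L lborel (J k)) has_sum (complex_of_real (q m) * cis (2 * pi * real_of_int m * a))) UNIV"
        using G_val G_int by simp
      then show ?thesis using hs_f unfolding termeq by (rule has_sum_unique[symmetric])
    qed
    have mult_out: "(\<Sum>\<^sub>\<infinity>k. g k x * c) = (\<Sum>\<^sub>\<infinity>k. g k x) * c" for g :: "int \<Rightarrow> real \<Rightarrow> complex" and x c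
      by (rule infsum_cmult_left')
    have int_cont: "integrable unit_lborel g" if cg: "continuous_on {0..1} g" for g :: "real \<Rightarrow> complex"
    proof -
      obtain B where "\<And>x. x \<in> {0..1} \<Longrightarrow> norm (g x) \<le> B"
        using compact_imp_bounded[OF compact_continuous_image[OF cg compact_Icc]] unfolding bounded_iff by blast
      then show ?thesis by (rule integrable_unit_bounded[OF meas_unit[OF cg]])
    qed
    have i_sf: "integrable unit_lborel (\<lambda>x. (\<Sum>\<^sub>\<infinity>k. f k x) * ?e x)" 
      by (intro int_cont continuous_on_mult e_cont continuous_on_subset[OF cont_f unitX])
    have i_sh: "integrable unit_lborel (\<lambda>x. (\<Sum>\<^sub>\<infinity>k. h k x) * ?e x)" 
      by (intro int_cont continuous_on_mult e_cont continuous_on_subset[OF cont_h unitX])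
    show "integral\<^sup>L unit_lborel (\<lambda>x. d x * ?e x) = 0"
      using coeff_f coeff_h i_sf i_sh unfolding mult_out d_def left_diff_distrib by simp
  qed
  then show ?thesis by (simp add: d_def f_def h_def q_def)
qed

subsection \<open>The squared theta function as a lattice sum\<close>

lemma summable_on_times_real:
  fixes f :: "'a \<Rightarrow> real" and g :: "'b \<Rightarrow> real"
  assumes f: "f summable_on A" "\<And>x. x \<in> A \<Longrightarrow> 0 \<le> f x" and g: "g summable_on B" "\<And>x. x \<in> B \<Longrightarrow> 0 \<le> g x"
  shows "(\<lambda>(x, y). f x * g y) summable_on (A \<times> B)"
proof (rule summable_on_SigmaI)
  show "((\<lambda>y. case (x, y) of (x, y) \<Rightarrow> f x * g y) has_sum f x * infsum g B) B" for x
    using has_sum_cmult_right[OF has_sum_infsum[OF g(1)], of "f x"] by simp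
  show "(\<lambda>x. f x * infsum g B) summable_on A"
    by (intro summable_on_cmult_left f)
qed (use f g in auto)

text \<open>The positive definite quadratic form of determinant 1 attached to z: the squared length
  in the lattice spanned by z and 1, scaled to covolume 1.\<close>

definition quad :: "complex \<Rightarrow> int \<times> int \<Rightarrow> real" where
  "quad z v = (norm (of_int (fst v) * z + of_int (snd v)))\<^sup>2 / Im z"

text \<open>For c = 2u this is the sign (-1)^(u d). It is the dual of the parity condition that u
  and v have the same parity, under Poisson summation in v.\<close>

definition theta_char :: "int \<times> int \<Rightarrow> real" where
  "theta_char v = (if even (fst v) then (if even (fst v div 2 * snd v) then 1 else -1) else 0)"

text \<open>The constants pi/4 and 1/2 are forced by the requirement that t = 1 give
  |\<theta>|^2.\<close>

definition theta_lattice :: "real \<Rightarrow> complex \<Rightarrow> real" where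
  "theta_lattice t z = (\<Sum>\<^sub>\<infinity>v. theta_char v * exp (- (pi / 4 * t * quad z v))) / 2"

lemma quad_eq: "quad z (c, d) = ((real_of_int c * Re z + real_of_int d)\<^sup>2 + (real_of_int c * Im z)\<^sup>2) / Im z"
  by (simp add: quad_def cmod_power2)

text \<open>From D^2 <= 2 (C x + D)^2 + 2 (C x)^2 the Euclidean norm is controlled by the form. The
  constant depends on z; it serves only for convergence and for the finiteness of the set of short
  vectors.\<close>

lemma quad_lower_bound:
  assumes z: "Im z > 0"
  obtains \<kappa> where "\<kappa> > 0" "\<And>c d. \<kappa> * ((real_of_int c)\<^sup>2 + (real_of_int d)\<^sup>2) \<le> quad z (c, d)"
proof -
  define x y where "x = Re z" and "y = Im z"
  define M where "M = 2 + (1 + 2 * x\<^sup>2) / y\<^sup>2"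
  have y: "y > 0" using z by (simp add: y_def)
  have "0 \<le> (1 + 2 * x\<^sup>2) / y\<^sup>2" by simp
  then have M: "M \<ge> 2" unfolding M_def by simp
  have "(1 / (M * y)) * ((real_of_int c)\<^sup>2 + (real_of_int d)\<^sup>2) \<le> quad z (c, d)" for c d
  proof -
    define C D where "C = real_of_int c" and "D = real_of_int d"
    have "0 \<le> (2 * C * x + D)\<^sup>2" by simp
    then have "D\<^sup>2 \<le> 2 * (C * x + D)\<^sup>2 + 2 * (C * x)\<^sup>2"
      by (simp add: power2_eq_square algebra_simps)
    then have "C\<^sup>2 + D\<^sup>2 \<le> C\<^sup>2 * (1 + 2 * x\<^sup>2) + 2 * (C * x + D)\<^sup>2"
      by (simp add: power2_eq_square algebra_simps)
    also have "C\<^sup>2 * (1 + 2 * x\<^sup>2) = (C * y)\<^sup>2 * ((1 + 2 * x\<^sup>2) / y\<^sup>2)"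
      using y by (simp add: power_mult_distrib)
    also have "\<dots> \<le> (C * y)\<^sup>2 * M" by (intro mult_left_mono) (auto simp: M_def)
    also have "2 * (C * x + D)\<^sup>2 \<le> M * (C * x + D)\<^sup>2" using M by (intro mult_right_mono) auto
    finally have "C\<^sup>2 + D\<^sup>2 \<le> M * ((C * x + D)\<^sup>2 + (C * y)\<^sup>2)" by (simp add: algebra_simps)
    then have "(C\<^sup>2 + D\<^sup>2) / (M * y) \<le> M * ((C * x + D)\<^sup>2 + (C * y)\<^sup>2) / (M * y)"
      using y M by (intro divide_right_mono) auto
    then show ?thesis using y M unfolding quad_eq C_def[symmetric] D_def[symmetric] x_def[symmetric] y_def[symmetric]
      by simp
  qed
  then show ?thesis using that[of "1 / (M * y)"] y M by simp
qed

lemma summable_on_int_pair_gauss: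
  assumes "0 < a" "0 < b"
  shows "(\<lambda>(c::int, d::int). exp (- (a * (real_of_int c)\<^sup>2)) * exp (- (b * (real_of_int d)\<^sup>2))) summable_on UNIV"
proof -
  have "(\<lambda>(c::int, d::int). exp (- (a * (real_of_int c)\<^sup>2)) * exp (- (b * (real_of_int d)\<^sup>2))) summable_on (UNIV \<times> UNIV)"
    by (rule summable_on_times_real) (use summable_on_int_gauss'[OF assms(1)] summable_on_int_gauss'[OF assms(2)] in auto)
  then show ?thesis by simp
qed

lemma summable_exp_quad:
  assumes z: "Im z > 0" and t: "t > 0"
  shows "(\<lambda>v. exp (- (t * quad z v))) summable_on A"
proof -
  obtain \<kappa> where \<kappa>: "\<kappa> > 0" "\<And>c d. \<kappa> * ((real_of_int c)\<^sup>2 + (real_of_int d)\<^sup>2) \<le> quad z (c, d)"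
    using quad_lower_bound[OF z] by blast
  have "(\<lambda>v. exp (- (t * quad z v))) summable_on UNIV"
  proof (rule summable_on_comparison_test)
    show "(\<lambda>(c::int, d::int). exp (- ((t * \<kappa>) * (real_of_int c)\<^sup>2)) * exp (- ((t * \<kappa>) * (real_of_int d)\<^sup>2))) summable_on UNIV"
      using \<kappa> t by (intro summable_on_int_pair_gauss) auto
    fix v :: "int \<times> int"
    obtain c d where v: "v = (c, d)" by (cases v)
    have "t * (\<kappa> * ((real_of_int c)\<^sup>2 + (real_of_int d)\<^sup>2)) \<le> t * quad z v"
      using \<kappa> t v by (intro mult_left_mono) auto
    then show "exp (- (t * quad z v)) \<le> (case v of (c, d) \<Rightarrow> exp (- ((t * \<kappa>) * (real_of_int c)\<^sup>2)) * exp (- ((t * \<kappa>) * (real_of_int d)\<^sup>2)))"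
      by (simp add: v algebra_simps flip: exp_add)
  qed simp
  then show ?thesis by (rule summable_on_subset_banach) simp
qed

lemma abs_theta_char_le: "\<bar>theta_char v\<bar> \<le> 1"
  by (simp add: theta_char_def)

lemma summable_theta_lattice:
  assumes z: "Im z > 0" and t: "t > 0"
  shows "(\<lambda>v. theta_char v * exp (- (t * quad z v))) summable_on A"
proof (rule abs_summable_summable, rule summable_on_comparison_test[OF summable_exp_quad[OF z t]])
  fix v show "norm (theta_char v * exp (- (t * quad z v))) \<le> exp (- (t * quad z v))"
    using mult_right_mono[OF abs_theta_char_le[of v], of "exp (- (t * quad z v))"] by (simp add: abs_mult)
qed simp

definition parity_sign :: "int \<Rightarrow> real" where
  "parity_sign k = (if even k then 1 else - 1)"

lemma cis_pi_int: "cis (pi * real_of_int m) = of_real (parity_sign m)"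
proof (cases "even m")
  case True
  then obtain k where "m = 2 * k" by blast
  then have "cis (pi * real_of_int m) = cis (2 * pi * real_of_int k)" by (simp add: mult_ac)
  then show ?thesis using True cis_multiple_2pi[of "real_of_int k"] by (simp add: parity_sign_def)
next
  case False
  then obtain k where "m = 2 * k + 1" by (elim oddE)
  then have "cis (pi * real_of_int m) = cis (2 * pi * real_of_int k) * cis pi" 
    unfolding cis_mult by (simp add: algebra_simps)
  then show ?thesis using False cis_multiple_2pi[of "real_of_int k"] by (simp add: parity_sign_def)
qed

lemma infsum_int_even_odd:
  fixes f :: "int \<Rightarrow> complex"
  assumes "f summable_on UNIV"
  shows "infsum f UNIV = (\<Sum>\<^sub>\<infinity>k. f (2 * k)) + (\<Sum>\<^sub>\<infinity>k. f (2 * k + 1))"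
proof -
  have s: "f summable_on A" for A using assms by (rule summable_on_subset_banach) simp
  have U: "range (\<lambda>k. 2 * k) \<union> range (\<lambda>k. 2 * k + 1) = (UNIV :: int set)"
    by (auto simp: image_def) (metis evenE oddE)
  have disj: "range (\<lambda>k. 2 * k) \<inter> range (\<lambda>k. 2 * k + 1) = ({} :: int set)" 
    by auto presburger
  have "infsum f UNIV = infsum f (range (\<lambda>k. 2 * k)) + infsum f (range (\<lambda>k. 2 * k + 1))"
    using infsum_Un_disjoint[OF s s disj] unfolding U .
  also have "infsum f (range (\<lambda>k. 2 * k)) = (\<Sum>\<^sub>\<infinity>k. f (2 * k))"
    using infsum_reindex[of "\<lambda>k. 2 * k" UNIV f] by (simp add: inj_on_def o_def)
  also have "infsum f (range (\<lambda>k. 2 * k + 1)) = (\<Sum>\<^sub>\<infinity>k. f (2 * k + 1))"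
    using infsum_reindex[of "\<lambda>k. 2 * k + 1" UNIV f] by (simp add: inj_on_def o_def)
  finally show ?thesis .
qed

lemma summable_on_int_gauss_shift:
  assumes "0 < c"
  shows "(\<lambda>k::int. exp (- (c * (real_of_int k + a)\<^sup>2))) summable_on UNIV"
proof (rule summable_on_comparison_test)
  show "(\<lambda>k::int. exp (c * a\<^sup>2) * exp (- ((c / 2) * (real_of_int k)\<^sup>2))) summable_on UNIV"
    using assms by (intro summable_on_cmult_right summable_on_int_gauss') simp
  fix k :: int
  have "0 \<le> (real_of_int k + 2 * a)\<^sup>2" by simp
  then have "(real_of_int k)\<^sup>2 / 2 - a\<^sup>2 \<le> (real_of_int k + a)\<^sup>2"
    by (simp add: power2_eq_square algebra_simps)
  then have "c * ((real_of_int k)\<^sup>2 / 2 - a\<^sup>2) \<le> c * (real_of_int k + a)\<^sup>2"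
    using assms by (intro mult_left_mono) auto
  then show "exp (- (c * (real_of_int k + a)\<^sup>2)) \<le> exp (c * a\<^sup>2) * exp (- ((c / 2) * (real_of_int k)\<^sup>2))"
    by (simp add: algebra_simps flip: exp_add)
qed simp

text \<open>Even and odd w are inverted separately with parameter 4s. At frequency m the two
  contributions combine to the factor 1 + (-1)^(u + m), which selects the m of the parity of u; its
  value 2 cancels the 2 in sqrt(4s).\<close>

lemma jacobi_inversion_parity:
  fixes u :: int
  assumes s: "0 < s"
  shows "(\<Sum>\<^sub>\<infinity>w::int. complex_of_real (parity_sign (u * w) * exp (- (pi * s * (real_of_int w + a)\<^sup>2)))) =
    (\<Sum>\<^sub>\<infinity>m::int. (if even (u - m) then complex_of_real (exp (- (pi * (real_of_int m)\<^sup>2 / (4 * s))) / sqrt s) * cis (pi * real_of_int m * a) else 0))"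
proof -
  define f where "f = (\<lambda>w::int. complex_of_real (parity_sign (u * w) * exp (- (pi * s * (real_of_int w + a)\<^sup>2))))"
  define q where "q = (\<lambda>m::int. exp (- (pi * (real_of_int m)\<^sup>2 / (4 * s))) / sqrt (4 * s))"
  have f: "f summable_on UNIV"
    by (rule abs_summable_summable, rule summable_on_comparison_test[OF summable_on_int_gauss_shift[of "pi * s" a]])
       (use s in \<open>auto simp: f_def norm_mult parity_sign_def\<close>)
  have q_sum: "(\<lambda>m. complex_of_real (q m) * cis (2 * pi * real_of_int m * b)) summable_on UNIV" for b
  proof (rule abs_summable_summable, rule summable_on_comparison_test)
    show "(\<lambda>m::int. (1 / sqrt (4 * s)) * exp (- ((pi / (4 * s)) * (real_of_int m)\<^sup>2))) summable_on UNIV"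
      using s by (intro summable_on_cmult_right summable_on_int_gauss') simp
  qed (use s in \<open>auto simp: q_def norm_mult norm_divide\<close>)
  have J: "(\<Sum>\<^sub>\<infinity>k::int. complex_of_real (exp (- (pi * (4 * s) * (real_of_int k + b)\<^sup>2)))) =
     (\<Sum>\<^sub>\<infinity>m::int. complex_of_real (q m) * cis (2 * pi * real_of_int m * b))" for b
    using jacobi_inversion[of "4 * s" b] s by (simp add: q_def)
  have 1: "f (2 * k) = complex_of_real (exp (- (pi * (4 * s) * (real_of_int k + a / 2)\<^sup>2)))" for k
  proof -
    have "s * (real_of_int (2 * k) + a)\<^sup>2 = (4 * s) * (real_of_int k + a / 2)\<^sup>2"
      by (simp add: power2_eq_square algebra_simps)
    then show ?thesis by (simp add: f_def parity_sign_def mult.assoc)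
  qed
  have 2: "f (2 * k + 1) = complex_of_real (parity_sign u) * complex_of_real (exp (- (pi * (4 * s) * (real_of_int k + (a + 1) / 2)\<^sup>2)))" for k
  proof -
    have "s * (real_of_int (2 * k + 1) + a)\<^sup>2 = (4 * s) * (real_of_int k + (a + 1) / 2)\<^sup>2"
      by (simp add: power2_eq_square algebra_simps)
    moreover have "parity_sign (u * (2 * k + 1)) = parity_sign u" by (simp add: parity_sign_def)
    ultimately show ?thesis by (simp add: f_def mult.assoc)
  qed
  have 3: "cis (2 * pi * real_of_int m * ((a + 1) / 2)) = complex_of_real (parity_sign m) * cis (pi * real_of_int m * a)" for m
    unfolding cis_pi_int[symmetric] cis_mult by (rule arg_cong[of _ _ cis]) (simp add: field_simps)
  have "infsum f UNIV = (\<Sum>\<^sub>\<infinity>k. f (2 * k)) + (\<Sum>\<^sub>\<infinity>k. f (2 * k + 1))"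
    by (rule infsum_int_even_odd[OF f])
  also have "\<dots> = (\<Sum>\<^sub>\<infinity>m. complex_of_real (q m) * cis (2 * pi * real_of_int m * (a / 2))) +
     complex_of_real (parity_sign u) * (\<Sum>\<^sub>\<infinity>m. complex_of_real (q m) * cis (2 * pi * real_of_int m * ((a + 1) / 2)))"
    unfolding 1 2 J[symmetric] by (simp add: infsum_cmult_right')
  also have "\<dots> = (\<Sum>\<^sub>\<infinity>m. complex_of_real (q m) * cis (2 * pi * real_of_int m * (a / 2)) +
     complex_of_real (parity_sign u) * (complex_of_real (q m) * cis (2 * pi * real_of_int m * ((a + 1) / 2))))"
    unfolding infsum_cmult_right'[symmetric]
    by (rule infsum_add[symmetric]) (intro summable_on_cmult_right q_sum)+
  also have "\<dots> = (\<Sum>\<^sub>\<infinity>m::int. (if even (u - m) then complex_of_real (exp (- (pi * (real_of_int m)\<^sup>2 / (4 * s))) / sqrt s) * cis (pi * real_of_int m * a) else 0))"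
  proof (rule infsum_cong)
    fix m :: int
    have "complex_of_real (q m) * cis (2 * pi * real_of_int m * (a / 2)) +
     complex_of_real (parity_sign u) * (complex_of_real (q m) * cis (2 * pi * real_of_int m * ((a + 1) / 2))) =
      complex_of_real (q m * (1 + parity_sign u * parity_sign m)) * cis (pi * real_of_int m * a)"
      unfolding 3 by (simp add: algebra_simps)
    also have "q m * (1 + parity_sign u * parity_sign m) = (if even (u - m) then exp (- (pi * (real_of_int m)\<^sup>2 / (4 * s))) / sqrt s else 0)"
      using s by (auto simp: parity_sign_def q_def real_sqrt_mult)
    finally show "complex_of_real (q m) * cis (2 * pi * real_of_int m * (a / 2)) +
     complex_of_real (parity_sign u) * (complex_of_real (q m) * cis (2 * pi * real_of_int m * ((a + 1) / 2))) = 
     (if even (u - m) then complex_of_real (exp (- (pi * (real_of_int m)\<^sup>2 / (4 * s))) / sqrt s) * cis (pi * real_of_int m * a) else 0)"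
      by (simp split: if_splits)
  qed
  finally show ?thesis unfolding f_def .
qed

text \<open>The partial Poisson transform of \<open>theta_lattice\<close>. It is symmetric under \<open>t \<mapsto> 1/t\<close>, and for
  \<open>t = 1\<close> it is the expansion of \<open>\<theta>(z)\<close> times its conjugate in terms of
  \<open>(u, v) = (m\<^sub>1 - m\<^sub>2, m\<^sub>1 + m\<^sub>2)\<close>.\<close>

definition theta_mixed :: "real \<Rightarrow> complex \<Rightarrow> int \<times> int \<Rightarrow> complex" where
  "theta_mixed t z = (\<lambda>(u, v). if even (u - v) then
     complex_of_real (exp (- (pi * Im z * t * (real_of_int u)\<^sup>2)) * exp (- (pi * Im z / t * (real_of_int v)\<^sup>2))) *
       cis (2 * pi * Re z * real_of_int u * real_of_int v) else 0)"

lemma summable_theta_mixed: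
  assumes "Im z > 0" "t > 0"
  shows "theta_mixed t z summable_on A"
proof -
  have "theta_mixed t z summable_on UNIV"
  proof (rule abs_summable_summable, rule summable_on_comparison_test)
    show "(\<lambda>(c::int, d::int). exp (- ((pi * Im z * t) * (real_of_int c)\<^sup>2)) * exp (- ((pi * Im z / t) * (real_of_int d)\<^sup>2))) summable_on UNIV"
      using assms by (intro summable_on_int_pair_gauss) auto
  qed (auto simp: theta_mixed_def norm_mult split: prod.split)
  then show ?thesis by (rule summable_on_subset_banach) simp
qed

text \<open>Only c = 2u contributes. Completing the square gives (pi/4) t quad z (2u, w) = pi t y
  u^2 + pi s (w + 2ux)^2 with s = t / (4y), so for fixed u the sum over w is ready for inversion;
  its phase is the one in \<open>theta_mixed\<close>.\<close>

lemma theta_lattice_eq_mixed: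
  assumes z: "Im z > 0" and t: "t > 0"
  shows "complex_of_real (theta_lattice t z) = of_real (sqrt (Im z / t)) * infsum (theta_mixed t z) UNIV"
proof -
  define x y where "x = Re z" and "y = Im z"
  have y: "y > 0" using z by (simp add: y_def)
  define s where "s = t / (4 * y)"
  have s: "s > 0" using t y by (simp add: s_def)
  let ?g = "\<lambda>v. theta_char v * exp (- (pi / 4 * t * quad z v))"
  have g_sum: "?g summable_on A" for A
    using summable_theta_lattice[OF z, of "pi / 4 * t" A] t by simp
  have inj: "inj (\<lambda>(u::int, w::int). (2 * u, w))" by (auto simp: inj_on_def)
  have tm: "?g (2 * u, w) = exp (- (pi * t * y * (real_of_int u)\<^sup>2)) * (parity_sign (u * w) * exp (- (pi * s * (real_of_int w + 2 * real_of_int u * x)\<^sup>2)))" for u w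
  proof -
    have "pi / 4 * t * quad z (2 * u, w) = pi * t * y * (real_of_int u)\<^sup>2 + pi * s * (real_of_int w + 2 * real_of_int u * x)\<^sup>2"
      using y unfolding quad_eq x_def[symmetric] y_def[symmetric] s_def
      by (simp add: field_simps power2_eq_square)
    moreover have "theta_char (2 * u, w) = parity_sign (u * w)" by (simp add: theta_char_def parity_sign_def)
    ultimately show ?thesis by (simp only: minus_add_distrib exp_add mult.left_commute of_int_mult of_int_numeral)
  qed
  have "infsum ?g UNIV = infsum ?g (range (\<lambda>(u::int, w::int). (2 * u, w)))"
  proof (rule infsum_cong_neutral)
    fix v :: "int \<times> int" assume v: "v \<in> UNIV - range (\<lambda>(u::int, w::int). (2 * u, w))"
    have "odd (fst v)"
    proof
      assume "even (fst v)"
      then obtain u where "fst v = 2 * u" by blast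
      then have "v = (\<lambda>(u::int, w::int). (2 * u, w)) (u, snd v)" by (simp add: prod_eq_iff)
      then show False using v by blast
    qed
    then show "?g v = 0" by (simp add: theta_char_def)
  qed auto
  also have "\<dots> = infsum (\<lambda>(u, w). ?g (2 * u, w)) (UNIV \<times> UNIV)"
    by (subst infsum_reindex[OF inj]) (simp add: o_def case_prod_unfold)
  finally have e1: "infsum ?g UNIV = infsum (\<lambda>(u, w). ?g (2 * u, w)) (UNIV \<times> UNIV)" .
  have sum2: "(\<lambda>(u, w). ?g (2 * u, w)) summable_on (UNIV \<times> UNIV)"
    using g_sum[of "range (\<lambda>(u::int, w::int). (2 * u, w))"] summable_on_reindex[OF inj, of ?g]
    by (simp add: o_def case_prod_unfold)
  have sum2c: "(\<lambda>(u, w). complex_of_real (?g (2 * u, w))) summable_on (UNIV \<times> UNIV)"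
    using summable_on_of_real[OF sum2] by (simp add: case_prod_unfold)
  have "complex_of_real (infsum ?g UNIV) = infsum (\<lambda>(u, w). complex_of_real (?g (2 * u, w))) (UNIV \<times> UNIV)"
    unfolding e1 using infsumI[OF has_sum_of_real[OF has_sum_infsum[OF sum2], where 'a = complex]]
    by (simp add: case_prod_unfold)
  also have "\<dots> = (\<Sum>\<^sub>\<infinity>u. \<Sum>\<^sub>\<infinity>w. complex_of_real (?g (2 * u, w)))"
    using infsum_Sigma'_banach[OF sum2c] by simp
  also have "\<dots> = (\<Sum>\<^sub>\<infinity>u. \<Sum>\<^sub>\<infinity>v. of_real (2 * sqrt (y / t)) * theta_mixed t z (u, v))"
  proof (rule infsum_cong)
    fix u :: int
    have "(\<Sum>\<^sub>\<infinity>w. complex_of_real (?g (2 * u, w))) = complex_of_real (exp (- (pi * t * y * (real_of_int u)\<^sup>2))) *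
       (\<Sum>\<^sub>\<infinity>w. complex_of_real (parity_sign (u * w) * exp (- (pi * s * (real_of_int w + 2 * real_of_int u * x)\<^sup>2))))"
      unfolding tm of_real_mult[of "exp (- (pi * t * y * (real_of_int u)\<^sup>2))"] by (rule infsum_cmult_right')
    also have "\<dots> = (\<Sum>\<^sub>\<infinity>m. complex_of_real (exp (- (pi * t * y * (real_of_int u)\<^sup>2))) * (if even (u - m) then complex_of_real (exp (- (pi * (real_of_int m)\<^sup>2 / (4 * s))) / sqrt s) * cis (pi * real_of_int m * (2 * real_of_int u * x)) else 0))"
      unfolding jacobi_inversion_parity[OF s] by (rule infsum_cmult_right'[symmetric])
    also have "\<dots> = (\<Sum>\<^sub>\<infinity>v. of_real (2 * sqrt (y / t)) * theta_mixed t z (u, v))"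
    proof (rule infsum_cong)
      fix m :: int
      have a: "pi * (real_of_int m)\<^sup>2 / (4 * s) = pi * y / t * (real_of_int m)\<^sup>2" using y t by (simp add: s_def)
      have "(2 * sqrt (y / t)) * sqrt s = sqrt (4 * (y / t) * s)" by (simp only: real_sqrt_mult real_sqrt_four)
      also have "4 * (y / t) * s = 1" using y t by (simp add: s_def)
      finally have b: "1 / sqrt s = 2 * sqrt (y / t)" using s by (simp add: field_simps)
      have c: "pi * real_of_int m * (2 * real_of_int u * x) = 2 * pi * x * real_of_int u * real_of_int m" by simp
      show "complex_of_real (exp (- (pi * t * y * (real_of_int u)\<^sup>2))) * (if even (u - m) then complex_of_real (exp (- (pi * (real_of_int m)\<^sup>2 / (4 * s))) / sqrt s) * cis (pi * real_of_int m * (2 * real_of_int u * x)) else 0)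
        = of_real (2 * sqrt (y / t)) * theta_mixed t z (u, m)"
        unfolding a b[symmetric] c theta_mixed_def x_def[symmetric] y_def[symmetric] by (simp add: mult_ac)
    qed
    finally show "(\<Sum>\<^sub>\<infinity>w. complex_of_real (?g (2 * u, w))) = (\<Sum>\<^sub>\<infinity>v. of_real (2 * sqrt (y / t)) * theta_mixed t z (u, v))" .
  qed
  also have "\<dots> = of_real (2 * sqrt (y / t)) * (\<Sum>\<^sub>\<infinity>u. \<Sum>\<^sub>\<infinity>v. theta_mixed t z (u, v))"
    by (simp add: infsum_cmult_right')
  also have "(\<Sum>\<^sub>\<infinity>u. \<Sum>\<^sub>\<infinity>v. theta_mixed t z (u, v)) = infsum (theta_mixed t z) UNIV"
    using infsum_Sigma'_banach[of "\<lambda>u v. theta_mixed t z (u, v)" UNIV "\<lambda>_. UNIV"] summable_theta_mixed[OF z t]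
    by simp
  finally show ?thesis by (simp add: theta_lattice_def y_def)
qed

text \<open>Exchanging u and v replaces t by 1/t, while the parity condition and the phase are
  symmetric.\<close>

lemma infsum_theta_mixed_inverse:
  assumes t: "t > 0"
  shows "infsum (theta_mixed (1 / t) z) UNIV = infsum (theta_mixed t z) UNIV"
proof -
  have "infsum (theta_mixed t z) UNIV = infsum (\<lambda>v. theta_mixed t z (prod.swap v)) UNIV"
    using infsum_reindex_bij_betw[OF bij_swap, of "theta_mixed t z"] by simp
  also have "\<dots> = infsum (theta_mixed (1 / t) z) UNIV"
    using t by (intro infsum_cong) (auto simp: theta_mixed_def mult_ac)
  finally show ?thesis by simp
qed

text \<open>The mixed sum is the same for t and 1/t; only the prefactor changes, from sqrt(y / t) to
  sqrt(y t), which is t times as large.\<close>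

theorem theta_lattice_inverse:
  assumes z: "Im z > 0" and t: "t > 0"
  shows "theta_lattice t z = theta_lattice (1 / t) z / t"
proof -
  have "complex_of_real (theta_lattice t z) = of_real (sqrt (Im z / t)) * infsum (theta_mixed t z) UNIV"
    by (rule theta_lattice_eq_mixed[OF z t])
  also have "sqrt (Im z / t) = sqrt (Im z / (1 / t)) / t"
    using t by (simp add: real_sqrt_mult real_sqrt_divide field_simps)
  also have "of_real (sqrt (Im z / (1 / t)) / t) * infsum (theta_mixed t z) UNIV = 
     complex_of_real (theta_lattice (1 / t) z / t)"
    using theta_lattice_eq_mixed[OF z, of "1 / t"] t infsum_theta_mixed_inverse[OF t, of z] by simp
  finally show ?thesis by (simp only: of_real_eq_iff)
qed

text \<open>In the product of the series with its conjugate, u = m1 - m2 and v = m1 + m2 give m1^2 -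
  m2^2 = u v for the phase and 2 (m1^2 + m2^2) = u^2 + v^2 for the decay. The pairs (u, v) that
  occur are those of equal parity.\<close>

theorem norm_jacobi_theta_squared:
  assumes z: "Im z > 0"
  shows "(norm (jacobi_theta z))\<^sup>2 = theta_lattice 1 z"
proof -
  define x y where "x = Re z" and "y = Im z"
  have y: "y > 0" using z by (simp add: y_def)
  define a where "a = (\<lambda>m::int. complex_of_real (exp (- (2 * pi * y * (real_of_int m)\<^sup>2))) * cis (2 * pi * x * (real_of_int m)\<^sup>2))"
  have a_eq: "exp (2 * of_real pi * \<i> * (of_int m)\<^sup>2 * z) = a m" for m :: int
  proof -
    have "exp (2 * of_real pi * \<i> * (of_int m)\<^sup>2 * z) = exp (complex_of_real (- (2 * pi * y * (real_of_int m)\<^sup>2)) + \<i> * complex_of_real (2 * pi * x * (real_of_int m)\<^sup>2))"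
      by (rule arg_cong[of _ _ exp]) (simp add: complex_eq_iff x_def y_def power2_eq_square mult_ac)
    then show ?thesis by (simp only: exp_add a_def cis_conv_exp exp_of_real)
  qed
  have a_abs: "(\<lambda>m. norm (a m)) summable_on UNIV"
    using summable_on_int_gauss'[of "2 * pi * y"] y by (simp add: a_def norm_mult)
  then have a_sum: "a summable_on UNIV" by (rule abs_summable_summable)
  define S where "S = infsum a UNIV"
  have "complex_of_real ((norm S)\<^sup>2) = S * cnj S" by (rule complex_norm_square)
  also have "\<dots> = S * (\<Sum>\<^sub>\<infinity>m. cnj (a m))" by (simp add: S_def)
  also have "\<dots> = (\<Sum>\<^sub>\<infinity>m1. a m1 * (\<Sum>\<^sub>\<infinity>m2. cnj (a m2)))"
    unfolding S_def by (rule infsum_cmult_left'[symmetric])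
  also have "\<dots> = (\<Sum>\<^sub>\<infinity>m1. \<Sum>\<^sub>\<infinity>m2. a m1 * cnj (a m2))"
    by (simp add: infsum_cmult_right')
  also have "\<dots> = infsum (\<lambda>(m1, m2). a m1 * cnj (a m2)) (UNIV \<times> UNIV)"
  proof -
    have "(\<lambda>(m1, m2). norm (a m1) * norm (a m2)) summable_on (UNIV \<times> UNIV)"
      using summable_on_times_real[of "\<lambda>m. norm (a m)" UNIV "\<lambda>m. norm (a m)" UNIV] a_abs by simp
    then have "(\<lambda>v. norm ((\<lambda>(m1, m2). a m1 * cnj (a m2)) v)) summable_on (UNIV \<times> UNIV)"
      by (simp add: case_prod_unfold norm_mult)
    then have "(\<lambda>(m1, m2). a m1 * cnj (a m2)) summable_on (UNIV \<times> UNIV)"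
      by (rule abs_summable_summable)
    then show ?thesis
      using infsum_Sigma'_banach[of "\<lambda>m1 m2. a m1 * cnj (a m2)" UNIV "\<lambda>_. UNIV"] by simp
  qed
  also have "\<dots> = infsum (\<lambda>v. theta_mixed 1 z ((\<lambda>(m1, m2). (m1 - m2, m1 + m2)) v)) UNIV"
  proof (rule infsum_cong_neutral)
    fix v :: "int \<times> int"
    obtain m n where v: "v = (m, n)" by (cases v)
    define M N where "M = real_of_int m" and "N = real_of_int n"
    have "a m * cnj (a n) = complex_of_real (exp (- (2 * pi * y * M\<^sup>2)) * exp (- (2 * pi * y * N\<^sup>2))) * (cis (2 * pi * x * M\<^sup>2) * cis (- (2 * pi * x * N\<^sup>2)))"
      by (simp add: a_def cis_cnj M_def N_def)
    also have "exp (- (2 * pi * y * M\<^sup>2)) * exp (- (2 * pi * y * N\<^sup>2)) = exp (- (pi * y * 1 * (M - N)\<^sup>2)) * exp (- (pi * y / 1 * (M + N)\<^sup>2))"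
      unfolding exp_add[symmetric] by (rule arg_cong[of _ _ exp]) (simp add: power2_eq_square algebra_simps)
    also have "cis (2 * pi * x * M\<^sup>2) * cis (- (2 * pi * x * N\<^sup>2)) = cis (2 * pi * x * (M - N) * (M + N))"
      unfolding cis_mult by (rule arg_cong[of _ _ cis]) (simp add: power2_eq_square algebra_simps)
    finally show "(case v of (m1, m2) \<Rightarrow> a m1 * cnj (a m2)) = theta_mixed 1 z ((\<lambda>(m1, m2). (m1 - m2, m1 + m2)) v)"
      by (simp add: v theta_mixed_def x_def y_def M_def N_def)
  qed auto
  also have "\<dots> = infsum (theta_mixed 1 z) (range (\<lambda>(m1, m2). (m1 - m2, m1 + m2)))"
    using infsum_reindex[of "\<lambda>(m1, m2). (m1 - m2, m1 + m2)" UNIV "theta_mixed 1 z"]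
    by (simp add: inj_on_def o_def)
  also have "\<dots> = infsum (theta_mixed 1 z) UNIV"
  proof (rule infsum_cong_neutral)
    fix v :: "int \<times> int" assume v: "v \<in> UNIV - range (\<lambda>(m1, m2). (m1 - m2, m1 + m2))"
    have "odd (fst v - snd v)"
    proof
      assume "even (fst v - snd v)"
      then have "even (fst v + snd v)" by simp
      then obtain k where "fst v + snd v = 2 * k" by blast
      then have "v = (\<lambda>(m1, m2). (m1 - m2, m1 + m2)) (k, snd v - k)" by (simp add: prod_eq_iff)
      then show False using v by blast
    qed
    then show "theta_mixed 1 z v = 0" by (simp add: theta_mixed_def case_prod_unfold)
  qed auto
  finally have S2: "complex_of_real ((norm S)\<^sup>2) = infsum (theta_mixed 1 z) UNIV" .
  have "jacobi_theta z = of_real (y powr (1/4)) * S"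
    by (simp add: jacobi_theta_def a_eq S_def y_def)
  then have "(norm (jacobi_theta z))\<^sup>2 = (y powr (1/4))\<^sup>2 * (norm S)\<^sup>2"
    by (simp add: norm_mult power_mult_distrib)
  also have "(y powr (1/4))\<^sup>2 = sqrt y"
    using y by (simp add: power2_eq_square powr_half_sqrt flip: powr_add)
  finally have "complex_of_real ((norm (jacobi_theta z))\<^sup>2) = of_real (sqrt (Im z / 1)) * infsum (theta_mixed 1 z) UNIV"
    using S2 by (simp add: y_def)
  also have "\<dots> = complex_of_real (theta_lattice 1 z)"
    by (rule theta_lattice_eq_mixed[OF z, symmetric]) simp
  finally show ?thesis by (simp only: of_real_eq_iff)
qed

subsection \<open>Integral matrices\<close>

definition mat2 :: "int \<Rightarrow> int \<Rightarrow> int \<Rightarrow> int \<Rightarrow> int^2^2" where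
  "mat2 a b c d = vector [vector [a, b], vector [c, d]]"

lemma mat2_nth [simp]:
  "mat2 a b c d $ 1 $ 1 = a" "mat2 a b c d $ 1 $ 2 = b" "mat2 a b c d $ 2 $ 1 = c" "mat2 a b c d $ 2 $ 2 = d"
  by (simp_all add: mat2_def)

lemma mat2_eqI:
  fixes A B :: "int^2^2"
  assumes "A$1$1 = B$1$1" "A$1$2 = B$1$2" "A$2$1 = B$2$1" "A$2$2 = B$2$2"
  shows "A = B"
  using assms by (simp add: vec_eq_iff forall_2)

lemma mat2_eq_iff: "mat2 a b c d = mat2 a' b' c' d' \<longleftrightarrow> a = a' \<and> b = b' \<and> c = c' \<and> d = d'"
  by (metis mat2_nth)

lemma mat2_eta: "mat2 (A$1$1) (A$1$2) (A$2$1) (A$2$2) = A"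
  by (rule mat2_eqI) simp_all

lemma mat2_cases: obtains a b c d where "A = mat2 a b c d"
  using mat2_eta by metis

lemma mult_nth_2:
  fixes A B :: "int^2^2"
  shows "(A ** B) $ i $ j = A$i$1 * B$1$j + A$i$2 * B$2$j"
  by (simp add: matrix_matrix_mult_def sum_2)

lemma mat2_mult [simp]: "mat2 a b c d ** mat2 a' b' c' d' = mat2 (a*a' + b*c') (a*b' + b*d') (c*a' + d*c') (c*b' + d*d')"
  by (rule mat2_eqI) (simp_all add: mult_nth_2)

lemma det_mat2 [simp]: "det (mat2 a b c d) = a * d - b * c"
  by (simp add: det_2)

lemma mat_1_eq_mat2: "mat 1 = mat2 1 0 0 1"
  by (rule mat2_eqI) (simp_all add: mat_def)

text \<open>The adjugate is an integral stand-in for the inverse: it is the inverse in determinant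
  1, and for any nonzero determinant it induces the inverse Moebius map, since scalar matrices act
  trivially.\<close>

definition adj2 :: "int^2^2 \<Rightarrow> int^2^2" where
  "adj2 A = mat2 (A$2$2) (- A$1$2) (- A$2$1) (A$1$1)"

lemma adj2_mat2 [simp]: "adj2 (mat2 a b c d) = mat2 d (-b) (-c) a"
  by (simp add: adj2_def)

lemma adj2_adj2 [simp]: "adj2 (adj2 A) = A"
  by (cases A rule: mat2_cases) simp

lemma det_adj2 [simp]: "det (adj2 A) = det A"
  by (cases A rule: mat2_cases) simp

lemma adj2_mult: "adj2 (A ** B) = adj2 B ** adj2 A"
  by (cases A rule: mat2_cases; cases B rule: mat2_cases) (simp add: algebra_simps)

lemma mult_adj2: "A ** adj2 A = mat2 (det A) 0 0 (det A)" "adj2 A ** A = mat2 (det A) 0 0 (det A)"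
  by (cases A rule: mat2_cases; simp add: mult.commute)+

lemma carrier_SL2Z [simp]: "A \<in> carrier SL2Z \<longleftrightarrow> det A = 1"
  by (simp add: SL2Z_def)

lemma adj2_inverse: "det (A :: int^2^2) = 1 \<Longrightarrow> A ** adj2 A = mat 1" "det A = 1 \<Longrightarrow> adj2 A ** A = mat 1"
  by (simp_all add: mult_adj2 mat_1_eq_mat2)

lemma SL2Z_simps: "A \<otimes>\<^bsub>SL2Z\<^esub> B = A ** B" "\<one>\<^bsub>SL2Z\<^esub> = mat 1"
  by (simp_all add: SL2Z_def)

lemma group_SL2Z: "group SL2Z"
proof (rule groupI)
  fix A assume "A \<in> carrier SL2Z"
  then show "\<exists>B\<in>carrier SL2Z. B \<otimes>\<^bsub>SL2Z\<^esub> A = \<one>\<^bsub>SL2Z\<^esub>"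
    by (intro bexI[of _ "adj2 A"]) (simp_all add: SL2Z_simps adj2_inverse)
qed (simp_all add: SL2Z_simps det_mul matrix_mul_assoc mat_1_eq_mat2[symmetric] det_I)

lemma inv_SL2Z: "det A = 1 \<Longrightarrow> inv\<^bsub>SL2Z\<^esub> A = adj2 A"
  using group.inv_equality[OF group_SL2Z, of "adj2 A" A] by (simp add: SL2Z_simps adj2_inverse)

lemma mult_left_cancel_mat2:
  fixes A B C :: "int^2^2"
  assumes "det A \<noteq> 0" "A ** B = A ** C"
  shows "B = C"
proof -
  have "mat2 (det A) 0 0 (det A) ** B = mat2 (det A) 0 0 (det A) ** C"
    using assms(2) by (metis mult_adj2(2) matrix_mul_assoc)
  then show ?thesis using assms(1)
    by (cases B rule: mat2_cases; cases C rule: mat2_cases) (auto simp: mat2_eq_iff)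
qed

lemma mult_right_cancel_mat2:
  fixes A B C :: "int^2^2"
  assumes "det A \<noteq> 0" "B ** A = C ** A"
  shows "B = C"
proof -
  have "B ** mat2 (det A) 0 0 (det A) = C ** mat2 (det A) 0 0 (det A)"
    using assms(2) by (metis mult_adj2(1) matrix_mul_assoc)
  then show ?thesis using assms(1)
    by (cases B rule: mat2_cases; cases C rule: mat2_cases) (auto simp: mat2_eq_iff)
qed

text \<open>Countability allows almost-everywhere statements to be combined over any set of
  matrices, and sums over matrices to be exchanged with integrals.\<close>

lemma countable_mat2: "countable (X :: (int^2^2) set)"
proof -
  have "inj (\<lambda>A :: int^2^2. (A$1$1, A$1$2, A$2$1, A$2$2))"
    by (rule injI) (auto intro: mat2_eqI)
  then have "countable (UNIV :: (int^2^2) set)" by (metis countable_image_inj_on countableI_type)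
  then show ?thesis by (rule countable_subset[rotated]) simp
qed

subsection \<open>Moebius transformations\<close>

lemma moebius_denom_nonzero:
  fixes A :: "int^2^2"
  assumes "Im z > 0" "det A \<noteq> 0"
  shows "of_int (A$2$1) * z + of_int (A$2$2) \<noteq> (0::complex)"
proof
  assume *: "of_int (A$2$1) * z + of_int (A$2$2) = (0::complex)"
  then have "real_of_int (A$2$1) * Im z = 0" by (simp add: complex_eq_iff)
  then have "A$2$1 = 0" using assms by simp
  then show False using * assms(2) by (simp add: det_2)
qed

lemma Im_moebius:
  fixes A :: "int^2^2"
  assumes "Im z > 0" "det A \<noteq> 0"
  shows "Im (moebius A z) = real_of_int (det A) * Im z / (norm (of_int (A$2$1) * z + of_int (A$2$2)))\<^sup>2"
  by (simp add: moebius_def Im_divide cmod_power2 det_2 algebra_simps)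

lemma Im_moebius_pos:
  fixes A :: "int^2^2"
  assumes "Im z > 0" "det A > 0"
  shows "Im (moebius A z) > 0"
  using assms moebius_denom_nonzero[of z A] by (simp add: Im_moebius)

lemma moebius_mult:
  fixes A B :: "int^2^2"
  assumes "Im z > 0" "det B \<noteq> 0"
  shows "moebius (A ** B) z = moebius A (moebius B z)"
proof -
  obtain a b c d where A: "A = mat2 a b c d" by (rule mat2_cases)
  obtain a' b' c' d' where B: "B = mat2 a' b' c' d'" by (rule mat2_cases)
  define j where "j = of_int c' * z + of_int d'"
  have j: "j \<noteq> 0" using moebius_denom_nonzero[OF assms] by (simp add: B j_def)
  define m where "m = of_int a' * z + of_int b'"
  have "moebius A (moebius B z) = (of_int a * (m / j) + of_int b) / (of_int c * (m / j) + of_int d)"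
    by (simp add: moebius_def A B m_def j_def)
  also have "\<dots> = ((of_int a * m + of_int b * j) / j) / ((of_int c * m + of_int d * j) / j)"
    using j by (simp add: add_divide_distrib)
  also have "\<dots> = (of_int a * m + of_int b * j) / (of_int c * m + of_int d * j)"
    using j by simp
  also have "\<dots> = moebius (A ** B) z"
    by (simp add: moebius_def A B m_def j_def algebra_simps)
  finally show ?thesis by simp
qed

lemma moebius_scalar: "k \<noteq> 0 \<Longrightarrow> moebius (mat2 k 0 0 k) z = z"
  by (simp add: moebius_def)

lemma moebius_adj2:
  fixes A :: "int^2^2"
  assumes "Im z > 0" "det A \<noteq> 0"
  shows "moebius (adj2 A) (moebius A z) = z"
  using moebius_mult[OF assms, of "adj2 A"] assms by (simp add: mult_adj2 moebius_scalar)

text \<open>Matrices act on row vectors from the right, so that the lattice spanned by the rows of a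
  matrix does not change when it is multiplied by SL2Z from the left.\<close>

definition vact :: "int \<times> int \<Rightarrow> int^2^2 \<Rightarrow> int \<times> int" where
  "vact v A = (fst v * A$1$1 + snd v * A$2$1, fst v * A$1$2 + snd v * A$2$2)"

lemma vact_mat2 [simp]: "vact (x, y) (mat2 a b c d) = (x * a + y * c, x * b + y * d)"
  by (simp add: vact_def)

lemma vact_mult: "vact v (A ** B) = vact (vact v A) B"
  by (cases A rule: mat2_cases; cases B rule: mat2_cases; cases v) (simp add: algebra_simps)

lemma vact_1 [simp]: "vact v (mat 1) = v"
  by (cases v) (simp add: mat_1_eq_mat2)

lemma inj_vact:
  fixes A :: "int^2^2"
  assumes "det A \<noteq> 0" shows "inj (\<lambda>v. vact v A)"
proof (rule injI)
  fix v w assume "vact v A = vact w A"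
  then have "vact v (A ** adj2 A) = vact w (A ** adj2 A)" by (simp add: vact_mult)
  then show "v = w" using assms by (cases v; cases w) (simp add: mult_adj2)
qed

lemma range_vact_SL2Z:
  fixes A g :: "int^2^2"
  assumes "det g = 1" shows "range (\<lambda>v. vact v (g ** A)) = range (\<lambda>v. vact v A)"
proof -
  have "range (\<lambda>v. vact v (g ** A)) \<subseteq> range (\<lambda>v. vact v A)" for g A
    by (auto simp: vact_mult)
  moreover have "A = adj2 g ** (g ** A)"
    using assms by (simp add: matrix_mul_assoc adj2_inverse)
  ultimately show ?thesis by (metis subset_antisym)
qed

text \<open>The automorphy factor j = c z + d cancels: the linear form at A z is the transformed
  linear form at z divided by j, and Im(A z) = det A Im z / |j|^2.\<close>

lemma quad_moebius:
  fixes A :: "int^2^2"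
  assumes "Im z > 0" "det A > 0"
  shows "quad (moebius A z) v = quad z (vact v A) / real_of_int (det A)"
proof -
  obtain a b c d where A: "A = mat2 a b c d" by (rule mat2_cases)
  obtain x y where v: "v = (x, y)" by (cases v)
  define j where "j = of_int c * z + of_int d"
  have j: "j \<noteq> 0" using moebius_denom_nonzero[of z A] assms by (simp add: A j_def)
  define m where "m = of_int a * z + of_int b"
  have "of_int x * moebius A z + of_int y = (of_int x * m + of_int y * j) / j"
    using j unfolding moebius_def A mat2_nth m_def[symmetric] j_def[symmetric] by (simp add: add_divide_distrib)
  also have "of_int x * m + of_int y * j = of_int (x * a + y * c) * z + of_int (x * b + y * d)"
    by (simp add: m_def j_def algebra_simps)
  finally have "norm (of_int x * moebius A z + of_int y) = norm (of_int (x * a + y * c) * z + of_int (x * b + y * d)) / norm j"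
    by (simp add: norm_divide)
  moreover have "Im (moebius A z) = real_of_int (det A) * Im z / (norm j)\<^sup>2"
    using Im_moebius[of z A] assms by (simp add: A j_def)
  ultimately show ?thesis
    using j assms unfolding v A by (simp add: quad_def power_divide)
qed

subsection \<open>Congruences\<close>

lemma mat_cong_refl [simp]: "mat_cong N A A" by (simp add: mat_cong_def)
lemma mat_cong_sym: "mat_cong N A B \<Longrightarrow> mat_cong N B A" by (simp add: mat_cong_def cong_sym_eq)
lemma mat_cong_trans: "mat_cong N A B \<Longrightarrow> mat_cong N B C \<Longrightarrow> mat_cong N A C"
  unfolding mat_cong_def using cong_trans by blast
lemma mat_cong_mult: "mat_cong N A B \<Longrightarrow> mat_cong N C D \<Longrightarrow> mat_cong N (A ** C) (B ** D)"
  unfolding mat_cong_def mult_nth_2 by (simp add: cong_add cong_mult)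
lemma mat_cong_mat2 [simp]: "mat_cong N (mat2 a b c d) (mat2 a' b' c' d') \<longleftrightarrow>
   [a = a'] (mod int N) \<and> [b = b'] (mod int N) \<and> [c = c'] (mod int N) \<and> [d = d'] (mod int N)"
  by (simp add: mat_cong_def forall_2)
lemma mat_cong_adj2: "mat_cong N A B \<Longrightarrow> mat_cong N (adj2 A) (adj2 B)"
  by (cases A rule: mat2_cases; cases B rule: mat2_cases) (simp add: cong_minus_minus_iff)

lemma theta_char_cong4:
  assumes "[a = a'] (mod 4)" "[b = b'] (mod 4)"
  shows "theta_char (a, b) = theta_char (a', b')"
proof -
  obtain k l where k: "a' = a + 4 * k" and l: "b' = b + 4 * l"
    using assms unfolding cong_iff_lin by auto
  show ?thesis
  proof (cases "even a")
    case True
    then obtain r where r: "a = 2 * r" by blast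
    have "a' div 2 = r + 2 * k" using r k by simp
    then show ?thesis by (simp add: theta_char_def r k l)
  qed (simp add: theta_char_def k)
qed

lemma theta_char_scale_fst: "odd n \<Longrightarrow> theta_char (x * n, y) = theta_char (x, y)"
proof (cases "even x")
  case True
  assume n: "odd n"
  obtain r where r: "x = 2 * r" using True by blast
  have "x * n div 2 = r * n" by (simp add: r)
  then show ?thesis using n by (simp add: theta_char_def r)
qed (simp add: theta_char_def)

lemma theta_char_scale: "odd n \<Longrightarrow> theta_char (n * x, n * y) = theta_char (x, y)"
  using theta_char_scale_fst[of n x "n * y"] by (simp add: mult.commute[of n x]) (simp add: theta_char_def)

text \<open>As 4 divides c, both a and d are odd. For a vector (2r, y) the image has half its first
  entry congruent to r and second entry congruent to y modulo 2, so the sign (-1)^(r y) is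
  kept.\<close>

lemma theta_char_Gamma0_4:
  fixes A :: "int^2^2"
  assumes "det A = 1" "4 dvd A$2$1"
  shows "theta_char (vact v A) = theta_char v"
proof -
  obtain a b c d where A: "A = mat2 a b c d" by (rule mat2_cases)
  obtain x y where v: "v = (x, y)" by (cases v)
  from assms obtain k where k: "c = 4 * k" by (auto simp: A)
  have det: "a * d - b * c = 1" using assms by (simp add: A)
  have "a * d = 1 + 2 * (2 * b * k)" using det k by (simp add: algebra_simps)
  then have "odd (a * d)" by (metis odd_two_times_div_two_succ dvd_triv_left even_add odd_one)
  then have ad: "odd a" "odd d" by auto
  show ?thesis
  proof (cases "even x")
    case True
    then obtain r where r: "x = 2 * r" by blast
    have "(x * a + y * c) div 2 = r * a + y * (2 * k)" by (simp add: r k)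
    then show ?thesis using ad by (simp add: theta_char_def v A r k)
  next
    case False
    then show ?thesis using ad by (simp add: theta_char_def v A k)
  qed
qed

text \<open>The value of \<open>theta_lattice\<close> at \<open>\<beta> w\<close> only depends on the row lattice of \<open>\<beta>\<close>.\<close>

definition theta_sublattice :: "real \<Rightarrow> complex \<Rightarrow> (int \<times> int) set \<Rightarrow> real" where
  "theta_sublattice t z L = (\<Sum>\<^sub>\<infinity>v\<in>L. theta_char v * exp (- (pi / 4 * t * quad z v))) / 2"

lemma theta_lattice_moebius:
  fixes A :: "int^2^2"
  assumes z: "Im z > 0" and A: "det A > 0" and inv: "\<And>v. theta_char (vact v A) = theta_char v"
  shows "theta_lattice t (moebius A z) = theta_sublattice (t / real_of_int (det A)) z (range (\<lambda>v. vact v A))"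
proof -
  have "(\<Sum>\<^sub>\<infinity>v. theta_char v * exp (- (pi / 4 * t * quad (moebius A z) v))) =
     (\<Sum>\<^sub>\<infinity>v. theta_char (vact v A) * exp (- (pi / 4 * (t / real_of_int (det A)) * quad z (vact v A))))"
    by (rule infsum_cong) (simp add: inv quad_moebius[OF z A])
  also have "\<dots> = infsum (\<lambda>u. theta_char u * exp (- (pi / 4 * (t / real_of_int (det A)) * quad z u))) (range (\<lambda>v. vact v A))"
    using infsum_reindex[OF inj_vact[of A], of "\<lambda>u. theta_char u * exp (- (pi / 4 * (t / real_of_int (det A)) * quad z u))"] A
    by (simp add: o_def)
  finally show ?thesis by (simp add: theta_lattice_def theta_sublattice_def)
qed

text \<open>The form is homogeneous of degree 2, and an odd scalar leaves the sign
  unchanged.\<close>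

lemma theta_sublattice_scaled:
  assumes e: "odd e"
  shows "theta_sublattice t z {v. e dvd fst v \<and> e dvd snd v} = theta_lattice (t * (real_of_int e)\<^sup>2) z"
proof -
  have e0: "e \<noteq> 0" using e by auto
  have R: "{v. e dvd fst v \<and> e dvd snd v} = range (\<lambda>v. (e * fst v, e * snd v))"
    by (auto simp: dvd_def image_def)
  have inj: "inj (\<lambda>v. (e * fst v, e * snd v))" using e0 by (auto simp: inj_on_def prod_eq_iff)
  have q: "quad z (e * x, e * y) = (real_of_int e)\<^sup>2 * quad z (x, y)" for x y
  proof -
    have "of_int (e * x) * z + of_int (e * y) = of_int e * (of_int x * z + of_int y)" by (simp add: algebra_simps)
    then show ?thesis by (simp add: quad_def norm_mult power_mult_distrib del: of_int_mult)
  qed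
  show ?thesis
    unfolding theta_sublattice_def theta_lattice_def R
    using infsum_reindex[OF inj, of "\<lambda>u. theta_char u * exp (- (pi / 4 * t * quad z u))"]
    by (simp add: o_def q theta_char_scale[OF e] mult.assoc)
qed

subsection \<open>Hermite normal forms\<close>

text \<open>Each sublattice of index n in the integer plane has exactly one basis of this shape, so
  these matrices enumerate the sublattices.\<close>

definition hermite_forms :: "nat \<Rightarrow> (int^2^2) set" where
  "hermite_forms n = {mat2 a b 0 d |a b d. a > 0 \<and> 0 \<le> b \<and> b < d \<and> a * d = int n}"

lemma det_hermite: "h \<in> hermite_forms n \<Longrightarrow> det h = int n"
  by (auto simp: hermite_forms_def)

text \<open>Bezout coefficients of the first column give a row operation of determinant 1 that
  clears the lower left entry; a shear then reduces the upper right entry modulo d.\<close>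

lemma hermite_exists:
  fixes B :: "int^2^2"
  assumes "det B = int n" "n > 0"
  obtains g h :: "int^2^2" where "det g = 1" "h \<in> hermite_forms n" "B = g ** h"
proof -
  obtain p q r s where B: "B = mat2 p q r s" by (rule mat2_cases)
  have det: "p * s - q * r = int n" using assms by (simp add: B)
  define a where "a = gcd p r"
  have "p \<noteq> 0 \<or> r \<noteq> 0" using det assms by auto
  then have a: "a > 0" by (simp add: a_def)
  obtain x y where xy: "x * p + y * r = a" unfolding a_def using bezout_int by blast
  define p' r' where "p' = p div a" and "r' = r div a"
  have p: "p = a * p'" and r: "r = a * r'" by (simp_all add: p'_def r'_def a_def)
  have one: "x * p' + y * r' = 1"
  proof -
    have "a * (x * p' + y * r') = a * 1" using xy by (simp add: p r algebra_simps)
    then show ?thesis using a by simp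
  qed
  define b0 d where "b0 = x * q + y * s" and "d = p' * s - r' * q"
  have ad: "a * d = int n" using det by (simp add: d_def p r algebra_simps)
  then have d: "d > 0" using a assms(2) by (metis of_nat_0_less_iff zero_less_mult_pos)
  define k where "k = b0 div d"
  define g' where "g' = mat2 1 (-k) 0 1 ** mat2 x y (- r') p'"
  have "det g' = 1" using one by (simp add: g'_def det_mul) (simp add: algebra_simps)
  have "g' ** B = mat2 1 (-k) 0 1 ** (mat2 x y (- r') p' ** B)" by (simp add: g'_def matrix_mul_assoc)
  also have "mat2 x y (- r') p' ** B = mat2 a b0 0 d"
    using xy unfolding B by (simp add: b0_def d_def) (simp add: p r algebra_simps)
  also have "mat2 1 (-k) 0 1 ** mat2 a b0 0 d = mat2 a (b0 mod d) 0 d"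
    by (simp add: k_def minus_div_mult_eq_mod[symmetric])
  finally have h: "g' ** B = mat2 a (b0 mod d) 0 d" .
  have "mat2 a (b0 mod d) 0 d \<in> hermite_forms n"
    using a d ad unfolding hermite_forms_def mem_Collect_eq
    by (intro exI[of _ a] exI[of _ "b0 mod d"] exI[of _ d]) simp
  moreover have "B = adj2 g' ** (g' ** B)"
    using \<open>det g' = 1\<close> by (simp add: matrix_mul_assoc adj2_inverse)
  ultimately show ?thesis using that[of "adj2 g'" "g' ** B"] h \<open>det g' = 1\<close> by simp
qed

text \<open>The vanishing lower left entries and the positive diagonals force g to be a shear, which
  shifts b by a multiple of d; both b and b' lie in [0, d).\<close>

lemma hermite_unique:
  assumes "det g = 1" "h \<in> hermite_forms n" "h' \<in> hermite_forms n" "g ** h = h'"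
  shows "h = h'"
proof -
  obtain a b d where h: "h = mat2 a b 0 d" "a > 0" "0 \<le> b" "b < d" "a * d = int n"
    using assms(2) by (auto simp: hermite_forms_def)
  obtain a' b' d' where h': "h' = mat2 a' b' 0 d'" "a' > 0" "0 \<le> b'" "b' < d'" "a' * d' = int n"
    using assms(3) by (auto simp: hermite_forms_def)
  obtain p q r s where g: "g = mat2 p q r s" by (rule mat2_cases)
  have "mat2 (p * a) (p * b + q * d) (r * a) (r * b + s * d) = mat2 a' b' 0 d'"
    using assms(4) by (simp add: g h(1) h'(1))
  then have e: "p * a = a'" "p * b + q * d = b'" "r * a = 0" "r * b + s * d = d'"
    by (metis mat2_nth)+
  then have r: "r = 0" using h by simp
  then have ps: "p * s = 1" using assms(1) by (simp add: g)
  have "p > 0" using e(1) h(2) h'(2) by (metis zero_less_mult_pos2)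
  then have p: "p = 1" and s: "s = 1" using ps by (simp_all add: zmult_eq_1_iff)
  have bd: "b + q * d = b'" "d = d'" using e p s r by auto
  have "b mod d = (b + q * d) mod d" by simp
  moreover have "b mod d = b" "b' mod d' = b'" using h h' by simp_all
  ultimately have "b = b'" using bd by metis
  then show ?thesis using e p bd h h' by simp
qed

lemma finite_hermite: "finite (hermite_forms n)"
proof (rule finite_subset)
  show "hermite_forms n \<subseteq> (\<lambda>(a, b, d). mat2 a b 0 d) ` ({0..int n} \<times> {0..int n} \<times> {0..int n})"
  proof
    fix h assume "h \<in> hermite_forms n"
    then obtain a b d where h: "h = mat2 a b 0 d" "a > 0" "0 \<le> b" "b < d" "a * d = int n"
      by (auto simp: hermite_forms_def)
    have "a * 1 \<le> a * d" "1 * d \<le> a * d" using h by (intro mult_mono; simp)+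
    then show "h \<in> (\<lambda>(a, b, d). mat2 a b 0 d) ` ({0..int n} \<times> {0..int n} \<times> {0..int n})"
      using h by (intro image_eqI[of _ _ "(a, b, d)"]) auto
  qed
qed simp

section \<open>Counting the sublattices that contain a given vector\<close>

lemma card_linear_congruence:
  fixes c k d :: int
  assumes d: "d > 0"
  shows "card {b \<in> {0..<d}. d dvd c * b - k} = (if gcd c d dvd k then nat (gcd c d) else 0)"
proof (cases "gcd c d dvd k")
  case False
  have "\<not> d dvd c * b - k" for b
  proof
    assume "d dvd c * b - k"
    then have "gcd c d dvd c * b - k" using dvd_trans gcd_dvd2 by blast
    moreover have "gcd c d dvd c * b" by simp
    ultimately have "gcd c d dvd c * b - (c * b - k)" by (rule dvd_diff[rotated])
    moreover have "c * b - (c * b - k) = k" by simp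
    ultimately have "gcd c d dvd k" by metis
    then show False using False by simp
  qed
  then show ?thesis using False by simp
next
  case True
  define g where "g = gcd c d"
  have g: "g > 0" using d by (simp add: g_def)
  obtain c' where c: "c = g * c'" unfolding g_def by (metis gcd_dvd1 dvdE)
  obtain d' where d': "d = g * d'" unfolding g_def by (metis gcd_dvd2 dvdE)
  obtain k' where k: "k = g * k'" using True unfolding g_def by blast
  have d'0: "d' > 0" using d d' g by (simp add: zero_less_mult_iff)
  have cop: "coprime c' d'"
  proof -
    have "g = g * gcd c' d'" using gcd_mult_distrib_int[of g c' d'] g by (simp add: g_def[symmetric] c[symmetric] d'[symmetric])
    then show ?thesis using g by (simp add: coprime_iff_gcd_eq_1)
  qed
  obtain x where x: "[c' * x = 1] (mod d')" using cong_solve_coprime_int[OF cop] by blast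
  define r where "r = (x * k') mod d'"
  have r: "0 \<le> r" "r < d'" using d'0 by (auto simp: r_def)
  have iff: "d dvd c * b - k \<longleftrightarrow> b mod d' = r" for b
  proof -
    have "d dvd c * b - k \<longleftrightarrow> d' dvd c' * b - k'"
      using g by (simp add: c d' k right_diff_distrib[symmetric] mult.assoc)
    also have "\<dots> \<longleftrightarrow> [c' * b = k'] (mod d')" by (simp add: cong_iff_dvd_diff)
    also have "\<dots> \<longleftrightarrow> [b = x * k'] (mod d')"
    proof
      assume "[c' * b = k'] (mod d')"
      then have "[x * (c' * b) = x * k'] (mod d')" by (rule cong_scalar_left)
      moreover have "[(c' * x) * b = 1 * b] (mod d')" using x by (rule cong_scalar_right)
      ultimately show "[b = x * k'] (mod d')" 
        by (metis cong_sym cong_trans mult.assoc mult.commute mult_1)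
    next
      assume "[b = x * k'] (mod d')"
      then have "[c' * b = c' * (x * k')] (mod d')" by (rule cong_scalar_left)
      moreover have "[(c' * x) * k' = 1 * k'] (mod d')" using x by (rule cong_scalar_right)
      ultimately show "[c' * b = k'] (mod d')" 
        by (metis cong_trans mult.assoc mult_1)
    qed
    finally show ?thesis by (simp add: r_def cong_def)
  qed
  have "{b \<in> {0..<d}. d dvd c * b - k} = (\<lambda>j. r + j * d') ` {0..<g}"
  proof (rule equalityI; rule subsetI)
    fix b assume "b \<in> {b \<in> {0..<d}. d dvd c * b - k}"
    then have b: "0 \<le> b" "b < d" "b mod d' = r" by (auto simp: iff)
    have "b = r + (b div d') * d'" using b(3) by (metis mod_mult_div_eq add.commute mult.commute)
    moreover have "b div d' < g"
    proof (rule ccontr)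
      assume "\<not> b div d' < g"
      then have "g * d' \<le> (b div d') * d'" using d'0 by (intro mult_right_mono) auto
      also have "\<dots> \<le> b" using d'0 by (metis b(1) div_mult_mod_eq le_add_same_cancel1 pos_mod_sign)
      finally show False using b(2) d' by simp
    qed
    moreover have "0 \<le> b div d'" using b d'0 by (simp add: pos_imp_zdiv_nonneg_iff)
    ultimately show "b \<in> (\<lambda>j. r + j * d') ` {0..<g}" by auto
  next
    fix b assume "b \<in> (\<lambda>j. r + j * d') ` {0..<g}"
    then obtain j where j: "0 \<le> j" "j < g" "b = r + j * d'" by auto
    have "j * d' \<le> (g - 1) * d'" using j d'0 by (intro mult_right_mono) auto
    then have "b < d" using j r d' by (simp add: algebra_simps)
    moreover have "0 \<le> b" using j r d'0 by simp
    moreover have "b mod d' = r" using j r by simp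
    ultimately show "b \<in> {b \<in> {0..<d}. d dvd c * b - k}" by (simp add: iff)
  qed
  moreover have "inj_on (\<lambda>j. r + j * d') {0..<g}" using d'0 by (auto simp: inj_on_def)
  ultimately show ?thesis using True by (simp add: card_image g_def)
qed

text \<open>The vector (x, y) lies in the row lattice of (a b; 0 d) iff a divides x and d divides
  (x/a) b - y. With G = gcd(x, n), a divisor a of G admits G/a values of b if G/a divides y, and
  none otherwise. Substituting e = G/a turns the total into the sum on the right.\<close>

lemma card_hermite_containing:
  assumes n: "n > 0"
  shows "card {h \<in> hermite_forms n. u \<in> range (\<lambda>v. vact v h)} = (\<Sum>e\<in>{e. e dvd n \<and> int e dvd fst u \<and> int e dvd snd u}. e)"
proof -
  obtain x y where u: "u = (x, y)" by (cases u)
  define G where "G = nat (gcd x (int n))"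
  have G: "G > 0" "int G = gcd x (int n)" using n by (auto simp: G_def)
  have Gdvd: "e dvd G \<longleftrightarrow> e dvd n \<and> int e dvd x" for e :: nat
    using G(2) by (metis gcd_greatest_iff int_dvd_int_iff conj_commute)
  define X where "X = (\<lambda>a. {b \<in> {0..<int n div int a}. (int n div int a) dvd (x div int a) * b - y})"
  have mem: "u \<in> range (\<lambda>v. vact v (mat2 a b 0 d)) \<longleftrightarrow> a dvd x \<and> d dvd (x div a) * b - y" if "a > 0" for a b d
  proof
    assume "u \<in> range (\<lambda>v. vact v (mat2 a b 0 d))"
    then obtain v where "u = vact v (mat2 a b 0 d)" by blast
    then have "x = fst v * a" "y = fst v * b + snd v * d" by (simp_all add: u vact_def)
    then show "a dvd x \<and> d dvd (x div a) * b - y" using that by simp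
  next
    assume *: "a dvd x \<and> d dvd (x div a) * b - y"
    then obtain q where "(x div a) * b - y = d * q" by blast
    then have "u = vact (x div a, - q) (mat2 a b 0 d)" using * by (simp add: u algebra_simps)
    then show "u \<in> range (\<lambda>v. vact v (mat2 a b 0 d))" by blast
  qed
  have set_eq: "{h \<in> hermite_forms n. u \<in> range (\<lambda>v. vact v h)} =
     (\<lambda>(a, b). mat2 (int a) b 0 (int n div int a)) ` (SIGMA a:{a. a dvd G}. X a)"
  proof (rule equalityI; rule subsetI)
    fix h assume "h \<in> {h \<in> hermite_forms n. u \<in> range (\<lambda>v. vact v h)}"
    then obtain a b d where h: "h = mat2 a b 0 d" "a > 0" "0 \<le> b" "b < d" "a * d = int n" "u \<in> range (\<lambda>v. vact v h)"
      by (auto simp: hermite_forms_def)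
    have ax: "a dvd x" and dy: "d dvd (x div a) * b - y" using h(6) mem[OF h(2)] unfolding h(1) by blast+
    have d: "d = int n div a" using h(2,5) by (metis nonzero_mult_div_cancel_left less_irrefl)
    have na: "int (nat a) = a" using h by simp
    have "nat a dvd G" unfolding Gdvd using ax h(5) na by (metis dvd_triv_left int_dvd_int_iff)
    moreover have "b \<in> X (nat a)" unfolding X_def na d[symmetric] using h dy by simp
    ultimately show "h \<in> (\<lambda>(a, b). mat2 (int a) b 0 (int n div int a)) ` (SIGMA a:{a. a dvd G}. X a)"
      using h(1) d na by (intro image_eqI[of _ _ "(nat a, b)"]) auto
  next
    fix h assume "h \<in> (\<lambda>(a, b). mat2 (int a) b 0 (int n div int a)) ` (SIGMA a:{a. a dvd G}. X a)"
    then obtain a b where h: "h = mat2 (int a) b 0 (int n div int a)" "a dvd G" "b \<in> X a" by auto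
    have a: "a dvd n" "int a dvd x" using h(2) Gdvd by auto
    then have a0: "a > 0" using n by (auto intro: Nat.gr0I)
    have "int a * (int n div int a) = int n" using a(1) by simp
    then have "h \<in> hermite_forms n" using h a0 unfolding hermite_forms_def X_def mem_Collect_eq
      by (intro exI[of _ "int a"] exI[of _ b] exI[of _ "int n div int a"]) simp
    moreover have "u \<in> range (\<lambda>v. vact v h)" unfolding h(1) using mem[of "int a" b "int n div int a"] a0 a h(3)
      by (simp add: X_def)
    ultimately show "h \<in> {h \<in> hermite_forms n. u \<in> range (\<lambda>v. vact v h)}" by simp
  qed
  have inj: "inj_on (\<lambda>(a, b). mat2 (int a) b 0 (int n div int a)) (SIGMA a:{a. a dvd G}. X a)"
  proof (rule inj_onI, clarify)
    fix a b a' b' assume "mat2 (int a) b 0 (int n div int a) = mat2 (int a') b' 0 (int n div int a')"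
    then have "int a = int a'" "b = b'" by (metis mat2_nth)+
    then show "a = a' \<and> b = b'" by simp
  qed
  have fin: "finite {a. a dvd G}" using G by simp
  have "card {h \<in> hermite_forms n. u \<in> range (\<lambda>v. vact v h)} = (\<Sum>a\<in>{a. a dvd G}. card (X a))"
    unfolding set_eq card_image[OF inj] 
    by (rule card_SigmaI[OF fin]) (simp add: X_def del: atLeastLessThan_iff)
  also have "\<dots> = (\<Sum>a\<in>{a. a dvd G}. if int (G div a) dvd y then G div a else 0)"
  proof (rule sum.cong[OF refl])
    fix a assume "a \<in> {a. a dvd G}"
    then have a: "a dvd G" "a dvd n" "int a dvd x" using Gdvd by auto
    then have a0: "a > 0" using n by (auto intro: Nat.gr0I)
    have gcd: "gcd (x div int a) (int n div int a) = int (G div a)"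
    proof -
      obtain x' where x': "x = int a * x'" using a by blast
      obtain n' where n': "n = a * n'" using a by blast
      have "int G = int a * gcd x' (int n')" unfolding G(2) x' n' using gcd_mult_distrib_int[of "int a" x' "int n'"] by simp
      then show ?thesis using a0 by (simp add: x' n' zdiv_int)
    qed
    have "int a * (int n div int a) = int n" using a(2) by simp
    then have "0 < int n div int a" using a0 n by (metis of_nat_0_less_iff zero_less_mult_pos)
    from card_linear_congruence[OF this, of "x div int a" y]
    show "card (X a) = (if int (G div a) dvd y then G div a else 0)"
      unfolding X_def gcd by simp
  qed
  also have "\<dots> = (\<Sum>e\<in>{e. e dvd G}. if int e dvd y then e else 0)"
    by (rule sum.reindex_bij_witness[of _ "\<lambda>e. G div e" "\<lambda>a. G div a"])
       (use G in \<open>auto elim!: dvdE\<close>)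
  also have "\<dots> = (\<Sum>e\<in>{e. e dvd n \<and> int e dvd fst u \<and> int e dvd snd u}. e)"
    by (rule sum.mono_neutral_cong_right) (use fin in \<open>auto simp: Gdvd u\<close>)
  finally show ?thesis .
qed

text \<open>The zero vector lies in every lattice and is divisible by every e.\<close>

lemma card_hermite:
  assumes n: "n > 0"
  shows "card (hermite_forms n) = (\<Sum>e\<in>{e. e dvd n}. e)"
proof -
  have "(0, 0) = vact (0, 0) h" for h by (simp add: vact_def)
  then have "(0, 0) \<in> range (\<lambda>v. vact v h)" for h by blast
  then show ?thesis using card_hermite_containing[OF n, of "(0, 0)"] by simp
qed

lemma infsum_finite_sum:
  fixes f :: "'i \<Rightarrow> 'a \<Rightarrow> real"
  assumes "finite I" "\<And>i. i \<in> I \<Longrightarrow> f i summable_on A"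
  shows "infsum (\<lambda>x. \<Sum>i\<in>I. f i x) A = (\<Sum>i\<in>I. infsum (f i) A)"
proof -
  have "(\<lambda>x. \<Sum>i\<in>I. f i x) summable_on A \<and> infsum (\<lambda>x. \<Sum>i\<in>I. f i x) A = (\<Sum>i\<in>I. infsum (f i) A)"
    using assms by (induction I rule: finite_induct) (auto simp: infsum_add summable_on_add)
  then show ?thesis ..
qed

text \<open>Double counting: on the left, u is weighted by the number of sublattices of index n
  containing it, which is the sum of those divisors e of n for which u is e times an integral
  vector.\<close>

lemma infsum_hermite:
  fixes f :: "int \<times> int \<Rightarrow> real"
  assumes n: "n > 0" and f: "f summable_on UNIV"
  shows "(\<Sum>h\<in>hermite_forms n. infsum f (range (\<lambda>v. vact v h))) =
     (\<Sum>e\<in>{e. e dvd n}. real e * infsum f {v. int e dvd fst v \<and> int e dvd snd v})"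
proof -
  have s: "(\<lambda>u. indicat_real X u * f u) summable_on UNIV" for X
  proof -
    have "f summable_on X" using f by (rule summable_on_subset_banach) simp
    also have "f summable_on X \<longleftrightarrow> (\<lambda>u. indicat_real X u * f u) summable_on UNIV"
      by (rule summable_on_cong_neutral) auto
    finally show ?thesis .
  qed
  have i: "infsum f X = (\<Sum>\<^sub>\<infinity>u. indicat_real X u * f u)" for X
    by (rule infsum_cong_neutral) auto
  have fin: "finite {e. e dvd n}" using n by simp
  have "(\<Sum>h\<in>hermite_forms n. infsum f (range (\<lambda>v. vact v h))) =
     (\<Sum>\<^sub>\<infinity>u. \<Sum>h\<in>hermite_forms n. indicat_real (range (\<lambda>v. vact v h)) u * f u)"
    unfolding i by (rule infsum_finite_sum[OF finite_hermite s, symmetric])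
  also have "\<dots> = (\<Sum>\<^sub>\<infinity>u. \<Sum>e\<in>{e. e dvd n}. real e * (indicat_real {v. int e dvd fst v \<and> int e dvd snd v} u * f u))"
  proof (rule infsum_cong)
    fix u
    have "(\<Sum>h\<in>hermite_forms n. indicat_real (range (\<lambda>v. vact v h)) u) = real (card {h \<in> hermite_forms n. u \<in> range (\<lambda>v. vact v h)})"
      using finite_hermite[of n] by (simp add: indicator_def sum.If_cases Int_def)
    also have "\<dots> = (\<Sum>e\<in>{e. e dvd n \<and> int e dvd fst u \<and> int e dvd snd u}. real e)"
      unfolding card_hermite_containing[OF n] by simp
    also have "\<dots> = (\<Sum>e\<in>{e. e dvd n}. real e * indicat_real {v. int e dvd fst v \<and> int e dvd snd v} u)"
      by (rule sum.mono_neutral_cong_left) (use fin in auto)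
    finally show "(\<Sum>h\<in>hermite_forms n. indicat_real (range (\<lambda>v. vact v h)) u * f u) =
      (\<Sum>e\<in>{e. e dvd n}. real e * (indicat_real {v. int e dvd fst v \<and> int e dvd snd v} u * f u))"
      by (simp add: sum_distrib_right[symmetric] mult.assoc[symmetric])
  qed
  also have "\<dots> = (\<Sum>e\<in>{e. e dvd n}. \<Sum>\<^sub>\<infinity>u. real e * (indicat_real {v. int e dvd fst v \<and> int e dvd snd v} u * f u))"
    by (rule infsum_finite_sum[OF fin]) (intro summable_on_cmult_right s)
  also have "\<dots> = (\<Sum>e\<in>{e. e dvd n}. real e * infsum f {v. int e dvd fst v \<and> int e dvd snd v})"
    unfolding i by (simp add: infsum_cmult_right')
  finally show ?thesis .
qed

text \<open>The vectors divisible by e rescale the parameter from 1/n to e^2/n, which is e/d if n =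
  e d.\<close>

lemma sum_theta_sublattice_hermite:
  assumes z: "Im z > 0" and n: "n > 0" "odd n"
  shows "(\<Sum>h\<in>hermite_forms n. theta_sublattice (1 / real n) z (range (\<lambda>v. vact v h))) =
    (\<Sum>e\<in>{e. e dvd n}. real e * theta_lattice ((real e)\<^sup>2 / real n) z)"
proof -
  let ?f = "\<lambda>v. theta_char v * exp (- (pi / 4 * (1 / real n) * quad z v))"
  have f: "?f summable_on UNIV"
    using summable_theta_lattice[OF z, of "pi / 4 * (1 / real n)"] n by simp
  have "(\<Sum>h\<in>hermite_forms n. theta_sublattice (1 / real n) z (range (\<lambda>v. vact v h))) =
     (\<Sum>e\<in>{e. e dvd n}. real e * infsum ?f {v. int e dvd fst v \<and> int e dvd snd v}) / 2"
    unfolding theta_sublattice_def sum_divide_distrib[symmetric] infsum_hermite[OF n(1) f] ..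
  also have "\<dots> = (\<Sum>e\<in>{e. e dvd n}. real e * theta_sublattice (1 / real n) z {v. int e dvd fst v \<and> int e dvd snd v})"
    by (simp add: theta_sublattice_def sum_divide_distrib)
  also have "\<dots> = (\<Sum>e\<in>{e. e dvd n}. real e * theta_lattice ((real e)\<^sup>2 / real n) z)"
  proof (rule sum.cong[OF refl])
    fix e assume "e \<in> {e. e dvd n}"
    then have "odd (int e)" using n(2) dvd_trans by auto
    from theta_sublattice_scaled[OF this, of "1 / real n" z]
    show "real e * theta_sublattice (1 / real n) z {v. int e dvd fst v \<and> int e dvd snd v} = real e * theta_lattice ((real e)\<^sup>2 / real n) z"
      by simp
  qed
  finally show ?thesis .
qed

text \<open>Every lattice of index n has a basis congruent to diag(n, 1) modulo N. Modulo N, a shear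
  removes b, and diag(d, 1/d) carries diag(a, d) to diag(n, 1); what remains is to lift these to
  integral matrices of determinant 1.\<close>

lemma hermite_lift:
  assumes h: "h \<in> hermite_forms n" and cop: "coprime n N"
  obtains g :: "int^2^2" where "det g = 1" "mat_cong N (g ** h) (mat2 (int n) 0 0 1)"
proof -
  obtain a b d where hh: "h = mat2 a b 0 d" "a > 0" "0 \<le> b" "b < d" "a * d = int n"
    using h by (auto simp: hermite_forms_def)
  have "coprime (int n) (int N)" using cop by simp
  then have "coprime d (int N)" using hh(5) by (metis coprime_mult_left_iff)
  then have "coprime d ((int N)\<^sup>2)" by simp
  then obtain e where "[d * e = 1] (mod (int N)\<^sup>2)" using cong_solve_coprime_int by blast
  then obtain k where k: "d * e = 1 + (int N)\<^sup>2 * k" by (metis cong_iff_lin cong_sym)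
  \<comment> \<open>Inverting d modulo N^2 instead of N leaves d e - 1 = N^2 k, which splits as a
    product of two off-diagonal entries N k and N, both 0 modulo N.\<close>
  define g where "g = mat2 d (int N * k) (int N) e ** mat2 1 (- (b * e)) 0 1"
  have "det g = 1" unfolding g_def det_mul using k by (simp add: power2_eq_square algebra_simps)
  moreover have "mat_cong N (g ** h) (mat2 (int n) 0 0 1)"
  proof -
    have de: "[d * e = 1] (mod int N)" unfolding cong_iff_dvd_diff using k by (simp add: power2_eq_square)
    have g_h: "g ** h = mat2 d (int N * k) (int N) e ** mat2 a (b * (1 - e * d)) 0 d"
      unfolding g_def hh(1) matrix_mul_assoc[symmetric] by (simp add: algebra_simps)
    have "mat_cong N (mat2 d (int N * k) (int N) e) (mat2 d 0 0 e)"
      by (simp add: cong_iff_dvd_diff)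
    moreover have "mat_cong N (mat2 a (b * (1 - e * d)) 0 d) (mat2 a 0 0 d)"
    proof -
      have "int N dvd 1 - e * d" using de by (metis cong_iff_dvd_diff cong_sym mult.commute)
      then show ?thesis by (simp add: cong_iff_dvd_diff)
    qed
    ultimately have "mat_cong N (g ** h) (mat2 d 0 0 e ** mat2 a 0 0 d)"
      unfolding g_h by (rule mat_cong_mult)
    moreover have "mat_cong N (mat2 d 0 0 e ** mat2 a 0 0 d) (mat2 (int n) 0 0 1)"
      using de hh(5) by (simp add: mult.commute)
    ultimately show ?thesis by (rule mat_cong_trans)
  qed
  ultimately show ?thesis by (rule that)
qed

subsection \<open>Reduction theory\<close>

text \<open>The closed standard fundamental domain of SL2Z. Including its boundary ensures that
  every orbit meets it, at the cost of uniqueness.\<close>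

definition reduced :: "complex \<Rightarrow> bool" where
  "reduced w \<longleftrightarrow> Im w > 0 \<and> \<bar>Re w\<bar> \<le> 1/2 \<and> 1 \<le> norm w"

text \<open>With |Re w| <= 1/2 and |w| >= 1, the squared norm is at least c^2 - |c d| + d^2, a
  positive definite form with integer values, hence at least 1.\<close>

lemma norm_add_reduced_ge_1:
  assumes w: "reduced w" and v: "(c, d) \<noteq> (0, 0)"
  shows "1 \<le> norm (of_int c * w + of_int d)"
proof -
  have nw: "(Re w)\<^sup>2 + (Im w)\<^sup>2 \<ge> 1" using w unfolding reduced_def by (simp flip: cmod_power2)
  have "(norm (of_int c * w + of_int d))\<^sup>2 = (real_of_int c)\<^sup>2 * ((Re w)\<^sup>2 + (Im w)\<^sup>2) + 2 * (real_of_int c * real_of_int d) * Re w + (real_of_int d)\<^sup>2"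
    unfolding cmod_power2 by (simp add: power2_eq_square algebra_simps)
  moreover have "(real_of_int c)\<^sup>2 * 1 \<le> (real_of_int c)\<^sup>2 * ((Re w)\<^sup>2 + (Im w)\<^sup>2)"
    using nw by (intro mult_left_mono) auto
  moreover have "- \<bar>real_of_int c * real_of_int d\<bar> \<le> 2 * (real_of_int c * real_of_int d) * Re w"
  proof -
    have "\<bar>2 * (real_of_int c * real_of_int d) * Re w\<bar> = \<bar>real_of_int c * real_of_int d\<bar> * (2 * \<bar>Re w\<bar>)" by (simp add: abs_mult)
    also have "\<dots> \<le> \<bar>real_of_int c * real_of_int d\<bar> * 1" using w by (intro mult_left_mono) (auto simp: reduced_def)
    finally have "\<bar>2 * (real_of_int c * real_of_int d) * Re w\<bar> \<le> \<bar>real_of_int c * real_of_int d\<bar>" by simp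
    then show ?thesis using abs_le_D2 minus_le_iff by blast
  qed
  moreover have "real_of_int 1 \<le> real_of_int (c\<^sup>2 - \<bar>c * d\<bar> + d\<^sup>2)"
  proof -
    have "0 < c\<^sup>2 - \<bar>c * d\<bar> + d\<^sup>2"
    proof -
      have "4 * (X\<^sup>2 - X * Y + Y\<^sup>2) = (2 * X - Y)\<^sup>2 + 3 * Y\<^sup>2" for X Y :: int
        by (simp add: power2_eq_square algebra_simps)
      from this[of "\<bar>c\<bar>" "\<bar>d\<bar>"]
      have "4 * (c\<^sup>2 - \<bar>c * d\<bar> + d\<^sup>2) = (2 * \<bar>c\<bar> - \<bar>d\<bar>)\<^sup>2 + 3 * d\<^sup>2"
        by (simp only: abs_mult power2_abs)
      moreover have "(2 * \<bar>c\<bar> - \<bar>d\<bar>)\<^sup>2 + 3 * d\<^sup>2 > 0"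
      proof (cases "d = 0")
        case True
        then show ?thesis using v by simp
      next
        case False
        then have "d\<^sup>2 > 0" by simp
        then show ?thesis using zero_le_power2[of "2 * \<bar>c\<bar> - \<bar>d\<bar>"] by linarith
      qed
      ultimately show ?thesis by (metis zero_less_mult_pos zero_less_numeral)
    qed
    then show ?thesis by linarith
  qed
  ultimately have "1\<^sup>2 \<le> (norm (of_int c * w + of_int d))\<^sup>2" by (simp add: abs_mult)
  then show ?thesis by (rule power2_le_imp_le) simp
qed

lemma Im_moebius_reduced_le:
  fixes g :: "int^2^2"
  assumes w: "reduced w" and g: "det g = 1"
  shows "Im (moebius g w) \<le> Im w"
proof -
  have Im: "Im w > 0" using w by (simp add: reduced_def)
  have "(g$2$1, g$2$2) \<noteq> (0, 0)" using g by (auto simp: det_2)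
  from norm_add_reduced_ge_1[OF w this]
  have "1 \<le> (norm (of_int (g$2$1) * w + of_int (g$2$2)))\<^sup>2" by simp
  then have "Im w / (norm (of_int (g$2$1) * w + of_int (g$2$2)))\<^sup>2 \<le> Im w / 1"
    using Im by (intro divide_left_mono) auto
  then show ?thesis using Im_moebius[OF Im, of g] g by simp
qed

text \<open>At a reduced point the identity already maximises the imaginary part, so the maximum in
  \<open>ht\<close> is attained. Other points are reached through the invariance of
  \<open>ht\<close>.\<close>

lemma ht_reduced:
  assumes w: "reduced w" shows "ht w = Im w"
  unfolding ht_def
proof (rule Greatest_equality)
  show "\<exists>\<gamma>\<in>carrier SL2Z. Im w = Im (moebius \<gamma> w)"
    by (intro bexI[of _ "mat 1"]) (simp_all add: mat_1_eq_mat2 moebius_def)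
qed (use Im_moebius_reduced_le[OF w] in auto)

lemma ht_moebius:
  fixes g :: "int^2^2"
  assumes z: "Im z > 0" and g: "det g = 1"
  shows "ht (moebius g z) = ht z"
proof -
  have "(\<exists>\<gamma>\<in>carrier SL2Z. h = Im (moebius \<gamma> (moebius g z))) \<longleftrightarrow> (\<exists>\<gamma>\<in>carrier SL2Z. h = Im (moebius \<gamma> z))" for h
  proof
    assume "\<exists>\<gamma>\<in>carrier SL2Z. h = Im (moebius \<gamma> (moebius g z))"
    then obtain \<gamma> where "det \<gamma> = 1" "h = Im (moebius (\<gamma> ** g) z)" using moebius_mult[OF z, of g] g by auto
    then show "\<exists>\<gamma>\<in>carrier SL2Z. h = Im (moebius \<gamma> z)" using g by (intro bexI[of _ "\<gamma> ** g"]) (simp_all add: det_mul)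
  next
    assume "\<exists>\<gamma>\<in>carrier SL2Z. h = Im (moebius \<gamma> z)"
    then obtain \<gamma> where \<gamma>: "det \<gamma> = 1" "h = Im (moebius \<gamma> z)" by auto
    have "\<gamma> = (\<gamma> ** adj2 g) ** g" using g by (simp add: matrix_mul_assoc[symmetric] adj2_inverse)
    then have "h = Im (moebius (\<gamma> ** adj2 g) (moebius g z))" using moebius_mult[OF z, of g "\<gamma> ** adj2 g"] g \<gamma> by simp
    then show "\<exists>\<gamma>\<in>carrier SL2Z. h = Im (moebius \<gamma> (moebius g z))" using g \<gamma> by (intro bexI[of _ "\<gamma> ** adj2 g"]) (simp_all add: det_mul)
  qed
  then show ?thesis by (simp add: ht_def)
qed

text \<open>Im(g z) is the reciprocal of the form at the bottom row of g. Only finitely many bottom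
  rows have a value not above that of (0, 1), so a g of maximal height exists. After a translation
  into the strip, norm below 1 would let the inversion S increase the height.\<close>

lemma reduction:
  assumes z: "Im z > 0"
  obtains g :: "int^2^2" where "det g = 1" "reduced (moebius g z)"
proof -
  define R where "R = {(g$2$1, g$2$2) |g :: int^2^2. det g = 1}"
  obtain \<kappa> where \<kappa>: "\<kappa> > 0" "\<And>c d. \<kappa> * ((real_of_int c)\<^sup>2 + (real_of_int d)\<^sup>2) \<le> quad z (c, d)"
    using quad_lower_bound[OF z] by blast
  define q0 where "q0 = quad z (0, 1)"
  define R' where "R' = {v \<in> R. quad z v \<le> q0}"
  have "(0, 1) \<in> R'"
  proof -
    have "(0, 1) \<in> R" unfolding R_def by (intro CollectI exI[of _ "mat2 1 0 0 1"]) simp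
    then show ?thesis by (simp add: R'_def q0_def)
  qed
  define M where "M = \<lceil>q0 / \<kappa>\<rceil>"
  have "finite R'"
  proof (rule finite_subset)
    show "R' \<subseteq> {-M..M} \<times> {-M..M}"
    proof
      fix v assume v: "v \<in> R'"
      obtain c d where cd: "v = (c, d)" by (cases v)
      have "\<kappa> * ((real_of_int c)\<^sup>2 + (real_of_int d)\<^sup>2) \<le> q0" using \<kappa>(2)[of c d] v cd by (auto simp: R'_def)
      then have "(real_of_int c)\<^sup>2 + (real_of_int d)\<^sup>2 \<le> q0 / \<kappa>" using \<kappa>(1) by (simp add: field_simps)
      also have "\<dots> \<le> real_of_int M" by (simp add: M_def)
      finally have "real_of_int (c\<^sup>2 + d\<^sup>2) \<le> real_of_int M" by simp
      then have M: "c\<^sup>2 + d\<^sup>2 \<le> M" by (simp only: of_int_le_iff)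
      have sq: "\<bar>k\<bar> \<le> k\<^sup>2" for k :: int
      proof (cases "k = 0")
        case False
        then have "\<bar>k\<bar> * 1 \<le> \<bar>k\<bar> * \<bar>k\<bar>" by (intro mult_left_mono) auto
        then show ?thesis by (simp add: power2_eq_square)
      qed simp
      have "0 \<le> c\<^sup>2" "0 \<le> d\<^sup>2" by simp_all
      then have "\<bar>c\<bar> \<le> M" "\<bar>d\<bar> \<le> M" using sq[of c] sq[of d] M by linarith+
      then show "v \<in> {-M..M} \<times> {-M..M}" by (auto simp: cd)
    qed
  qed simp
  define v0 where "v0 = arg_min_on (quad z) R'"
  have v0: "v0 \<in> R'" and v0_min: "\<And>v. v \<in> R' \<Longrightarrow> quad z v0 \<le> quad z v"
    unfolding v0_def using \<open>finite R'\<close> \<open>(0, 1) \<in> R'\<close> by (auto intro: arg_min_if_finite(1) arg_min_least)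
  then obtain g0 :: "int^2^2" where g0: "det g0 = 1" "v0 = (g0$2$1, g0$2$2)" by (auto simp: R'_def R_def)
  have Im_eq: "Im (moebius g z) = 1 / quad z (g$2$1, g$2$2)" if "det g = 1" for g :: "int^2^2"
    using Im_moebius[OF z, of g] that by (simp add: quad_def)
  have quad_pos: "quad z (g$2$1, g$2$2) > 0" if "det g = 1" for g :: "int^2^2"
    using moebius_denom_nonzero[OF z, of g] that z by (simp add: quad_def)
  have max: "Im (moebius g z) \<le> Im (moebius g0 z)" if g: "det g = 1" for g :: "int^2^2"
  proof -
    have "(g$2$1, g$2$2) \<in> R" using g by (auto simp: R_def)
    then have "quad z v0 \<le> quad z (g$2$1, g$2$2)"
      using v0 v0_min[of "(g$2$1, g$2$2)"] by (cases "quad z (g$2$1, g$2$2) \<le> q0") (auto simp: R'_def)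
    then show ?thesis using quad_pos[OF g0(1)] unfolding Im_eq[OF g] Im_eq[OF g0(1)] g0(2) by (intro divide_left_mono) (auto intro: mult_pos_pos quad_pos g g0)
  qed
  define w0 where "w0 = moebius g0 z"
  define k where "k = - round (Re w0)"
  define g where "g = mat2 1 k 0 1 ** g0"
  have g: "det g = 1" by (simp add: g_def det_mul g0)
  have w: "moebius g z = w0 + of_int k"
    unfolding g_def using moebius_mult[OF z, of g0] g0 by (simp add: w0_def) (simp add: moebius_def)
  have w0_pos: "Im w0 > 0" using Im_moebius_pos[OF z, of g0] g0 by (simp add: w0_def)
  have Re: "\<bar>Re (moebius g z)\<bar> \<le> 1/2"
    using of_int_round_abs_le[of "Re w0"] by (simp add: w k_def abs_minus_commute)
  have Im: "Im (moebius g z) = Im w0" by (simp add: w)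
  define S where "S = mat2 0 (-1) 1 0"
  have "Im (moebius (S ** g) z) \<le> Im w0" using max[of "S ** g"] g by (simp add: det_mul S_def w0_def)
  moreover have "moebius (S ** g) z = moebius S (moebius g z)" using moebius_mult[OF z, of g S] g by simp
  moreover have "Im (moebius S (moebius g z)) = Im w0 / (norm (moebius g z))\<^sup>2"
    using Im_moebius[of "moebius g z" S] Im w0_pos by (simp add: S_def)
  ultimately have "Im w0 / (norm (moebius g z))\<^sup>2 \<le> Im w0" by simp
  moreover have "norm (moebius g z) > 0" using Im w0_pos by auto
  ultimately have "1\<^sup>2 \<le> (norm (moebius g z))\<^sup>2" using w0_pos by (simp add: divide_le_eq)
  then have "1 \<le> norm (moebius g z)" by (rule power2_le_imp_le) simp
  then show ?thesis using that[of g] g Re Im w0_pos by (simp add: reduced_def)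
qed

text \<open>The sharp bound is sqrt(3)/2; the rational 3/4 avoids the root and gives sqrt(ht) >= 1/2
  later on.\<close>

lemma Im_reduced_ge: "reduced w \<Longrightarrow> Im w \<ge> 3/4"
proof -
  assume w: "reduced w"
  have "1 \<le> (Re w)\<^sup>2 + (Im w)\<^sup>2" using w unfolding reduced_def by (simp flip: cmod_power2)
  moreover have "(Re w)\<^sup>2 \<le> (1/2)\<^sup>2" using w unfolding reduced_def by (intro abs_le_square_iff[THEN iffD1]) simp
  ultimately have "(3/4)\<^sup>2 \<le> (Im w)\<^sup>2" by (simp add: power2_eq_square)
  then show ?thesis using w unfolding reduced_def by (intro power2_le_imp_le[of "3/4" "Im w"]) auto
qed

lemma ht_ge: "Im z > 0 \<Longrightarrow> ht z \<ge> 3/4"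
  using reduction ht_moebius ht_reduced Im_reduced_ge by metis

subsection \<open>Bounds for theta sums\<close>

text \<open>Comparison of the sum with the integral of 1 / (1 + s x^2), carried out one step at a
  time by the mean value theorem for arctan.\<close>

lemma sum_inverse_le_arctan:
  assumes s: "s > 0"
  shows "(\<Sum>k=1..n. 1 / (1 + s * (real k)\<^sup>2)) \<le> arctan (sqrt s * real n) / sqrt s"
proof (induction n)
  case (Suc n)
  have r: "sqrt s > 0" using s by simp
  have "sqrt s * real n < sqrt s * real (Suc n)" using r by simp
  from MVT2[OF this, of arctan "\<lambda>x. inverse (1 + x\<^sup>2)"]
  obtain \<xi> where \<xi>: "sqrt s * real n < \<xi>" "\<xi> < sqrt s * real (Suc n)"
    "arctan (sqrt s * real (Suc n)) - arctan (sqrt s * real n) = (sqrt s * real (Suc n) - sqrt s * real n) * inverse (1 + \<xi>\<^sup>2)"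
    using DERIV_arctan by blast
  have "0 \<le> sqrt s * real n" using r by simp
  then have "\<xi>\<^sup>2 \<le> (sqrt s * real (Suc n))\<^sup>2" using \<xi> by (intro power_mono) auto
  also have "\<dots> = s * (real (Suc n))\<^sup>2" using s by (simp add: power_mult_distrib)
  finally have "1 / (1 + s * (real (Suc n))\<^sup>2) \<le> 1 / (1 + \<xi>\<^sup>2)"
    using s by (intro divide_left_mono) (auto intro!: mult_pos_pos add_pos_nonneg)
  also have "\<dots> = (arctan (sqrt s * real (Suc n)) - arctan (sqrt s * real n)) / sqrt s"
  proof -
    have "sqrt s * real (Suc n) - sqrt s * real n = sqrt s" by (simp add: algebra_simps)
    then show ?thesis unfolding \<xi>(3) using r by (simp add: divide_inverse)
  qed
  finally have "1 / (1 + s * (real (Suc n))\<^sup>2) \<le> arctan (sqrt s * real (Suc n)) / sqrt s - arctan (sqrt s * real n) / sqrt s"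
    by (simp add: diff_divide_distrib)
  then show ?case using Suc by simp
qed simp

text \<open>After exp(-x) <= 1/(1 + x), the positive and the negative integers each contribute at
  most (pi/2) / sqrt s, by the limit of arctan.\<close>

lemma infsum_int_gauss_le:
  assumes s: "s > 0"
  shows "(\<Sum>\<^sub>\<infinity>k::int. exp (- (s * (real_of_int k)\<^sup>2))) \<le> 1 + pi / sqrt s"
proof (rule infsum_le_finite_sums)
  show "(\<lambda>k::int. exp (- (s * (real_of_int k)\<^sup>2))) summable_on UNIV" by (rule summable_on_int_gauss'[OF s])
  fix F :: "int set" assume F: "finite F"
  define f where "f = (\<lambda>k::int. exp (- (s * (real_of_int k)\<^sup>2)))"
  obtain n :: nat where n: "\<And>k. k \<in> F \<Longrightarrow> \<bar>k\<bar> \<le> int n"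
  proof -
    have "\<bar>k\<bar> \<le> int (nat (\<Sum>k\<in>F. \<bar>k\<bar>))" if "k \<in> F" for k
      using member_le_sum[OF that _ F, of abs] by simp
    then show ?thesis using that by blast
  qed
  define P where "P = int ` {1..n}"
  have sumP: "sum f P \<le> pi / 2 / sqrt s" "sum f (uminus ` P) \<le> pi / 2 / sqrt s"
  proof -
    have "sum f P = (\<Sum>k=1..n. exp (- (s * (real k)\<^sup>2)))"
      unfolding P_def f_def by (subst sum.reindex) auto
    also have "\<dots> \<le> (\<Sum>k=1..n. 1 / (1 + s * (real k)\<^sup>2))"
      using s by (intro sum_mono exp_minus_le_inverse) simp
    also have "\<dots> \<le> arctan (sqrt s * real n) / sqrt s" by (rule sum_inverse_le_arctan[OF s])
    also have "\<dots> \<le> pi / 2 / sqrt s" using s arctan_ubound[of "sqrt s * real n"] by (intro divide_right_mono) auto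
    finally show 1: "sum f P \<le> pi / 2 / sqrt s" .
    have "sum f (uminus ` P) = sum f P" by (subst sum.reindex) (auto simp: f_def)
    then show "sum f (uminus ` P) \<le> pi / 2 / sqrt s" using 1 by simp
  qed
  have "F \<subseteq> insert 0 (P \<union> uminus ` P)"
  proof
    fix k assume k: "k \<in> F"
    have P: "k \<in> P" if "k > 0" "k \<le> int n" for k
      unfolding P_def using that by (intro image_eqI[of _ _ "nat k"]) auto
    show "k \<in> insert 0 (P \<union> uminus ` P)"
      using P[of k] P[of "-k"] n[OF k] by (cases k "0 :: int" rule: linorder_cases) (auto intro: image_eqI[of _ _ "-k"])
  qed
  then have "sum f F \<le> sum f (insert 0 (P \<union> uminus ` P))"
    by (intro sum_mono2) (auto simp: P_def f_def)
  also have "\<dots> \<le> f 0 + (sum f P + sum f (uminus ` P))"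
  proof -
    have "sum f (insert 0 (P \<union> uminus ` P)) = f 0 + sum f (P \<union> uminus ` P)"
      by (rule sum.insert) (auto simp: P_def)
    moreover have "sum f (P \<union> uminus ` P) = sum f P + sum f (uminus ` P)"
      by (rule sum.union_disjoint) (auto simp: P_def)
    ultimately show ?thesis by simp
  qed
  also have "\<dots> \<le> 1 + pi / sqrt s" using sumP by (simp add: f_def)
  finally show "sum (\<lambda>k. exp (- (s * (real_of_int k)\<^sup>2))) F \<le> 1 + pi / sqrt s" by (simp add: f_def)
qed

text \<open>On the reduced domain the form is comparable to a diagonal one: |2x| <= 1 bounds the
  cross term by (C^2 + D^2)/2, and as |w| >= 1 half of C^2 |w|^2 pays for C^2/2.\<close>

lemma quad_reduced_ge:
  assumes w: "reduced w"
  shows "((real_of_int c)\<^sup>2 * Im w + (real_of_int d)\<^sup>2 / Im w) / 2 \<le> quad w (c, d)"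
proof -
  define x y C D where "x = Re w" and "y = Im w" and "C = real_of_int c" and "D = real_of_int d"
  have y: "y > 0" using w by (simp add: reduced_def y_def)
  have nw: "1 \<le> x\<^sup>2 + y\<^sup>2" using w unfolding reduced_def x_def y_def by (simp flip: cmod_power2)
  have x: "\<bar>2 * x\<bar> \<le> 1" using w by (simp add: reduced_def x_def abs_mult)
  have "\<bar>2 * (C * D) * x\<bar> = \<bar>C * D\<bar> * \<bar>2 * x\<bar>" by (simp add: abs_mult)
  also have "\<dots> \<le> \<bar>C * D\<bar> * 1" using x by (intro mult_left_mono) auto
  also have "\<dots> \<le> (C\<^sup>2 + D\<^sup>2) / 2" 
    using zero_le_power2[of "\<bar>C\<bar> - \<bar>D\<bar>"] unfolding power2_diff by (simp add: abs_mult)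
  finally have "- ((C\<^sup>2 + D\<^sup>2) / 2) \<le> 2 * (C * D) * x" using abs_le_D2 minus_le_iff by blast
  moreover have "C\<^sup>2 * 1 \<le> C\<^sup>2 * (x\<^sup>2 + y\<^sup>2)" using nw by (intro mult_left_mono) auto
  moreover have "(C * x + D)\<^sup>2 + (C * y)\<^sup>2 = C\<^sup>2 * (x\<^sup>2 + y\<^sup>2) + 2 * (C * D) * x + D\<^sup>2"
    by (simp add: power2_eq_square algebra_simps)
  moreover have "C\<^sup>2 * (x\<^sup>2 + y\<^sup>2) = C\<^sup>2 * x\<^sup>2 + C\<^sup>2 * y\<^sup>2" by (simp add: algebra_simps)
  moreover have "0 \<le> C\<^sup>2 * x\<^sup>2" by simp
  ultimately have "(C\<^sup>2 * y\<^sup>2 + D\<^sup>2) / 2 \<le> (C * x + D)\<^sup>2 + (C * y)\<^sup>2" by argo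
  then have "(C\<^sup>2 * y\<^sup>2 + D\<^sup>2) / 2 / y \<le> ((C * x + D)\<^sup>2 + (C * y)\<^sup>2) / y" using y by (intro divide_right_mono) auto
  also have "(C\<^sup>2 * y\<^sup>2 + D\<^sup>2) / 2 / y = (C\<^sup>2 * y + D\<^sup>2 / y) / 2" using y by (simp add: field_simps power2_eq_square)
  finally show ?thesis unfolding quad_eq C_def D_def x_def y_def .
qed

text \<open>Expanding a product of two one-dimensional sums leaves three error terms. The ones
  linear in pi contribute 2 and 1 times pi sqrt(8/pi), their product 2 pi^2 (8/pi); the eights come
  from the exponents pi/8 left by the diagonal bound.\<close>

definition theta_const :: real where
  "theta_const = 3 * pi * sqrt (8 / pi) + 2 * pi\<^sup>2 * (8 / pi)"

text \<open>The sum runs over all of the lattice and so is invariant under SL2Z, which allows z to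
  be replaced by a reduced point w with Im w = ht z. There the diagonal lower bound splits it into a
  product of two Gaussian sums.\<close>

lemma infsum_exp_quad_le:
  assumes z: "Im z > 0" and t: "t \<ge> 1"
  shows "(\<Sum>\<^sub>\<infinity>v. exp (- (pi / 4 * t * quad z v))) \<le> 1 + theta_const * sqrt (ht z) / sqrt t"
proof -
  obtain g :: "int^2^2" where g: "det g = 1" "reduced (moebius g z)" using reduction[OF z] by blast
  define w where "w = moebius g z"
  define y where "y = Im w"
  have w: "reduced w" using g by (simp add: w_def)
  have y: "y \<ge> 3/4" "y > 0" using Im_reduced_ge[OF w] by (auto simp: y_def)
  have hty: "ht z = y" using ht_moebius[OF z g(1)] ht_reduced[OF w] by (simp add: w_def y_def)
  have "(\<Sum>\<^sub>\<infinity>v. exp (- (pi / 4 * t * quad w v))) = (\<Sum>\<^sub>\<infinity>v. exp (- (pi / 4 * t * quad z (vact v g))))"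
    using quad_moebius[OF z, of g] g by (simp add: w_def)
  also have "\<dots> = infsum (\<lambda>v. exp (- (pi / 4 * t * quad z v))) (range (\<lambda>v. vact v g))"
    using infsum_reindex[OF inj_vact[of g], of "\<lambda>v. exp (- (pi / 4 * t * quad z v))"] g by (simp add: o_def)
  also have "range (\<lambda>v. vact v g) = UNIV"
    using range_vact_SL2Z[OF g(1), of "mat 1"] by simp
  finally have eq: "(\<Sum>\<^sub>\<infinity>v. exp (- (pi / 4 * t * quad z v))) = (\<Sum>\<^sub>\<infinity>v. exp (- (pi / 4 * t * quad w v)))" by simp
  define s1 s2 where "s1 = pi / 8 * t * y" and "s2 = pi / 8 * t / y"
  have s: "s1 > 0" "s2 > 0" using t y by (auto simp: s1_def s2_def)
  define f where "f = (\<lambda>s (k::int). exp (- (s * (real_of_int k)\<^sup>2)))"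
  have fs: "f s summable_on UNIV" if "s > 0" for s
    unfolding f_def using that by (rule summable_on_int_gauss')
  have ff: "(\<lambda>(c, d). f s1 c * f s2 d) summable_on (UNIV \<times> UNIV)"
    using summable_on_times_real[OF fs[OF s(1)] _ fs[OF s(2)]] by (simp add: f_def)
  have "(\<Sum>\<^sub>\<infinity>v. exp (- (pi / 4 * t * quad w v))) \<le> infsum (\<lambda>(c, d). f s1 c * f s2 d) UNIV"
  proof (rule infsum_mono)
    show "(\<lambda>v. exp (- (pi / 4 * t * quad w v))) summable_on UNIV"
      using summable_exp_quad[of w "pi / 4 * t"] w t by (simp add: reduced_def)
    show "(\<lambda>(c, d). f s1 c * f s2 d) summable_on UNIV" using ff by simp
    fix v :: "int \<times> int"
    obtain c d where v: "v = (c, d)" by (cases v)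
    have "pi / 4 * t * (((real_of_int c)\<^sup>2 * y + (real_of_int d)\<^sup>2 / y) / 2) \<le> pi / 4 * t * quad w v"
      unfolding v y_def using t by (intro mult_left_mono quad_reduced_ge[OF w]) auto
    moreover have "s1 * (real_of_int c)\<^sup>2 + s2 * (real_of_int d)\<^sup>2 = pi / 4 * t * (((real_of_int c)\<^sup>2 * y + (real_of_int d)\<^sup>2 / y) / 2)"
      by (simp add: s1_def s2_def algebra_simps)
    moreover have "f s1 c * f s2 d = exp (- (s1 * (real_of_int c)\<^sup>2 + s2 * (real_of_int d)\<^sup>2))"
      by (simp add: f_def flip: exp_add)
    ultimately show "exp (- (pi / 4 * t * quad w v)) \<le> (case v of (c, d) \<Rightarrow> f s1 c * f s2 d)"
      by (simp only: v case_prod_conv exp_le_cancel_iff neg_le_iff_le)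
  qed
  also have "\<dots> = (\<Sum>\<^sub>\<infinity>c. \<Sum>\<^sub>\<infinity>d. f s1 c * f s2 d)"
    using infsum_Sigma'_banach[of "\<lambda>c d. f s1 c * f s2 d" UNIV "\<lambda>_. UNIV"] ff by simp
  also have "\<dots> = infsum (f s1) UNIV * infsum (f s2) UNIV"
    by (simp add: infsum_cmult_right' infsum_cmult_left')
  also have "\<dots> \<le> (1 + pi / sqrt s1) * (1 + pi / sqrt s2)"
    unfolding f_def using s by (intro mult_mono infsum_int_gauss_le infsum_nonneg add_nonneg_nonneg) auto
  also have "\<dots> = 1 + pi / sqrt s1 + pi / sqrt s2 + pi\<^sup>2 / (sqrt s1 * sqrt s2)"
    by (simp add: power2_eq_square algebra_simps)
  also have "sqrt s1 * sqrt s2 = pi / 8 * t"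
  proof -
    have "s1 * s2 = (pi / 8 * t)\<^sup>2" using y by (simp add: s1_def s2_def power2_eq_square)
    then have "sqrt (s1 * s2) = \<bar>pi / 8 * t\<bar>" by (simp only: real_sqrt_abs)
    then show ?thesis using t by (simp add: real_sqrt_mult)
  qed
  also have "pi\<^sup>2 / (pi / 8 * t) \<le> 2 * pi\<^sup>2 * (8 / pi) * (sqrt y / sqrt t)"
  proof -
    have "1 / t \<le> 1 / sqrt t"
    proof (rule divide_left_mono)
      have "sqrt t * 1 \<le> sqrt t * sqrt t" using t by (intro mult_left_mono) auto
      then show "sqrt t \<le> t" using t by simp
    qed (use t in auto)
    also have "\<dots> \<le> 2 * sqrt y / sqrt t"
    proof (intro divide_right_mono)
      have "(1/2)\<^sup>2 \<le> y" using y by (simp add: power2_eq_square)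
      then have "1/2 \<le> sqrt y" by (rule real_le_rsqrt)
      then show "1 \<le> 2 * sqrt y" by simp
    qed (use t in simp)
    finally have "(pi\<^sup>2 * (8 / pi)) * (1 / t) \<le> (pi\<^sup>2 * (8 / pi)) * (2 * sqrt y / sqrt t)"
      by (intro mult_left_mono) auto
    then show ?thesis by (simp add: field_simps)
  qed
  also have "pi / sqrt s2 = pi * sqrt (8 / pi) * (sqrt y / sqrt t)"
  proof -
    have "1 / s2 = (8 / pi) * (y / t)" by (simp add: s2_def)
    then have "sqrt (1 / s2) = sqrt (8 / pi) * (sqrt y / sqrt t)" by (simp only: real_sqrt_mult real_sqrt_divide)
    moreover have "pi / sqrt s2 = pi * sqrt (1 / s2)" by (simp add: real_sqrt_divide)
    ultimately show ?thesis by (simp only: mult.assoc)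
  qed
  \<comment> \<open>This term is of the smaller order (y t)^(-1/2); since 4 y^2 >= 1 it can be
    merged with the dominant sqrt(y / t).\<close>
  also have "pi / sqrt s1 \<le> 2 * pi * sqrt (8 / pi) * (sqrt y / sqrt t)"
  proof -
    have "1 / s1 = (8 / pi) * (1 / (y * t))" by (simp add: s1_def)
    also have "\<dots> \<le> (8 / pi) * (4 * y / t)"
    proof (rule mult_left_mono)
      have "(3/4) * (3/4) \<le> y * y" using y by (intro mult_mono) auto
      then have "1 \<le> 4 * y * y" by simp
      then show "1 / (y * t) \<le> 4 * y / t" using y t by (simp add: field_simps)
    qed simp
    finally have "sqrt (1 / s1) \<le> sqrt ((8 / pi) * (4 * y / t))" by (rule real_sqrt_le_mono)
    also have "\<dots> = sqrt (8 / pi) * (2 * sqrt y / sqrt t)" by (simp only: real_sqrt_mult real_sqrt_divide real_sqrt_four)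
    finally have "pi * sqrt (1 / s1) \<le> pi * (sqrt (8 / pi) * (2 * sqrt y / sqrt t))" by (intro mult_left_mono) auto
    then show ?thesis by (simp add: real_sqrt_divide mult_ac)
  qed
  also have "1 + 2 * pi * sqrt (8 / pi) * (sqrt y / sqrt t) + pi * sqrt (8 / pi) * (sqrt y / sqrt t) + 2 * pi\<^sup>2 * (8 / pi) * (sqrt y / sqrt t)
     = 1 + theta_const * (sqrt y / sqrt t)"
  proof -
    have "1 + 2 * p * S * Q + p * S * Q + m * Q = 1 + (3 * p * S + m) * Q" for p S Q m :: real
      by (simp add: algebra_simps)
    then show ?thesis unfolding theta_const_def .
  qed
  finally show ?thesis unfolding eq hty by simp
qed

lemma theta_const_nonneg: "theta_const \<ge> 0"
  by (simp add: theta_const_def)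

text \<open>The zero vector gives the main term 1/2. The signs of the other terms are discarded, and
  their sum is bounded by the unsigned one.\<close>

lemma theta_lattice_approx:
  assumes z: "Im z > 0" and t: "t \<ge> 1"
  shows "\<bar>theta_lattice t z - 1/2\<bar> \<le> theta_const * sqrt (ht z) / sqrt t"
proof -
  let ?e = "\<lambda>v. exp (- (pi / 4 * t * quad z v))"
  have t': "pi / 4 * t > 0" using t by simp
  have s: "?e summable_on A" for A by (rule summable_exp_quad[OF z t'])
  have s': "(\<lambda>v. theta_char v * ?e v) summable_on A" for A by (rule summable_theta_lattice[OF z t'])
  have U: "insert (0, 0) (- {(0, 0)}) = (UNIV :: (int \<times> int) set)" by auto
  have "(\<Sum>\<^sub>\<infinity>v. theta_char v * ?e v) = theta_char (0, 0) * ?e (0, 0) + infsum (\<lambda>v. theta_char v * ?e v) (- {(0, 0)})"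
    using infsum_insert[OF s', of "(0, 0)" "- {(0, 0)}"] unfolding U by simp
  then have 1: "2 * theta_lattice t z = 1 + infsum (\<lambda>v. theta_char v * ?e v) (- {(0, 0)})"
    by (simp add: theta_lattice_def theta_char_def quad_def)
  have "(\<Sum>\<^sub>\<infinity>v. ?e v) = ?e (0, 0) + infsum ?e (- {(0, 0)})"
    using infsum_insert[OF s, of "(0, 0)" "- {(0, 0)}"] unfolding U by simp
  then have 2: "infsum ?e (- {(0, 0)}) \<le> theta_const * sqrt (ht z) / sqrt t"
    using infsum_exp_quad_le[OF z t] by (simp add: quad_def)
  have le: "norm (theta_char v * ?e v) \<le> ?e v" for v
    using mult_right_mono[OF abs_theta_char_le[of v], of "?e v"] by (simp add: abs_mult)
  have ns: "(\<lambda>v. norm (theta_char v * ?e v)) summable_on A" for A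
    by (rule summable_on_comparison_test[OF s[of A] le]) simp
  have "norm (infsum (\<lambda>v. theta_char v * ?e v) (- {(0, 0)})) \<le> infsum (\<lambda>v. norm (theta_char v * ?e v)) (- {(0, 0)})"
    by (rule norm_infsum_bound[OF ns])
  also have "\<dots> \<le> infsum ?e (- {(0, 0)})" by (rule infsum_mono[OF ns s le])
  finally have "\<bar>2 * theta_lattice t z - 1\<bar> \<le> theta_const * sqrt (ht z) / sqrt t" using 1 2 by simp
  then show ?thesis by argo
qed

text \<open>Each divisor e with e^2 >= n is estimated directly, the others through the functional
  equation. The main terms max(e, n/e)/2 add up to almost \<sigma>: max and min together are e +
  n/e, both of which sum to \<sigma>, and each min is at most sqrt n. Division by \<sigma> >= n
  turns sqrt n into n^(-1/2).\<close>

lemma hecke_theta_approx: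
  assumes z: "Im z > 0" and n: "n > 0"
  defines "\<sigma> \<equiv> real (\<Sum>e\<in>{e. e dvd n}. e)"
  shows "\<bar>(\<Sum>e\<in>{e. e dvd n}. real e * theta_lattice ((real e)\<^sup>2 / real n) z) / \<sigma> - 1\<bar>
    \<le> (theta_const + 1) * real (card {e. e dvd n}) * real n powr (-1/2) * sqrt (ht z)"
proof -
  define D where "D = {e. e dvd n}"
  have fin: "finite D" using n by (simp add: D_def)
  have D: "e > 0" "n = e * (n div e)" if "e \<in> D" for e using that n by (auto simp: D_def intro: Nat.gr0I)
  define r where "r = sqrt (real n)"
  have r: "r > 0" "r * r = real n" using n by (auto simp: r_def)
  define E where "E = theta_const * r * sqrt (ht z)"
  have main: "\<bar>real e * theta_lattice ((real e)\<^sup>2 / real n) z - max (real e) (real n / real e) / 2\<bar> \<le> E" if e: "e \<in> D" for e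
  proof (cases "real e \<ge> r")
    case True
    define t where "t = (real e)\<^sup>2 / real n"
    have e0: "real e > 0" using D(1)[OF e] by simp
    have ee: "r * r \<le> real e * real e" using True r by (intro mult_mono) auto
    have t: "t \<ge> 1" using ee r n unfolding t_def by (simp add: power2_eq_square)
    have st: "sqrt t = real e / r" using e0 by (simp add: t_def real_sqrt_divide r_def)
    have mx: "max (real e) (real n / real e) = real e" using ee r e0 by (simp add: max_def field_simps)
    have "real e * theta_lattice t z - real e / 2 = real e * (theta_lattice t z - 1/2)" by (simp add: right_diff_distrib)
    then have "\<bar>real e * theta_lattice t z - real e / 2\<bar> = real e * \<bar>theta_lattice t z - 1/2\<bar>"
      by (simp only: abs_mult abs_of_nat)
    also have "\<dots> \<le> real e * (theta_const * sqrt (ht z) / sqrt t)"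
      using e0 by (intro mult_left_mono theta_lattice_approx[OF z t]) auto
    also have "\<dots> = E" unfolding st E_def using e0 r by simp
    finally show ?thesis unfolding mx t_def .
  next
    case False
    define t where "t = (real e)\<^sup>2 / real n"
    have e0: "real e > 0" using D(1)[OF e] by simp
    have ee: "real e * real e \<le> r * r" using False r by (intro mult_mono) auto
    have t0: "t > 0" using e0 n by (simp add: t_def)
    have t1: "1 / t \<ge> 1" using ee r e0 unfolding t_def by (simp add: power2_eq_square)
    have st: "sqrt (1 / t) = r / real e" using e0 by (simp add: t_def real_sqrt_divide r_def)
    define f where "f = real n / real e"
    have f: "f > 0" using e0 n by (simp add: f_def)
    have mx: "max (real e) (real n / real e) = f" using ee r e0 by (simp add: max_def field_simps f_def)
    have "real e * theta_lattice t z = f * theta_lattice (1 / t) z"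
      using theta_lattice_inverse[OF z t0] e0 n by (simp add: t_def f_def power2_eq_square)
    then have "real e * theta_lattice t z - f / 2 = f * (theta_lattice (1 / t) z - 1/2)" by (simp add: right_diff_distrib)
    then have "\<bar>real e * theta_lattice t z - f / 2\<bar> = f * \<bar>theta_lattice (1 / t) z - 1/2\<bar>"
      using f by (simp only: abs_mult abs_of_pos)
    also have "\<dots> \<le> f * (theta_const * sqrt (ht z) / sqrt (1 / t))"
      using f by (intro mult_left_mono theta_lattice_approx[OF z t1]) auto
    also have "\<dots> = E" unfolding st E_def f_def r(2)[symmetric] using e0 r(1) by simp
    finally show ?thesis unfolding mx t_def .
  qed
  have \<sigma>: "\<sigma> = (\<Sum>e\<in>D. real e)" by (simp add: \<sigma>_def D_def)
  have \<sigma>': "\<sigma> = (\<Sum>e\<in>D. real n / real e)"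
  proof -
    have "\<sigma> = (\<Sum>e\<in>D. real (n div e))" unfolding \<sigma>
      by (rule sum.reindex_bij_witness[of _ "\<lambda>e. n div e" "\<lambda>e. n div e"]) (use n in \<open>auto simp: D_def elim!: dvdE\<close>)
    also have "\<dots> = (\<Sum>e\<in>D. real n / real e)"
      by (rule sum.cong) (auto simp: D_def real_of_nat_div)
    finally show ?thesis .
  qed
  have \<sigma>_ge: "\<sigma> \<ge> real n" unfolding \<sigma> using member_le_sum[of n D real] fin by (simp add: D_def)
  have minle: "0 \<le> min (real e) (real n / real e)" "min (real e) (real n / real e) \<le> r" if e: "e \<in> D" for e
  proof -
    have e0: "real e > 0" using D(1)[OF e] by simp
    show "0 \<le> min (real e) (real n / real e)" by simp
    show "min (real e) (real n / real e) \<le> r"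
    proof (cases "real e \<le> r")
      case False
      then have "r * r \<le> r * real e" using r by (intro mult_left_mono) auto
      then have "real n / real e \<le> r" using r e0 by (simp add: field_simps)
      then show ?thesis by simp
    qed simp
  qed
  have "2 * \<sigma> = (\<Sum>e\<in>D. real e + real n / real e)" using \<sigma> \<sigma>' by (simp add: sum.distrib)
  also have "\<dots> = (\<Sum>e\<in>D. max (real e) (real n / real e)) + (\<Sum>e\<in>D. min (real e) (real n / real e))"
    unfolding sum.distrib[symmetric] by (rule sum.cong) auto
  finally have two: "\<sigma> = (\<Sum>e\<in>D. max (real e) (real n / real e) / 2) + (\<Sum>e\<in>D. min (real e) (real n / real e)) / 2"
    by (simp add: sum_divide_distrib[symmetric])
  define T where "T = (\<Sum>e\<in>D. real e * theta_lattice ((real e)\<^sup>2 / real n) z)"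
  have "\<bar>T - (\<Sum>e\<in>D. max (real e) (real n / real e) / 2)\<bar> \<le> (\<Sum>e\<in>D. E)"
    unfolding T_def sum_subtractf[symmetric] by (rule order_trans[OF sum_abs sum_mono[OF main]])
  then have 1: "\<bar>T - (\<Sum>e\<in>D. max (real e) (real n / real e) / 2)\<bar> \<le> real (card D) * E" by simp
  have "0 \<le> (\<Sum>e\<in>D. min (real e) (real n / real e))" by (intro sum_nonneg minle)
  moreover have "(\<Sum>e\<in>D. min (real e) (real n / real e)) \<le> real (card D) * r"
    using sum_mono[OF minle(2), of D] by simp
  ultimately have "\<bar>T - \<sigma>\<bar> \<le> real (card D) * E + real (card D) * r / 2" using 1 two by argo
  also have "\<dots> = real (card D) * (E + r / 2)" by (simp add: algebra_simps)
  also have "\<dots> \<le> real (card D) * ((theta_const + 1) * r * sqrt (ht z))"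
  \<comment> \<open>The error r/2 from the minima has no height factor; sqrt(ht z) >= 1/2 allows it
    to be absorbed as the +1 in the constant.\<close>
  proof (rule mult_left_mono)
    have "(1/2)\<^sup>2 \<le> ht z" using ht_ge[OF z] by (simp add: power2_eq_square)
    then have "1/2 \<le> sqrt (ht z)" by (rule real_le_rsqrt)
    then have "r * (1/2) \<le> r * sqrt (ht z)" using r by (intro mult_left_mono) auto
    then show "E + r / 2 \<le> (theta_const + 1) * r * sqrt (ht z)" unfolding E_def by (simp add: algebra_simps)
  qed simp
  finally have A: "\<bar>T - \<sigma>\<bar> \<le> real (card D) * ((theta_const + 1) * r * sqrt (ht z))" .
  have \<sigma>0: "\<sigma> > 0" using \<sigma>_ge n by simp
  have "T / \<sigma> - 1 = (T - \<sigma>) / \<sigma>" using \<sigma>0 by (simp add: diff_divide_distrib)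
  then have "\<bar>T / \<sigma> - 1\<bar> = \<bar>T - \<sigma>\<bar> / \<sigma>" using \<sigma>0 by (simp only: abs_divide abs_of_pos)
  also have "\<dots> \<le> real (card D) * ((theta_const + 1) * r * sqrt (ht z)) / \<sigma>"
    using A \<sigma>0 by (intro divide_right_mono) auto
  also have "\<dots> \<le> real (card D) * ((theta_const + 1) * r * sqrt (ht z)) / real n"
    using \<sigma>_ge \<sigma>0 n r theta_const_nonneg ht_ge[OF z] by (intro divide_left_mono) auto
  also have "\<dots> = (theta_const + 1) * real (card D) * (r / real n) * sqrt (ht z)" by simp
  finally have "\<bar>T / \<sigma> - 1\<bar> \<le> (theta_const + 1) * real (card D) * (r / real n) * sqrt (ht z)" .
  moreover have "r / real n = real n powr (-1/2)"
  proof -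
    have "(-1/2 :: real) = - (1/2)" by simp
    then have "real n powr (-1/2) = inverse (real n powr (1/2))" by (simp only: powr_minus)
    also have "real n powr (1/2) = r" unfolding r_def by (rule powr_half_sqrt) simp
    also have "inverse r = 1 / r" by (simp add: divide_inverse)
    also have "\<dots> = r / real n" unfolding r(2)[symmetric] using r(1) by simp
    finally show ?thesis by simp
  qed
  ultimately have "\<bar>T / \<sigma> - 1\<bar> \<le> (theta_const + 1) * real (card D) * real n powr (-1/2) * sqrt (ht z)" by metis
  then show ?thesis unfolding T_def D_def .
qed

subsection \<open>Invariance of the hyperbolic measure\<close>

text \<open>The underlying theorem speaks of absolutely integrable vector-valued functions, so real
  functions are passed through vectors with one entry, and the conclusion is an equivalence for each
  finite value r. Infinite integrals are recovered later by exclusion.\<close>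

lemma change_of_variables_nn_integral:
  fixes g :: "real^'n::{finite,wellorder} \<Rightarrow> real^'n::_" and f :: "real^'n::_ \<Rightarrow> real"
  assumes S: "S \<in> sets borel" and gS: "g ` S \<in> sets borel"
    and der: "\<And>x. x \<in> S \<Longrightarrow> (g has_derivative g' x) (at x within S)"
    and inj: "inj_on g S"
    and f: "f \<in> borel_measurable borel" "\<And>x. 0 \<le> f x"
    and h: "h \<in> borel_measurable borel" "\<And>x. 0 \<le> h x" "\<And>x. x \<in> S \<Longrightarrow> h x = \<bar>det (matrix (g' x))\<bar> * f (g x)"
    and r: "0 \<le> r"
  shows "(\<integral>\<^sup>+x. ennreal (h x * indicator S x) \<partial>lborel) = ennreal r \<longleftrightarrow>
         (\<integral>\<^sup>+x. ennreal (f x * indicator (g ` S) x) \<partial>lborel) = ennreal r"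
proof -
  have key: "(\<integral>\<^sup>+x. ennreal (k x * indicator X x) \<partial>lborel) = ennreal r \<longleftrightarrow> k absolutely_integrable_on X \<and> integral X k = r"
    if X: "X \<in> sets borel" and k: "k \<in> borel_measurable borel" "\<And>x. 0 \<le> k x" for k :: "real^'n::_ \<Rightarrow> real" and X
  proof -
    have meas: "(\<lambda>x. k x * indicator X x) \<in> borel_measurable borel" using X k by measurable
    have "(\<integral>\<^sup>+x. ennreal (k x * indicator X x) \<partial>lborel) = (\<integral>\<^sup>+x. ennreal (k x * indicator X x) \<partial>lebesgue)"
      by (rule nn_integral_completion[symmetric])
    moreover have "((\<lambda>x. k x * indicator X x) has_integral r) UNIV \<longleftrightarrow> (\<integral>\<^sup>+x. ennreal (k x * indicator X x) \<partial>lebesgue) = ennreal r"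
      using has_integral_iff_nn_integral_lebesgue[of "\<lambda>x. k x * indicator X x" r] k r meas
      by (auto simp: measurable_completion)
    moreover have "((\<lambda>x. k x * indicator X x) has_integral r) UNIV \<longleftrightarrow> (k has_integral r) X"
    proof -
      have "(\<lambda>x. k x * indicator X x) = (\<lambda>x. if x \<in> X then k x else 0)" by auto
      then show ?thesis by (simp only: has_integral_restrict_UNIV)
    qed
    moreover have "(k has_integral r) X \<longleftrightarrow> k absolutely_integrable_on X \<and> integral X k = r"
      using k(2) by (auto simp: has_integral_iff absolutely_integrable_on_iff_nonneg)
    ultimately show ?thesis by simp
  qed
  have "(\<integral>\<^sup>+x. ennreal (h x * indicator S x) \<partial>lborel) = ennreal r \<longleftrightarrow> h absolutely_integrable_on S \<and> integral S h = r"
    by (rule key[OF S h(1,2)])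
  also have "\<dots> \<longleftrightarrow> (\<lambda>x. \<bar>det (matrix (g' x))\<bar> *\<^sub>R vec (f (g x)) :: real^1) absolutely_integrable_on S \<and>
     integral S (\<lambda>x. \<bar>det (matrix (g' x))\<bar> *\<^sub>R vec (f (g x)) :: real^1) = vec r"
  proof -
    have 1: "(\<lambda>x. \<bar>det (matrix (g' x))\<bar> *\<^sub>R vec (f (g x)) :: real^1) = (\<lambda>x. vec (\<bar>det (matrix (g' x))\<bar> * f (g x)))"
      by (auto simp: vec_eq_iff)
    have 2: "h absolutely_integrable_on S \<longleftrightarrow> (\<lambda>x. \<bar>det (matrix (g' x))\<bar> * f (g x)) absolutely_integrable_on S"
      using h(3) by (intro absolutely_integrable_spike_eq[of "{}"]) auto
    have 3: "integral S h = integral S (\<lambda>x. \<bar>det (matrix (g' x))\<bar> * f (g x))"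
      using h(3) by (intro Henstock_Kurzweil_Integration.integral_cong) auto
    show ?thesis unfolding 1 2 3 absolutely_integrable_on_1_iff
      by (auto simp: integral_on_1_eq vec_eq_iff)
  qed
  also have "\<dots> \<longleftrightarrow> (\<lambda>x. vec (f x) :: real^1) absolutely_integrable_on (g ` S) \<and> integral (g ` S) (\<lambda>x. vec (f x) :: real^1) = vec r"
    using S by (intro has_absolute_integral_change_of_variables der inj) auto
  also have "\<dots> \<longleftrightarrow> f absolutely_integrable_on (g ` S) \<and> integral (g ` S) f = r"
    unfolding absolutely_integrable_on_1_iff by (auto simp: integral_on_1_eq vec_eq_iff)
  also have "\<dots> \<longleftrightarrow> (\<integral>\<^sup>+x. ennreal (f x * indicator (g ` S) x) \<partial>lborel) = ennreal r"
    by (rule key[OF gS f, symmetric])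
  finally show ?thesis .
qed

definition complex_of_vec :: "real^2 \<Rightarrow> complex" where "complex_of_vec v = Complex (v$1) (v$2)"
definition vec_of_complex :: "complex \<Rightarrow> real^2" where "vec_of_complex z = vector [Re z, Im z]"

lemma complex_of_vec_inverse [simp]: "complex_of_vec (vec_of_complex z) = z" "vec_of_complex (complex_of_vec v) = v"
  by (simp_all add: complex_of_vec_def vec_of_complex_def vec_eq_iff forall_2)

lemma Re_complex_of_vec [simp]: "Re (complex_of_vec v) = v$1" "Im (complex_of_vec v) = v$2"
  by (simp_all add: complex_of_vec_def)

lemma vec_of_complex_nth [simp]: "vec_of_complex z $ 1 = Re z" "vec_of_complex z $ 2 = Im z"
  by (simp_all add: vec_of_complex_def)

lemma bounded_linear_complex_of_vec: "bounded_linear complex_of_vec"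
  by (intro linear_conv_bounded_linear[THEN iffD1] linearI) (simp_all add: complex_eq_iff)

lemma bounded_linear_vec_of_complex: "bounded_linear vec_of_complex"
  by (intro linear_conv_bounded_linear[THEN iffD1] linearI) (simp_all add: vec_eq_iff forall_2)

lemma measurable_complex_of_vec [measurable]: "complex_of_vec \<in> borel_measurable borel"
  by (intro borel_measurable_continuous_onI linear_continuous_on bounded_linear_complex_of_vec)

lemma lborel_complex_eq_distr_vec: "(lborel :: complex measure) = distr lborel borel complex_of_vec"
proof (rule lborel_eqI)
  fix l u :: complex assume le: "\<And>b. b \<in> Basis \<Longrightarrow> l \<bullet> b \<le> u \<bullet> b"
  then have le': "Re l \<le> Re u" "Im l \<le> Im u" using le[of 1] le[of \<i>] by (simp_all add: Basis_complex_def)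
  have "complex_of_vec -` box l u = box (vec_of_complex l) (vec_of_complex u)"
    by (auto simp: box_def Basis_complex_def Basis_vec_def inner_axis forall_2 axis_eq_axis)
  then have "emeasure (distr lborel borel complex_of_vec) (box l u) = emeasure lborel (box (vec_of_complex l) (vec_of_complex u))"
    by (subst emeasure_distr) auto
  also have "\<dots> = ennreal ((Re u - Re l) * (Im u - Im l))"
    using le' by (subst emeasure_lborel_box) (auto simp: Basis_vec_def inner_axis prod.reindex inj_on_def axis_eq_axis UNIV_2 algebra_simps)
  also have "(Re u - Re l) * (Im u - Im l) = (\<Prod>b\<in>Basis. (u - l) \<bullet> b)"
    by (simp add: Basis_complex_def)
  finally show "emeasure (distr lborel borel complex_of_vec) (box l u) = ennreal (\<Prod>b\<in>Basis. (u - l) \<bullet> b)" by simp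
qed simp

lemma det_matrix_complex_mult:
  "det (matrix (\<lambda>h. vec_of_complex (w * complex_of_vec h))) = (norm w)\<^sup>2"
  unfolding cmod_power2 by (simp add: det_2 matrix_def axis_def power2_eq_square)

text \<open>Multiplication by the complex derivative, as a real linear map of the plane, has
  determinant |g'|^2, which is the Jacobian.\<close>

lemma change_of_variables_complex:
  fixes g :: "complex \<Rightarrow> complex" and f :: "complex \<Rightarrow> real"
  assumes S: "S \<in> sets borel" and gS: "g ` S \<in> sets borel"
    and der: "\<And>x. x \<in> S \<Longrightarrow> (g has_field_derivative g' x) (at x)"
    and inj: "inj_on g S"
    and f: "f \<in> borel_measurable borel" "\<And>x. 0 \<le> f x"
    and h: "h \<in> borel_measurable borel" "\<And>x. 0 \<le> h x" "\<And>x. x \<in> S \<Longrightarrow> h x = (norm (g' x))\<^sup>2 * f (g x)"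
    and r: "0 \<le> r"
  shows "(\<integral>\<^sup>+x. ennreal (h x * indicator S x) \<partial>lborel) = ennreal r \<longleftrightarrow>
         (\<integral>\<^sup>+x. ennreal (f x * indicator (g ` S) x) \<partial>lborel) = ennreal r"
proof -
  define G where "G = vec_of_complex \<circ> g \<circ> complex_of_vec"
  define G' where "G' = (\<lambda>x h. vec_of_complex (g' (complex_of_vec x) * complex_of_vec h))"
  have tr: "(\<integral>\<^sup>+x. ennreal (k x * indicator X x) \<partial>lborel) = (\<integral>\<^sup>+x. ennreal (k (complex_of_vec x) * indicator (complex_of_vec -` X) x) \<partial>lborel)"
    if "k \<in> borel_measurable borel" "X \<in> sets borel" for k :: "complex \<Rightarrow> real" and X
    using that by (subst lborel_complex_eq_distr_vec, subst nn_integral_distr) (auto simp: indicator_def)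
  have im: "G ` (complex_of_vec -` S) = complex_of_vec -` (g ` S)"
  proof (rule equalityI; rule subsetI)
    fix v assume "v \<in> complex_of_vec -` (g ` S)"
    then obtain z where z: "z \<in> S" "complex_of_vec v = g z" by auto
    then have "v = G (vec_of_complex z)" by (metis G_def comp_apply complex_of_vec_inverse)
    then show "v \<in> G ` (complex_of_vec -` S)" using z(1) by auto
  qed (auto simp: G_def)
  have vS: "complex_of_vec -` S \<in> sets borel"
    using measurable_sets[OF measurable_complex_of_vec S] by simp
  have vgS: "complex_of_vec -` (g ` S) \<in> sets borel"
    using measurable_sets[OF measurable_complex_of_vec gS] by simp
  have "(\<integral>\<^sup>+x. ennreal (h (complex_of_vec x) * indicator (complex_of_vec -` S) x) \<partial>lborel) = ennreal r \<longleftrightarrow>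
    (\<integral>\<^sup>+x. ennreal (f (complex_of_vec x) * indicator (G ` (complex_of_vec -` S)) x) \<partial>lborel) = ennreal r"
  proof (rule change_of_variables_nn_integral[where g' = G'])
    show "G ` (complex_of_vec -` S) \<in> sets borel" unfolding im by (rule vgS)
    fix x assume "x \<in> complex_of_vec -` S"
    then have x: "complex_of_vec x \<in> S" by simp
    have "(g has_derivative (\<lambda>h. g' (complex_of_vec x) * h)) (at (complex_of_vec x))"
      using der[OF x] by (simp add: has_field_derivative_def)
    then have "(vec_of_complex \<circ> g \<circ> complex_of_vec has_derivative G' x) (at x)"
      unfolding o_def G'_def
      by (intro bounded_linear.has_derivative[OF bounded_linear_vec_of_complex]
          has_derivative_compose[OF bounded_linear.has_derivative[OF bounded_linear_complex_of_vec has_derivative_ident]])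
    then show "(G has_derivative G' x) (at x within complex_of_vec -` S)"
      unfolding G_def by (rule has_derivative_at_withinI)
    show "h (complex_of_vec x) = \<bar>det (matrix (G' x))\<bar> * f (complex_of_vec (G x))"
      unfolding G'_def det_matrix_complex_mult using h(3)[OF x] by (simp add: G_def)
  next
    show "inj_on G (complex_of_vec -` S)"
    proof (rule inj_onI)
      fix x y assume xy: "x \<in> complex_of_vec -` S" "y \<in> complex_of_vec -` S" "G x = G y"
      then have "g (complex_of_vec x) = g (complex_of_vec y)" by (metis G_def comp_apply complex_of_vec_inverse(1))
      then have "complex_of_vec x = complex_of_vec y" using inj xy by (auto dest: inj_onD)
      then show "x = y" by (metis complex_of_vec_inverse(2))
    qed
  qed (use f h r vS in auto)
  then show ?thesis unfolding im tr[OF h(1) S] tr[OF f(1) gS] .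
qed

section \<open>The hyperbolic measure and its behaviour under Moebius maps\<close>

lemma open_upper_half_plane: "open upper_half_plane"
  unfolding upper_half_plane_def by (simp add: open_halfspace_Im_gt)

lemma upper_half_plane_borel [measurable]: "upper_half_plane \<in> sets borel"
  using open_upper_half_plane by simp

lemma space_hyp_measure [simp]: "space hyp_measure = upper_half_plane"
  by (simp add: hyp_measure_def space_restrict_space)

lemma sets_hyp_measure: "A \<in> sets hyp_measure \<longleftrightarrow> A \<subseteq> upper_half_plane \<and> A \<in> sets lebesgue"
  unfolding hyp_measure_def sets_density by (subst sets_restrict_space_iff) auto

lemma borel_sets_hyp_measure: "A \<in> sets borel \<Longrightarrow> A \<subseteq> upper_half_plane \<Longrightarrow> A \<in> sets hyp_measure"
  by (simp add: sets_hyp_measure)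

lemma measurable_hyp_measureI: "f \<in> borel_measurable borel \<Longrightarrow> f \<in> borel_measurable hyp_measure"
  unfolding hyp_measure_def
  by (simp add: measurable_restrict_space1 measurable_completion)

lemma nn_integral_hyp_measure:
  assumes f: "f \<in> borel_measurable borel"
  shows "(\<integral>\<^sup>+z. f z \<partial>hyp_measure) = (\<integral>\<^sup>+z. ennreal (1 / (Im z)\<^sup>2) * f z * indicator upper_half_plane z \<partial>lborel)"
proof -
  have m: "(\<lambda>z. ennreal (1 / (Im z)\<^sup>2)) \<in> borel_measurable borel" by measurable
  have "(\<integral>\<^sup>+z. f z \<partial>hyp_measure) = (\<integral>\<^sup>+z. ennreal (1 / (Im z)\<^sup>2) * f z \<partial>lebesgue_on upper_half_plane)"
    unfolding hyp_measure_def using f m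
    by (intro nn_integral_density) (auto intro!: measurable_restrict_space1 measurable_completion)
  also have "\<dots> = (\<integral>\<^sup>+z. ennreal (1 / (Im z)\<^sup>2) * f z * indicator upper_half_plane z \<partial>lebesgue)"
    by (rule nn_integral_restrict_space) simp
  also have "\<dots> = (\<integral>\<^sup>+z. ennreal (1 / (Im z)\<^sup>2) * f z * indicator upper_half_plane z \<partial>lborel)"
    by (rule nn_integral_completion)
  finally show ?thesis .
qed

lemma emeasure_hyp_measure:
  assumes A: "A \<in> sets borel" "A \<subseteq> upper_half_plane"
  shows "emeasure hyp_measure A = (\<integral>\<^sup>+z. ennreal (1 / (Im z)\<^sup>2 * indicator A z) \<partial>lborel)"
proof -
  have "emeasure hyp_measure A = (\<integral>\<^sup>+z. indicator A z \<partial>hyp_measure)"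
    using A by (intro nn_integral_indicator[symmetric] borel_sets_hyp_measure)
  also have "\<dots> = (\<integral>\<^sup>+z. ennreal (1 / (Im z)\<^sup>2) * indicator A z * indicator upper_half_plane z \<partial>lborel)"
    using A by (intro nn_integral_hyp_measure) auto
  also have "\<dots> = (\<integral>\<^sup>+z. ennreal (1 / (Im z)\<^sup>2 * indicator A z) \<partial>lborel)"
    using A(2) by (intro nn_integral_cong) (auto simp: indicator_def)
  finally show ?thesis .
qed

lemma measurable_moebius_borel [measurable]: "moebius A \<in> borel_measurable borel"
  unfolding moebius_def by measurable

lemma moebius_has_field_derivative:
  fixes A :: "int^2^2"
  assumes "Im z > 0" "det A \<noteq> 0"
  shows "(moebius A has_field_derivative of_int (det A) / (of_int (A$2$1) * z + of_int (A$2$2))\<^sup>2) (at z)"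
  unfolding moebius_def using moebius_denom_nonzero[OF assms]
  by (auto intro!: derivative_eq_intros simp: det_2 power2_eq_square field_simps)

text \<open>The preimage under A is the image under the adjugate B, whose derivative is det B / j^2.
  Since Im(B z) = det B Im z / |j|^2, the Jacobian is exactly compensated by the density 1 / y^2,
  for every positive determinant.\<close>

lemma emeasure_hyp_moebius_borel:
  fixes A :: "int^2^2"
  assumes A: "det A > 0" and X: "X \<in> sets borel" "X \<subseteq> upper_half_plane"
  shows "emeasure hyp_measure (moebius A -` X \<inter> upper_half_plane) = emeasure hyp_measure X"
proof -
  define B where "B = adj2 A"
  have B: "det B > 0" "adj2 B = A" using A by (simp_all add: B_def)
  have inH: "moebius M z \<in> upper_half_plane" if "det M > 0" "z \<in> upper_half_plane" for M z
    using that Im_moebius_pos[of z M] by (simp add: upper_half_plane_def)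
  have AB: "moebius A (moebius B z) = z" if "z \<in> upper_half_plane" for z
    using moebius_adj2[of z B] that B by (simp add: upper_half_plane_def)
  have BA: "moebius B (moebius A z) = z" if "z \<in> upper_half_plane" for z
    using moebius_adj2[of z A] that A by (simp add: upper_half_plane_def B_def)
  have im: "moebius B ` X = moebius A -` X \<inter> upper_half_plane"
  proof (rule equalityI; rule subsetI)
    fix z assume "z \<in> moebius A -` X \<inter> upper_half_plane"
    then show "z \<in> moebius B ` X" using BA[of z] by (intro image_eqI[of _ _ "moebius A z"]) auto
  next
    fix z assume "z \<in> moebius B ` X"
    then obtain x where "x \<in> X" "z = moebius B x" by auto
    then show "z \<in> moebius A -` X \<inter> upper_half_plane" using AB[of x] inH[OF B(1), of x] X by auto
  qed
  have imb: "moebius B ` X \<in> sets borel"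
    unfolding im using measurable_sets[OF measurable_moebius_borel X(1), of A] by simp
  let ?f = "\<lambda>z::complex. 1 / (Im z)\<^sup>2"
  have iff: "(\<integral>\<^sup>+z. ennreal (?f z * indicator X z) \<partial>lborel) = ennreal r \<longleftrightarrow>
      (\<integral>\<^sup>+z. ennreal (?f z * indicator (moebius B ` X) z) \<partial>lborel) = ennreal r" if r: "0 \<le> r" for r
  proof (rule change_of_variables_complex[OF X(1) imb _ _ _ _ _ _ _ r])
    fix z assume "z \<in> X"
    then have z: "Im z > 0" using X by (auto simp: upper_half_plane_def)
    show "(moebius B has_field_derivative of_int (det B) / (of_int (B$2$1) * z + of_int (B$2$2))\<^sup>2) (at z)"
      using B by (intro moebius_has_field_derivative z) auto
    define j where "j = norm (of_int (B$2$1) * z + of_int (B$2$2))"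
    have j: "j > 0" using moebius_denom_nonzero[OF z, of B] B by (simp add: j_def)
    show "?f z = (norm (of_int (det B) / (of_int (B$2$1) * z + of_int (B$2$2))\<^sup>2))\<^sup>2 * ?f (moebius B z)"
      using Im_moebius[OF z, of B] B j z unfolding norm_divide norm_power j_def[symmetric]
      by (simp add: power2_eq_square)
  next
    show "inj_on (moebius B) X" using AB X by (metis inj_onI subsetD)
  qed auto
  have iff2: "emeasure hyp_measure X = ennreal r \<longleftrightarrow> emeasure hyp_measure (moebius B ` X) = ennreal r" if "0 \<le> r" for r
  proof -
    have "moebius B ` X \<subseteq> upper_half_plane" unfolding im by simp
    then show ?thesis using iff[OF that] emeasure_hyp_measure[OF X] emeasure_hyp_measure[OF imb] by simp
  qed
  \<comment> \<open>The equivalence only sees finite values; if one measure is infinite, the other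
    cannot be finite.\<close>
  have "emeasure hyp_measure X = emeasure hyp_measure (moebius B ` X)"
  proof (cases "emeasure hyp_measure X")
    case (real r)
    then show ?thesis using iff2[of r] by simp
  next
    case top
    then show ?thesis using iff2 by (cases "emeasure hyp_measure (moebius B ` X)") auto
  qed
  then show ?thesis by (simp add: im)
qed

text \<open>Sets here are Lebesgue measurable, while the change of variables needs Borel sets: every
  measurable set is a Borel set up to a part of a Borel null set.\<close>

lemma hyp_measure_set_decompose:
  assumes X: "X \<in> sets hyp_measure"
  obtains B N where "B \<in> sets borel" "N \<in> sets borel" "B \<subseteq> upper_half_plane" "N \<subseteq> upper_half_plane"
    "B \<subseteq> X" "X - B \<subseteq> N" "emeasure hyp_measure N = 0"
proof -
  have X': "X \<subseteq> upper_half_plane" "X \<in> sets lebesgue" using X by (auto simp: sets_hyp_measure)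
  from sets_completionE[OF X'(2)] obtain S N N' where SN: "X = S \<union> N" "N \<subseteq> N'" "N' \<in> null_sets lborel" "S \<in> sets lborel"
    by blast
  define M where "M = N' \<inter> upper_half_plane"
  have N': "N' \<in> sets borel" using SN(3) by auto
  have M: "M \<in> sets borel" unfolding M_def using N' by measurable
  have "emeasure hyp_measure M = (\<integral>\<^sup>+z. ennreal (1 / (Im z)\<^sup>2 * indicator M z) \<partial>lborel)"
    by (rule emeasure_hyp_measure[OF M]) (auto simp: M_def)
  also have "\<dots> = 0"
  proof (subst nn_integral_0_iff_AE)
    show "(\<lambda>z. ennreal (1 / (Im z)\<^sup>2 * indicator M z)) \<in> borel_measurable lborel" using M by measurable
    have "AE z in lborel. z \<notin> N'" using SN(3) by (rule AE_not_in)
    then show "AE z in lborel. ennreal (1 / (Im z)\<^sup>2 * indicator M z) = 0"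
      by eventually_elim (simp add: M_def)
  qed
  finally have "emeasure hyp_measure M = 0" .
  then show ?thesis using that[of S M] SN M X' by (auto simp: M_def)
qed

text \<open>Preimages of Borel sets are Borel, and invariance of the measure on Borel sets makes
  preimages of null sets null; the decomposition above combines the two.\<close>

lemma measurable_moebius_hyp:
  fixes A :: "int^2^2"
  assumes A: "det A > 0"
  shows "moebius A \<in> measurable hyp_measure hyp_measure"
proof (rule measurableI)
  fix z assume "z \<in> space hyp_measure"
  then show "moebius A z \<in> space hyp_measure" using Im_moebius_pos[of z A] A by (simp add: upper_half_plane_def)
next
  fix X assume "X \<in> sets hyp_measure"
  then obtain B N where BN: "B \<in> sets borel" "N \<in> sets borel" "B \<subseteq> upper_half_plane" "N \<subseteq> upper_half_plane"
    "B \<subseteq> X" "X - B \<subseteq> N" "emeasure hyp_measure N = 0" by (rule hyp_measure_set_decompose)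
  let ?p = "\<lambda>Y. moebius A -` Y \<inter> upper_half_plane"
  have b: "?p Y \<in> sets borel" if "Y \<in> sets borel" for Y
    using measurable_sets[OF measurable_moebius_borel that, of A] by simp
  have pN: "?p N \<in> null_sets lebesgue"
  proof -
    have "emeasure hyp_measure (?p N) = 0" using emeasure_hyp_moebius_borel[OF A BN(2,4)] BN(7) by simp
    then have "(\<integral>\<^sup>+z. ennreal (1 / (Im z)\<^sup>2 * indicator (?p N) z) \<partial>lborel) = 0"
      using emeasure_hyp_measure[OF b[OF BN(2)]] by simp
    then have "AE z in lborel. ennreal (1 / (Im z)\<^sup>2 * indicator (?p N) z) = 0"
      using b[OF BN(2)] by (subst (asm) nn_integral_0_iff_AE) auto
    then have "AE z in lborel. z \<notin> ?p N"
      by eventually_elim (auto simp: indicator_def upper_half_plane_def)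
    then have "?p N \<in> null_sets lborel"
      using b[OF BN(2)] by (subst (asm) AE_iff_null_sets[symmetric]) auto
    then show ?thesis by (rule null_sets_completionI)
  qed
  have "?p X = ?p B \<union> (?p X - ?p B)" using BN(5) by auto
  moreover have "?p X - ?p B \<in> null_sets lebesgue"
    by (rule null_sets_completion_subset[OF _ pN]) (use BN in auto)
  moreover have "?p B \<in> sets lebesgue" using b[OF BN(1)] by simp
  ultimately have "?p X \<in> sets lebesgue" by (metis null_setsD2 sets.Un)
  then show "moebius A -` X \<inter> space hyp_measure \<in> sets hyp_measure"
    by (simp add: sets_hyp_measure)
qed

lemma emeasure_hyp_moebius:
  fixes A :: "int^2^2"
  assumes A: "det A > 0" and X: "X \<in> sets hyp_measure"
  shows "emeasure hyp_measure (moebius A -` X \<inter> upper_half_plane) = emeasure hyp_measure X"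
proof -
  obtain B N where BN: "B \<in> sets borel" "N \<in> sets borel" "B \<subseteq> upper_half_plane" "N \<subseteq> upper_half_plane"
    "B \<subseteq> X" "X - B \<subseteq> N" "emeasure hyp_measure N = 0" using hyp_measure_set_decompose[OF X] by blast
  let ?p = "\<lambda>Y. moebius A -` Y \<inter> upper_half_plane"
  have h: "B \<in> sets hyp_measure" "N \<in> sets hyp_measure" using BN by (auto intro: borel_sets_hyp_measure)
  have ph: "?p Y \<in> sets hyp_measure" if "Y \<in> sets hyp_measure" for Y
    using measurable_sets[OF measurable_moebius_hyp[OF A] that] by simp
  have e: "emeasure hyp_measure Y = emeasure hyp_measure Z"
    if "Z \<in> sets hyp_measure" "Y \<in> sets hyp_measure" "M \<in> null_sets hyp_measure" "Z \<subseteq> Y" "Y - Z \<subseteq> M" for Y Z M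
  proof (rule emeasure_eq_AE)
    show "AE x in hyp_measure. (x \<in> Y) = (x \<in> Z)"
      using AE_not_in[OF that(3)] by eventually_elim (use that in auto)
  qed (use that in auto)
  have "emeasure hyp_measure (?p X) = emeasure hyp_measure (?p B)"
  proof (rule e[of _ _ "?p N"])
    show "?p N \<in> null_sets hyp_measure"
      using ph[OF h(2)] emeasure_hyp_moebius_borel[OF A BN(2,4)] BN(7) by (simp add: null_sets_def)
  qed (use ph X h BN in auto)
  also have "\<dots> = emeasure hyp_measure B" by (rule emeasure_hyp_moebius_borel[OF A BN(1,3)])
  also have "\<dots> = emeasure hyp_measure X"
    by (rule e[symmetric, of _ _ N]) (use h X BN in \<open>auto simp: null_sets_def\<close>)
  finally show ?thesis .
qed

lemma distr_hyp_moebius: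
  fixes A :: "int^2^2"
  assumes A: "det A > 0"
  shows "distr hyp_measure hyp_measure (moebius A) = hyp_measure"
  by (rule measure_eqI) (simp_all add: emeasure_distr[OF measurable_moebius_hyp[OF A]] emeasure_hyp_moebius[OF A])

lemma nn_integral_hyp_moebius:
  fixes A :: "int^2^2"
  assumes A: "det A > 0" and f: "f \<in> borel_measurable hyp_measure"
  shows "(\<integral>\<^sup>+z. f (moebius A z) \<partial>hyp_measure) = (\<integral>\<^sup>+z. f z \<partial>hyp_measure)"
  using nn_integral_distr[OF measurable_moebius_hyp[OF A], of f] f by (simp add: distr_hyp_moebius[OF A])

lemma AE_hyp_moebius:
  fixes A :: "int^2^2"
  assumes A: "det A > 0" and P: "AE z in hyp_measure. P z"
  shows "AE z in hyp_measure. P (moebius A z)"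
proof -
  have "AE z in distr hyp_measure hyp_measure (moebius A). P z" using P unfolding distr_hyp_moebius[OF A] .
  then show ?thesis by (rule AE_distrD[OF measurable_moebius_hyp[OF A]])
qed

lemma AE_hyp_not_in_negligible:
  assumes "negligible N" shows "AE z in hyp_measure. z \<notin> N"
proof -
  have "AE z in lebesgue. z \<notin> N" using assms by (simp add: negligible_iff_null_sets AE_not_in)
  then have "AE z in lebesgue_on upper_half_plane. z \<notin> N"
    by (subst AE_restrict_space_iff) auto
  then show ?thesis unfolding hyp_measure_def
    by (subst AE_density) (auto intro!: measurable_restrict_space1 measurable_completion)
qed

lemma lborel_complex_eq_distr_prod: "(lborel :: complex measure) = distr (lborel \<Otimes>\<^sub>M lborel) borel (\<lambda>(x, y). Complex x y)"
proof (rule lborel_eqI)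
  have [measurable]: "(\<lambda>(x, y). Complex x y) \<in> borel_measurable borel"
    unfolding Complex_eq case_prod_unfold
    by (intro borel_measurable_continuous_onI continuous_intros)
  fix l u :: complex assume le: "\<And>b. b \<in> Basis \<Longrightarrow> l \<bullet> b \<le> u \<bullet> b"
  then have le': "Re l \<le> Re u" "Im l \<le> Im u" using le[of 1] le[of \<i>] by (simp_all add: Basis_complex_def)
  have "(\<lambda>(x, y). Complex x y) -` box l u = box (Re l, Im l) (Re u, Im u)"
    by (auto simp: box_def Basis_complex_def Basis_prod_def)
  then have "emeasure (distr (lborel \<Otimes>\<^sub>M lborel) borel (\<lambda>(x, y). Complex x y)) (box l u) = emeasure lborel (box (Re l, Im l) (Re u, Im u))"
    unfolding lborel_prod by (subst emeasure_distr) auto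
  also have "\<dots> = ennreal ((Re u - Re l) * (Im u - Im l))"
    using le' by (subst emeasure_lborel_box) (auto simp: Basis_prod_def prod.union_disjoint)
  also have "(Re u - Re l) * (Im u - Im l) = (\<Prod>b\<in>Basis. (u - l) \<bullet> b)"
    by (simp add: Basis_complex_def)
  finally show "emeasure (distr (lborel \<Otimes>\<^sub>M lborel) borel (\<lambda>(x, y). Complex x y)) (box l u) = ennreal (\<Prod>b\<in>Basis. (u - l) \<bullet> b)" by simp
qed simp

text \<open>The reduced domain lies in the half-strip |x| <= 1/2, y >= 3/4, and against dx dy / y^2
  the integrand becomes y^(-1-\<delta>), which is integrable towards the cusp.\<close>

lemma nn_integral_reduced_finite:
  assumes d: "0 < \<delta>"
  shows "(\<integral>\<^sup>+z. ennreal (Im z powr (1 - \<delta>)) * indicator {w. reduced w} z \<partial>hyp_measure) < \<infinity>"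
proof -
  have [measurable]: "{w. reduced w} \<in> sets borel"
    unfolding reduced_def by measurable
  define F where "F = (\<lambda>y::real. - (y powr (- \<delta>)) / \<delta>)"
  have "(\<integral>\<^sup>+z. ennreal (Im z powr (1 - \<delta>)) * indicator {w. reduced w} z \<partial>hyp_measure) =
     (\<integral>\<^sup>+z. ennreal (1 / (Im z)\<^sup>2) * (ennreal (Im z powr (1 - \<delta>)) * indicator {w. reduced w} z) * indicator upper_half_plane z \<partial>lborel)"
    by (rule nn_integral_hyp_measure) measurable
  also have "\<dots> \<le> (\<integral>\<^sup>+z. indicator {-1/2..1/2} (Re z) * (ennreal (Im z powr (- \<delta> - 1)) * indicator {3/4..} (Im z)) \<partial>lborel)"
  proof (rule nn_integral_mono)
    fix z :: complex
    show "ennreal (1 / (Im z)\<^sup>2) * (ennreal (Im z powr (1 - \<delta>)) * indicator {w. reduced w} z) * indicator upper_half_plane z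
      \<le> indicator {-1/2..1/2} (Re z) * (ennreal (Im z powr (- \<delta> - 1)) * indicator {3/4..} (Im z))"
    proof (cases "reduced z")
      case True
      have y: "Im z \<ge> 3/4" using Im_reduced_ge[OF True] .
      have x: "Re z \<in> {-1/2..1/2}" using True by (auto simp: reduced_def abs_le_iff)
      have "(Im z)\<^sup>2 = Im z powr 2" using y by (simp add: powr_numeral)
      moreover have "Im z powr (1 - \<delta>) / Im z powr 2 = Im z powr (1 - \<delta> - 2)" by (rule powr_diff[symmetric])
      moreover have "1 - \<delta> - 2 = - \<delta> - 1" by simp
      ultimately have "1 / (Im z)\<^sup>2 * Im z powr (1 - \<delta>) = Im z powr (- \<delta> - 1)" by (metis divide_inverse inverse_eq_divide mult.commute)
      then have "ennreal (1 / (Im z)\<^sup>2) * ennreal (Im z powr (1 - \<delta>)) = ennreal (Im z powr (- \<delta> - 1))"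
        by (simp add: ennreal_mult[symmetric])
      then show ?thesis using True y x by (simp add: indicator_def)
    qed simp
  qed
  also have "\<dots> = (\<integral>\<^sup>+p. indicator {-1/2..1/2} (fst p) * (ennreal (snd p powr (- \<delta> - 1)) * indicator {3/4..} (snd p)) \<partial>((lborel :: real measure) \<Otimes>\<^sub>M (lborel :: real measure)))"
    by (subst lborel_complex_eq_distr_prod, subst nn_integral_distr)
       (auto simp: case_prod_unfold Complex_eq)
  also have "\<dots> = (\<integral>\<^sup>+x. (\<integral>\<^sup>+y. indicator {-1/2..1/2} x * (ennreal (y powr (- \<delta> - 1)) * indicator {3/4..} y) \<partial>(lborel :: real measure)) \<partial>(lborel :: real measure))"
    by (subst lborel.nn_integral_fst[symmetric]) auto
  also have "\<dots> = (\<integral>\<^sup>+x. indicator {-1/2..1/2::real} x \<partial>lborel) * (\<integral>\<^sup>+y. ennreal (y powr (- \<delta> - 1)) * indicator {3/4..} y \<partial>lborel)"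
    by (simp add: nn_integral_cmult nn_integral_multc)
  also have "(\<integral>\<^sup>+y. ennreal (y powr (- \<delta> - 1)) * indicator {3/4..} y \<partial>lborel) = ennreal (0 - F (3/4))"
  proof (rule nn_integral_FTC_atLeast)
    fix y :: real assume y: "3/4 \<le> y"
    show "(F has_real_derivative y powr (- \<delta> - 1)) (at y)"
      unfolding F_def using y d by (auto intro!: derivative_eq_intros simp: field_simps)
    show "0 \<le> y powr (- \<delta> - 1)" by simp
  next
    have "((\<lambda>y. y powr (- \<delta>)) \<longlongrightarrow> 0) at_top" using d by (intro tendsto_neg_powr filterlim_ident) auto
    then have "((\<lambda>y. - (y powr (- \<delta>)) / \<delta>) \<longlongrightarrow> - 0 / \<delta>) at_top" by (intro tendsto_intros) (use d in auto)
    then show "(F \<longlongrightarrow> 0) at_top" by (simp add: F_def)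
  qed measurable
  also have "(\<integral>\<^sup>+x. indicator {-1/2..1/2::real} x \<partial>lborel) * ennreal (0 - F (3/4)) < \<infinity>"
    by (simp add: ennreal_mult_less_top)
  finally show ?thesis .
qed

subsection \<open>Fundamental domains\<close>

text \<open>The interior of the standard domain: it meets each orbit at most once, but misses a null
  set of orbits.\<close>

definition strictly_reduced :: "complex \<Rightarrow> bool" where
  "strictly_reduced w \<longleftrightarrow> Im w > 0 \<and> \<bar>Re w\<bar> < 1/2 \<and> 1 < norm w"

text \<open>The same integral form c^2 - |c d| + d^2 as in the closed case; the strict inequality
  comes from |w| > 1 and needs c different from 0.\<close>

lemma norm_strictly_reduced_gt_1:
  assumes w: "strictly_reduced w" and c: "c \<noteq> 0"
  shows "1 < norm (of_int c * w + of_int d)"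
proof -
  define C D where "C = real_of_int c" and "D = real_of_int d"
  have "1\<^sup>2 < (norm w)\<^sup>2" using w unfolding strictly_reduced_def by (intro power_strict_mono) auto
  then have nw: "(Re w)\<^sup>2 + (Im w)\<^sup>2 > 1" by (simp flip: cmod_power2)
  have "(norm (of_int c * w + of_int d))\<^sup>2 = C\<^sup>2 * ((Re w)\<^sup>2 + (Im w)\<^sup>2) + 2 * (C * D) * Re w + D\<^sup>2"
    unfolding cmod_power2 by (simp add: C_def D_def power2_eq_square algebra_simps)
  moreover have "C\<^sup>2 * 1 < C\<^sup>2 * ((Re w)\<^sup>2 + (Im w)\<^sup>2)"
    using nw c by (intro mult_strict_left_mono) (auto simp: C_def)
  moreover have "- \<bar>C * D\<bar> \<le> 2 * (C * D) * Re w"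
  proof -
    have "\<bar>2 * (C * D) * Re w\<bar> = \<bar>C * D\<bar> * (2 * \<bar>Re w\<bar>)" by (simp add: abs_mult)
    also have "\<dots> \<le> \<bar>C * D\<bar> * 1" using w by (intro mult_left_mono) (auto simp: strictly_reduced_def)
    finally have "\<bar>2 * (C * D) * Re w\<bar> \<le> \<bar>C * D\<bar>" by simp
    then show ?thesis using abs_le_D2 minus_le_iff by blast
  qed
  moreover have "real_of_int 1 \<le> real_of_int (c\<^sup>2 - \<bar>c * d\<bar> + d\<^sup>2)"
  proof -
    have "4 * (X\<^sup>2 - X * Y + Y\<^sup>2) = (X - 2 * Y)\<^sup>2 + 3 * X\<^sup>2" for X Y :: int
      by (simp add: power2_eq_square algebra_simps)
    from this[of "\<bar>c\<bar>" "\<bar>d\<bar>"]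
    have "4 * (c\<^sup>2 - \<bar>c * d\<bar> + d\<^sup>2) = (\<bar>c\<bar> - 2 * \<bar>d\<bar>)\<^sup>2 + 3 * c\<^sup>2"
      by (simp only: abs_mult power2_abs)
    moreover have "0 < (\<bar>c\<bar> - 2 * \<bar>d\<bar>)\<^sup>2 + 3 * c\<^sup>2" using c by (intro add_nonneg_pos) auto
    ultimately have "0 < c\<^sup>2 - \<bar>c * d\<bar> + d\<^sup>2" by (metis zero_less_mult_pos zero_less_numeral)
    then show ?thesis by linarith
  qed
  then have "1 \<le> C\<^sup>2 - \<bar>C * D\<bar> + D\<^sup>2" by (simp add: C_def D_def abs_mult)
  ultimately have "1\<^sup>2 < (norm (of_int c * w + of_int d))\<^sup>2" by simp
  then show ?thesis by (rule power_less_imp_less_base) simp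
qed

text \<open>If the lower left entry of g were nonzero, both g and its inverse would strictly
  decrease the imaginary part. So g is a translation by an integer k, and two points of the open
  strip differ by less than 1.\<close>

lemma strictly_reduced_unique:
  fixes g :: "int^2^2"
  assumes z: "strictly_reduced z" and gz: "strictly_reduced (moebius g z)" and g: "det g = 1"
  shows "moebius g z = z"
proof -
  have Imz: "Im z > 0" using z by (simp add: strictly_reduced_def)
  have less: "Im (moebius h w) < Im w" if h: "det h = 1" and w: "strictly_reduced w" and c: "h$2$1 \<noteq> 0" for h :: "int^2^2" and w
  proof -
    have Imw: "Im w > 0" using w by (simp add: strictly_reduced_def)
    have "1 < norm (of_int (h$2$1) * w + of_int (h$2$2))" by (rule norm_strictly_reduced_gt_1[OF w c])
    then have "1\<^sup>2 < (norm (of_int (h$2$1) * w + of_int (h$2$2)))\<^sup>2" by (intro power_strict_mono) auto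
    then have "Im w / (norm (of_int (h$2$1) * w + of_int (h$2$2)))\<^sup>2 < Im w / 1"
      using Imw by (intro divide_strict_left_mono) auto
    then show ?thesis using Im_moebius[OF Imw, of h] h by simp
  qed
  have c: "g$2$1 = 0"
  proof (rule ccontr)
    assume c: "g$2$1 \<noteq> 0"
    have "Im (moebius g z) < Im z" by (rule less[OF g z c])
    moreover have "Im (moebius (adj2 g) (moebius g z)) < Im (moebius g z)"
      by (rule less[OF _ gz]) (use g c in \<open>simp, simp add: adj2_def\<close>)
    ultimately show False using moebius_adj2[OF Imz, of g] g by simp
  qed
  then have ad: "g$1$1 * g$2$2 = 1" using g by (simp add: det_2)
  then have ad': "(g$1$1 = 1 \<and> g$2$2 = 1) \<or> (g$1$1 = -1 \<and> g$2$2 = -1)" by (simp add: zmult_eq_1_iff)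
  define k where "k = g$1$1 * g$1$2"
  have eq: "moebius g z = z + of_int k"
    using ad' by (auto simp: moebius_def c k_def)
  have "\<bar>Re (moebius g z)\<bar> < 1/2" "\<bar>Re z\<bar> < 1/2" using z gz by (auto simp: strictly_reduced_def)
  then have "\<bar>Re z + real_of_int k\<bar> + \<bar>Re z\<bar> < 1/2 + 1/2" unfolding eq by (intro add_strict_mono) simp_all
  moreover have "\<bar>real_of_int k\<bar> \<le> \<bar>Re z + real_of_int k\<bar> + \<bar>Re z\<bar>" by linarith
  ultimately have "\<bar>real_of_int k\<bar> < 1" by simp
  then have "k = 0" by simp
  then show ?thesis using eq by simp
qed

text \<open>A reduced point that is not strictly reduced lies on one of two lines or the unit
  circle. These are null sets, and so are their countably many preimages under SL2Z.\<close>

lemma AE_strictly_reduced: "AE z in hyp_measure. \<exists>g. det g = (1::int) \<and> strictly_reduced (moebius g z)"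
proof -
  define N where "N = {z. 1 \<bullet> z = 1/2} \<union> {z. 1 \<bullet> z = - (1/2)} \<union> sphere (0::complex) 1"
  have N: "negligible N"
    unfolding N_def by (intro negligible_Un negligible_hyperplane negligible_sphere) auto
  have "AE z in hyp_measure. \<forall>g\<in>{g :: int^2^2. det g = 1}. moebius g z \<notin> N"
    unfolding AE_ball_countable[OF countable_mat2]
    by (auto intro!: AE_hyp_moebius AE_hyp_not_in_negligible N)
  then show ?thesis
    using AE_space
  proof eventually_elim
    case (elim z)
    then have "Im z > 0" by (simp add: upper_half_plane_def)
    then obtain g :: "int^2^2" where g: "det g = 1" "reduced (moebius g z)" using reduction by blast
    have "moebius g z \<notin> N" using elim g by auto
    then have "strictly_reduced (moebius g z)"
      using g(2) unfolding N_def strictly_reduced_def reduced_def by (auto simp: abs_if split: if_splits)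
    then show ?case using g(1) by blast
  qed
qed

definition neg_one :: "int^2^2" where "neg_one = mat2 (-1) 0 0 (-1)"

text \<open>Subtracting the fixed-point equations of two distinct points of the upper half-plane and
  taking imaginary parts forces g to be scalar. Every other g fixes at most one point, and there are
  countably many g.\<close>

lemma AE_stabilizer_trivial:
  "AE z in hyp_measure. \<forall>g. det g = (1::int) \<and> moebius g z = z \<longrightarrow> g = mat 1 \<or> g = neg_one"
proof -
  define Fix where "Fix = (\<lambda>g. {z. Im z > 0 \<and> moebius g z = z})"
  define G where "G = {g :: int^2^2. det g = 1 \<and> g \<noteq> mat 1 \<and> g \<noteq> neg_one}"
  have at_most_one: "z = w" if g: "g \<in> G" and zw: "z \<in> Fix g" "w \<in> Fix g" for g z w
  proof (rule ccontr)
    assume ne: "z \<noteq> w"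
    obtain a b c d where g': "g = mat2 a b c d" by (rule mat2_cases)
    have quadr: "of_int c * v * v + (of_int d - of_int a) * v - of_int b = 0" if "v \<in> Fix g" for v
    proof -
      have "of_int c * v + of_int d \<noteq> 0" using moebius_denom_nonzero[of v g] that g by (simp add: Fix_def g' G_def)
      moreover have "(of_int a * v + of_int b) / (of_int c * v + of_int d) = v" using that by (simp add: Fix_def moebius_def g')
      ultimately have "of_int a * v + of_int b = v * (of_int c * v + of_int d)" by (simp add: divide_eq_eq)
      then show ?thesis by (simp add: algebra_simps)
    qed
    have "(z - w) * (of_int c * (z + w) + (of_int d - of_int a)) =
      (of_int c * z * z + (of_int d - of_int a) * z - of_int b) - (of_int c * w * w + (of_int d - of_int a) * w - of_int b)"
      by (simp add: algebra_simps)
    also have "\<dots> = 0" using quadr zw by simp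
    finally have "of_int c * (z + w) + (of_int d - of_int a) = 0" using ne by simp
    then have "Im (of_int c * (z + w) + (of_int d - of_int a)) = 0" by simp
    then have "real_of_int c * (Im z + Im w) = 0" by simp
    then have c: "c = 0" using zw by (auto simp: Fix_def)
    have "Im (of_int c * z * z + (of_int d - of_int a) * z - of_int b) = 0" using quadr[OF zw(1)] by simp
    then have "(real_of_int d - real_of_int a) * Im z = 0" by (simp add: c)
    then have da: "d = a" using zw by (auto simp: Fix_def)
    have b: "b = 0" using quadr[OF zw(1)] by (simp add: c da)
    have "a * a = 1" using g by (simp add: G_def g' c da)
    then have "a = 1 \<or> a = -1" by (simp add: zmult_eq_1_iff)
    then show False using g by (auto simp: G_def g' c da b mat_1_eq_mat2 neg_one_def)
  qed
  have "countable (\<Union>g\<in>G. Fix g)"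
  proof (rule countable_UN[OF countable_mat2])
    fix g assume g: "g \<in> G"
    show "countable (Fix g)"
    proof (cases "Fix g = {}")
      case False
      then obtain z where z: "z \<in> Fix g" by blast
      then have "Fix g \<subseteq> {z}" using at_most_one[OF g] by blast
      then show ?thesis by (rule countable_subset) simp
    qed simp
  qed
  then have "negligible (\<Union>g\<in>G. Fix g)" 
    by (simp add: negligible_iff_null_sets null_sets_completionI countable_imp_null_set_lborel)
  from AE_hyp_not_in_negligible[OF this] AE_space show ?thesis
  proof eventually_elim
    case (elim z)
    show ?case
    proof (intro allI impI)
      fix g :: "int^2^2" assume g: "det g = 1 \<and> moebius g z = z"
      show "g = mat 1 \<or> g = neg_one"
      proof (rule ccontr)
        assume "\<not> (g = mat 1 \<or> g = neg_one)"
        then have "g \<in> G" using g by (simp add: G_def)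
        moreover have "z \<in> Fix g" using g elim(2) by (simp add: Fix_def upper_half_plane_def)
        ultimately show False using elim(1) by blast
      qed
    qed
  qed
qed

section \<open>Subgroups of SL2Z, their fundamental domains and unfolding\<close>

locale modular_subgroup =
  fixes \<Gamma> :: "(int^2^2) set"
  assumes subgroup: "subgroup \<Gamma> SL2Z"
begin

lemma det_eq_1: "\<gamma> \<in> \<Gamma> \<Longrightarrow> det \<gamma> = 1"
  using subgroup.subset[OF subgroup] by auto

lemma one_mem: "mat 1 \<in> \<Gamma>"
  using subgroup.one_closed[OF subgroup] by (simp add: SL2Z_simps)

lemma mult_mem: "\<gamma> \<in> \<Gamma> \<Longrightarrow> \<gamma>' \<in> \<Gamma> \<Longrightarrow> \<gamma> ** \<gamma>' \<in> \<Gamma>"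
  using subgroup.m_closed[OF subgroup] by (simp add: SL2Z_simps)

lemma adj2_mem: "\<gamma> \<in> \<Gamma> \<Longrightarrow> adj2 \<gamma> \<in> \<Gamma>"
  using subgroup.m_inv_closed[OF subgroup, of \<gamma>] inv_SL2Z[OF det_eq_1] by simp

lemma moebius_moebius: "\<gamma>' \<in> \<Gamma> \<Longrightarrow> z \<in> upper_half_plane \<Longrightarrow> moebius \<gamma> (moebius \<gamma>' z) = moebius (\<gamma> ** \<gamma>') z"
  using moebius_mult[of z \<gamma>' \<gamma>] det_eq_1 by (simp add: upper_half_plane_def)

lemma moebius_adj2_cancel: "\<gamma> \<in> \<Gamma> \<Longrightarrow> z \<in> upper_half_plane \<Longrightarrow> moebius (adj2 \<gamma>) (moebius \<gamma> z) = z"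
  using moebius_adj2[of z \<gamma>] det_eq_1 by (simp add: upper_half_plane_def)

definition coset :: "int^2^2 \<Rightarrow> (int^2^2) set" where
  "coset \<alpha> = (\<lambda>\<gamma>. \<gamma> ** \<alpha>) ` \<Gamma>"

lemma self_mem_coset: "\<alpha> \<in> coset \<alpha>"
  unfolding coset_def using one_mem by (intro image_eqI[of _ _ "mat 1"]) simp_all

lemma coset_eq:
  assumes "\<beta> \<in> coset \<alpha>" shows "coset \<beta> = coset \<alpha>"
proof -
  have sub: "coset \<beta> \<subseteq> coset \<alpha>" if "\<beta> \<in> coset \<alpha>" for \<alpha> \<beta>
    using that unfolding coset_def by (auto simp: matrix_mul_assoc intro!: image_eqI mult_mem)
  obtain \<gamma> where \<gamma>: "\<gamma> \<in> \<Gamma>" "\<beta> = \<gamma> ** \<alpha>" using assms by (auto simp: coset_def)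
  then have "\<alpha> = adj2 \<gamma> ** \<beta>" by (simp add: matrix_mul_assoc adj2_inverse det_eq_1)
  then have "\<alpha> \<in> coset \<beta>" unfolding coset_def using adj2_mem[OF \<gamma>(1)] by blast
  then show ?thesis using sub assms by blast
qed

text \<open>The translates \<open>g F\<close> of the strict fundamental domain \<open>F\<close> of \<open>SL2Z\<close> meet every orbit
  at most once; \<open>D\<close> takes from each translate the orbits not met by the earlier ones.\<close>

lemma fundamental_domain_exists: "\<exists>D. fundamental_domain \<Gamma> D"
proof -
  define G where "G = {g :: int^2^2. det g = 1}"
  have "mat 1 \<in> G" using det_eq_1[OF one_mem] by (simp add: G_def)
  then have G: "countable G" "G \<noteq> {}" using countable_mat2 by auto
  define e where "e = from_nat_into G"
  have e: "det (e i) = 1" for i using from_nat_into[OF G(2), of i] by (simp add: e_def G_def)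
  define U where "U = (\<lambda>i. {z \<in> upper_half_plane. strictly_reduced (moebius (adj2 (e i)) z)})"
  have U_borel [measurable]: "U i \<in> sets borel" for i
    unfolding U_def strictly_reduced_def by measurable
  define D where "D = (\<Union>i. U i - (\<Union>j\<in>{..<i}. \<Union>\<gamma>\<in>\<Gamma>. moebius \<gamma> -` U j))"
  have U_upper: "U i \<subseteq> upper_half_plane" for i by (auto simp: U_def)
  have vim: "moebius \<gamma> -` U j \<in> sets borel" for \<gamma> j
    using measurable_sets[OF measurable_moebius_borel U_borel] by simp
  have "(\<Union>\<gamma>\<in>\<Gamma>. moebius \<gamma> -` U j) \<in> sets borel" for j
    by (rule sets.countable_UN'[OF countable_mat2]) (use vim in auto)
  then have D_borel: "D \<in> sets borel"
    unfolding D_def by (intro sets.countable_UN sets.Diff sets.finite_UN) auto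
  \<comment> \<open>Applying the inverse of \<open>e i\<close> moves both points into the strict
    domain, where \<gamma> acts through its conjugate and uniqueness applies.\<close>
  have once: "w' = w" if w: "w \<in> U i" and w': "w' \<in> U i" "w' = moebius \<gamma> w" and \<gamma>: "\<gamma> \<in> \<Gamma>" for w w' i \<gamma>
  proof -
    have wH: "w \<in> upper_half_plane" "w' \<in> upper_half_plane" using w w' by (auto simp: U_def)
    then have Im: "Im w > 0" "Im w' > 0" by (auto simp: upper_half_plane_def)
    define h where "h = adj2 (e i)"
    have h: "det h = 1" by (simp add: h_def e)
    have "moebius (h ** \<gamma> ** adj2 h) (moebius h w) = moebius (h ** \<gamma> ** adj2 h ** h) w"
      by (rule moebius_mult[symmetric]) (use Im h in auto)
    also have "h ** \<gamma> ** adj2 h ** h = h ** \<gamma>"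
      using h by (simp add: matrix_mul_assoc[symmetric] adj2_inverse)
    also have "moebius (h ** \<gamma>) w = moebius h w'"
      unfolding w'(2) by (rule moebius_mult) (use Im det_eq_1[OF \<gamma>] in auto)
    finally have eq: "moebius (h ** \<gamma> ** adj2 h) (moebius h w) = moebius h w'" .
    have "moebius (h ** \<gamma> ** adj2 h) (moebius h w) = moebius h w"
      by (rule strictly_reduced_unique) (use w w' h det_eq_1[OF \<gamma>] in \<open>simp_all add: eq, simp_all add: U_def h_def det_mul\<close>)
    then have "moebius h w = moebius h w'" using eq by simp
    then have "moebius (adj2 h) (moebius h w) = moebius (adj2 h) (moebius h w')" by simp
    then show ?thesis using moebius_adj2[OF Im(1), of h] moebius_adj2[OF Im(2), of h] h by simp
  qed
  have "AE z in hyp_measure. \<exists>!w. w \<in> D \<and> (\<exists>\<gamma>\<in>\<Gamma>. w = moebius \<gamma> z)"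
    using AE_strictly_reduced AE_space
  proof eventually_elim
    case (elim z)
    then have zH: "z \<in> upper_half_plane" by simp
    from elim obtain g :: "int^2^2" where g: "det g = 1" "strictly_reduced (moebius g z)" by blast
    have "adj2 g \<in> G" using g by (simp add: G_def)
    then obtain i0 where "e i0 = adj2 g" using from_nat_into_surj[OF G(1)] unfolding e_def by blast
    then have "z \<in> U i0" using g zH by (simp add: U_def)
    moreover have "moebius (mat 1) z = z" by (simp add: moebius_def mat_1_eq_mat2)
    ultimately have ex: "\<exists>i. \<exists>\<gamma>\<in>\<Gamma>. moebius \<gamma> z \<in> U i" using one_mem by metis
    define i where "i = (LEAST i. \<exists>\<gamma>\<in>\<Gamma>. moebius \<gamma> z \<in> U i)"
    have "\<exists>\<gamma>\<in>\<Gamma>. moebius \<gamma> z \<in> U i" unfolding i_def by (rule LeastI_ex[OF ex])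
    then obtain \<gamma> where \<gamma>: "\<gamma> \<in> \<Gamma>" "moebius \<gamma> z \<in> U i" by blast
    have least: "\<not> (\<exists>\<gamma>\<in>\<Gamma>. moebius \<gamma> z \<in> U j)" if "j < i" for j
      using not_less_Least[of j] that unfolding i_def by blast
    show ?case
    proof (rule ex1I)
      have "moebius \<gamma>' (moebius \<gamma> z) \<notin> U j" if "j < i" "\<gamma>' \<in> \<Gamma>" for j \<gamma>'
        using least[OF that(1)] mult_mem[OF that(2) \<gamma>(1)] moebius_moebius[OF \<gamma>(1) zH] by metis
      then show "moebius \<gamma> z \<in> D \<and> (\<exists>\<gamma>'\<in>\<Gamma>. moebius \<gamma> z = moebius \<gamma>' z)"
        using \<gamma> unfolding D_def by auto
      fix w assume "w \<in> D \<and> (\<exists>\<gamma>\<in>\<Gamma>. w = moebius \<gamma> z)"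
      then obtain k \<gamma>' where k: "w \<in> U k" "\<And>j \<gamma>. j < k \<Longrightarrow> \<gamma> \<in> \<Gamma> \<Longrightarrow> moebius \<gamma> w \<notin> U j" and \<gamma>': "\<gamma>' \<in> \<Gamma>" "w = moebius \<gamma>' z"
        unfolding D_def by auto
      define \<gamma>'' where "\<gamma>'' = \<gamma> ** adj2 \<gamma>'"
      have \<gamma>'': "\<gamma>'' \<in> \<Gamma>" unfolding \<gamma>''_def using \<gamma> \<gamma>' by (intro mult_mem adj2_mem)
      have eq: "moebius \<gamma>'' w = moebius \<gamma> z"
        unfolding \<gamma>'(2) moebius_moebius[OF \<gamma>'(1) zH] \<gamma>''_def
        by (simp add: matrix_mul_assoc[symmetric] adj2_inverse det_eq_1[OF \<gamma>'(1)])
      have "\<not> i < k" using k(2)[OF _ \<gamma>''] eq \<gamma>(2) by metis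
      moreover have "\<not> k < i" using least k(1) \<gamma>' by blast
      ultimately have "k = i" by simp
      then show "w = moebius \<gamma> z" using once[OF k(1) _ _ \<gamma>''] eq \<gamma>(2) by metis
    qed
  qed
  moreover have "D \<subseteq> upper_half_plane" using U_upper by (auto simp: D_def)
  ultimately show ?thesis unfolding fundamental_domain_def using borel_sets_hyp_measure[OF D_borel] by blast
qed

text \<open>The number of elements of \<Gamma> that act trivially, 1 or 2; a sum over \<Gamma>
  counts every orbit point this many times.\<close>

definition central_order :: nat where "central_order = card (\<Gamma> \<inter> {mat 1, neg_one})"

lemma central_order_pos: "central_order > 0"
  unfolding central_order_def using one_mem by (subst card_gt_0_iff) auto

end

locale modular_domain = modular_subgroup +
  fixes D :: "complex set"
  assumes domain: "fundamental_domain \<Gamma> D"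
begin

lemma D_sets [measurable]: "D \<in> sets hyp_measure"
  using domain by (simp add: fundamental_domain_def)

text \<open>For generic z exactly one orbit point lies in D, and by triviality of stabilizers the
  \<gamma> reaching it form a coset of the trivially acting elements.\<close>

lemma AE_orbit_count:
  "AE z in hyp_measure. (\<integral>\<^sup>+\<gamma>. indicator D (moebius \<gamma> z) \<partial>count_space \<Gamma>) = of_nat central_order"
proof -
  have "AE z in hyp_measure. \<exists>!w. w \<in> D \<and> (\<exists>\<gamma>\<in>\<Gamma>. w = moebius \<gamma> z)"
    using domain by (simp add: fundamental_domain_def)
  then show ?thesis using AE_stabilizer_trivial AE_space
  proof eventually_elim
    case (elim z)
    then have zH: "z \<in> upper_half_plane" by simp
    from elim(1) obtain \<gamma>0 where \<gamma>0: "\<gamma>0 \<in> \<Gamma>" "moebius \<gamma>0 z \<in> D"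
      and uniq: "\<And>\<gamma>. \<gamma> \<in> \<Gamma> \<Longrightarrow> moebius \<gamma> z \<in> D \<Longrightarrow> moebius \<gamma> z = moebius \<gamma>0 z" by metis
    have neg: "moebius neg_one z = z" "moebius (mat 1) z = z" by (simp_all add: moebius_def mat_1_eq_mat2 neg_one_def)
    have "{\<gamma> \<in> \<Gamma>. moebius \<gamma> z \<in> D} = (\<lambda>s. \<gamma>0 ** s) ` (\<Gamma> \<inter> {mat 1, neg_one})"
    proof (rule equalityI; rule subsetI)
      fix \<gamma> assume "\<gamma> \<in> {\<gamma> \<in> \<Gamma>. moebius \<gamma> z \<in> D}"
      then have \<gamma>: "\<gamma> \<in> \<Gamma>" "moebius \<gamma> z = moebius \<gamma>0 z" using uniq by auto
      define s where "s = adj2 \<gamma>0 ** \<gamma>"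
      have s: "s \<in> \<Gamma>" unfolding s_def using \<gamma> \<gamma>0 by (intro mult_mem adj2_mem)
      have "moebius s z = z" unfolding s_def moebius_moebius[OF \<gamma>(1) zH, symmetric] \<gamma>(2) by (rule moebius_adj2_cancel[OF \<gamma>0(1) zH])
      then have "s = mat 1 \<or> s = neg_one" using elim(2) det_eq_1[OF s] by blast
      moreover have "\<gamma> = \<gamma>0 ** s" unfolding s_def by (simp add: matrix_mul_assoc adj2_inverse det_eq_1[OF \<gamma>0(1)])
      ultimately show "\<gamma> \<in> (\<lambda>s. \<gamma>0 ** s) ` (\<Gamma> \<inter> {mat 1, neg_one})" using s by blast
    next
      fix \<gamma> assume "\<gamma> \<in> (\<lambda>s. \<gamma>0 ** s) ` (\<Gamma> \<inter> {mat 1, neg_one})"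
      then obtain s where s: "s \<in> \<Gamma>" "s = mat 1 \<or> s = neg_one" "\<gamma> = \<gamma>0 ** s" by blast
      have "moebius \<gamma> z = moebius \<gamma>0 z" unfolding s(3) moebius_moebius[OF s(1) zH, symmetric] using s(2) neg by auto
      then show "\<gamma> \<in> {\<gamma> \<in> \<Gamma>. moebius \<gamma> z \<in> D}" using s \<gamma>0 by (auto intro: mult_mem)
    qed
    moreover have "inj_on (\<lambda>s. \<gamma>0 ** s) (\<Gamma> \<inter> {mat 1, neg_one})"
      using mult_left_cancel_mat2[of \<gamma>0] det_eq_1[OF \<gamma>0(1)] by (intro inj_onI) simp
    ultimately have card: "finite {\<gamma> \<in> \<Gamma>. moebius \<gamma> z \<in> D}" "card {\<gamma> \<in> \<Gamma>. moebius \<gamma> z \<in> D} = central_order"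
      by (simp_all add: card_image central_order_def)
    have "(\<integral>\<^sup>+\<gamma>. indicator D (moebius \<gamma> z) \<partial>count_space \<Gamma>) = (\<integral>\<^sup>+\<gamma>. indicator {\<gamma> \<in> \<Gamma>. moebius \<gamma> z \<in> D} \<gamma> \<partial>count_space \<Gamma>)"
      by (intro nn_integral_cong) (auto simp: indicator_def)
    also have "\<dots> = emeasure (count_space \<Gamma>) {\<gamma> \<in> \<Gamma>. moebius \<gamma> z \<in> D}"
      by (rule nn_integral_indicator) auto
    also have "\<dots> = of_nat central_order"
      using card by (subst emeasure_count_space_finite) auto
    finally show ?case .
  qed
qed

text \<open>Each matrix of X is uniquely \<gamma> times the chosen representative of its coset. For
  fixed representative f is constant along the coset, and the indicators of D add up to the orbit
  count at the transformed point; the count holds at all these countably many points at once for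
  almost every z.\<close>

lemma coset_sum:
  fixes f :: "complex \<Rightarrow> ennreal"
  assumes X: "\<And>\<alpha>. \<alpha> \<in> X \<Longrightarrow> det \<alpha> > 0" "\<And>\<gamma> \<alpha>. \<gamma> \<in> \<Gamma> \<Longrightarrow> \<alpha> \<in> X \<Longrightarrow> \<gamma> ** \<alpha> \<in> X"
    and f: "\<And>\<gamma> z. \<gamma> \<in> \<Gamma> \<Longrightarrow> z \<in> upper_half_plane \<Longrightarrow> f (moebius \<gamma> z) = f z"
  shows "AE z in hyp_measure. (\<integral>\<^sup>+\<alpha>. indicator D (moebius \<alpha> z) * f (moebius \<alpha> z) \<partial>count_space X) =
     of_nat central_order * (\<integral>\<^sup>+c. f (moebius (SOME \<alpha>. \<alpha> \<in> c) z) \<partial>count_space (coset ` X))"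
proof -
  have "AE z in hyp_measure. \<forall>\<alpha>\<in>X. (\<integral>\<^sup>+\<gamma>. indicator D (moebius \<gamma> (moebius \<alpha> z)) \<partial>count_space \<Gamma>) = of_nat central_order"
    unfolding AE_ball_countable[OF countable_mat2] using AE_hyp_moebius[OF X(1) AE_orbit_count] by blast
  then show ?thesis using AE_space
  proof eventually_elim
    case (elim z)
    then have zH: "z \<in> upper_half_plane" by simp
    define Q where "Q = coset ` X"
    define rep where "rep = (\<lambda>c :: (int^2^2) set. SOME \<alpha>. \<alpha> \<in> c)"
    have rep: "rep c \<in> c" "rep c \<in> X" "coset (rep c) = c" if c: "c \<in> Q" for c
    proof -
      from c obtain \<alpha> where \<alpha>: "\<alpha> \<in> X" "c = coset \<alpha>" unfolding Q_def by blast
      show 1: "rep c \<in> c" unfolding rep_def using someI[of "\<lambda>\<alpha>. \<alpha> \<in> c" \<alpha>] self_mem_coset[of \<alpha>] \<alpha> by simp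
      then show "rep c \<in> X" using \<alpha> X(2) by (auto simp: coset_def)
      show "coset (rep c) = c" using coset_eq 1 \<alpha> by simp
    qed
    have bij: "bij_betw (\<lambda>(c, \<gamma>). \<gamma> ** rep c) (Q \<times> \<Gamma>) X"
    proof (rule bij_betw_imageI)
      show "inj_on (\<lambda>(c, \<gamma>). \<gamma> ** rep c) (Q \<times> \<Gamma>)"
      proof (rule inj_onI, clarify)
        fix c \<gamma> c' \<gamma>' assume *: "c \<in> Q" "c' \<in> Q" "\<gamma> \<in> \<Gamma>" "\<gamma>' \<in> \<Gamma>" "\<gamma> ** rep c = \<gamma>' ** rep c'"
        have "coset (\<gamma> ** rep c) = c" "coset (\<gamma>' ** rep c') = c'"
          using * rep coset_eq by (metis coset_def image_eqI)+
        then have c: "c = c'" using * by simp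
        moreover have "\<gamma> = \<gamma>'"
          using mult_right_cancel_mat2[of "rep c" \<gamma> \<gamma>'] X(1)[OF rep(2)[OF *(1)]] *(5) c by simp
        ultimately show "c = c' \<and> \<gamma> = \<gamma>'" by simp
      qed
      show "(\<lambda>(c, \<gamma>). \<gamma> ** rep c) ` (Q \<times> \<Gamma>) = X"
      proof (rule equalityI; rule subsetI)
        fix \<alpha> assume \<alpha>: "\<alpha> \<in> X"
        have Q: "coset \<alpha> \<in> Q" using \<alpha> by (simp add: Q_def)
        have "\<alpha> \<in> coset (rep (coset \<alpha>))" using rep(3)[OF Q] self_mem_coset by simp
        then obtain \<gamma> where "\<gamma> \<in> \<Gamma>" "\<alpha> = \<gamma> ** rep (coset \<alpha>)" by (auto simp: coset_def)
        then show "\<alpha> \<in> (\<lambda>(c, \<gamma>). \<gamma> ** rep c) ` (Q \<times> \<Gamma>)" using Q by (intro image_eqI[of _ _ "(coset \<alpha>, \<gamma>)"]) auto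
      qed (use X rep in auto)
    qed
    let ?h = "\<lambda>\<alpha>. indicator D (moebius \<alpha> z) * f (moebius \<alpha> z)"
    have cQ: "countable Q" unfolding Q_def by (intro countable_image countable_mat2)
    have "(\<integral>\<^sup>+\<alpha>. ?h \<alpha> \<partial>count_space X) = (\<integral>\<^sup>+p. ?h ((\<lambda>(c, \<gamma>). \<gamma> ** rep c) p) \<partial>count_space (Q \<times> \<Gamma>))"
      by (rule nn_integral_bij_count_space[OF bij, symmetric])
    also have "\<dots> = (\<integral>\<^sup>+p. ?h (snd p ** rep (fst p)) \<partial>(count_space Q \<Otimes>\<^sub>M count_space \<Gamma>))"
      by (simp add: pair_measure_countable[OF cQ countable_mat2] case_prod_unfold)
    also have "\<dots> = (\<integral>\<^sup>+c. (\<integral>\<^sup>+\<gamma>. ?h (\<gamma> ** rep c) \<partial>count_space \<Gamma>) \<partial>count_space Q)"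
      using sigma_finite_measure.nn_integral_fst[OF sigma_finite_measure_count_space_countable[OF countable_mat2], of "\<lambda>p. ?h (snd p ** rep (fst p))" "count_space Q" \<Gamma>]
      by (simp add: pair_measure_countable[OF cQ countable_mat2])
    also have "\<dots> = (\<integral>\<^sup>+c. of_nat central_order * f (moebius (rep c) z) \<partial>count_space Q)"
    proof (rule nn_integral_cong)
      fix c assume "c \<in> space (count_space Q)"
      then have c: "c \<in> Q" by simp
      have det: "det (rep c) > 0" using X(1)[OF rep(2)[OF c]] .
      have "(\<integral>\<^sup>+\<gamma>. ?h (\<gamma> ** rep c) \<partial>count_space \<Gamma>) = (\<integral>\<^sup>+\<gamma>. indicator D (moebius \<gamma> (moebius (rep c) z)) * f (moebius (rep c) z) \<partial>count_space \<Gamma>)"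
      proof (rule nn_integral_cong)
        fix \<gamma> assume "\<gamma> \<in> space (count_space \<Gamma>)"
        then have \<gamma>: "\<gamma> \<in> \<Gamma>" by simp
        have "moebius (\<gamma> ** rep c) z = moebius \<gamma> (moebius (rep c) z)"
          using zH det by (intro moebius_mult) (auto simp: upper_half_plane_def)
        moreover have "moebius (rep c) z \<in> upper_half_plane" using Im_moebius_pos[of z "rep c"] det zH by (simp add: upper_half_plane_def)
        ultimately show "?h (\<gamma> ** rep c) = indicator D (moebius \<gamma> (moebius (rep c) z)) * f (moebius (rep c) z)"
          using f[OF \<gamma>] by simp
      qed
      also have "\<dots> = of_nat central_order * f (moebius (rep c) z)"
        using elim(1) rep(2)[OF c] by (simp add: nn_integral_multc)
      finally show "(\<integral>\<^sup>+\<gamma>. ?h (\<gamma> ** rep c) \<partial>count_space \<Gamma>) = of_nat central_order * f (moebius (rep c) z)" .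
    qed
    also have "\<dots> = of_nat central_order * (\<integral>\<^sup>+c. f (moebius (rep c) z) \<partial>count_space Q)"
      by (simp add: nn_integral_cmult)
    finally show ?case by (simp add: Q_def rep_def)
  qed
qed

text \<open>Summing over all of \<open>X\<close> instead of over cosets makes the change of variables \<open>w = \<alpha> z\<close> available
  term by term.\<close>

lemma unfold_sum:
  fixes f h :: "complex \<Rightarrow> ennreal"
  assumes X: "\<And>\<alpha>. \<alpha> \<in> X \<Longrightarrow> det \<alpha> > 0"
    and f: "f \<in> borel_measurable hyp_measure" and h: "h \<in> borel_measurable hyp_measure"
  shows "(\<integral>\<^sup>+z. f z * (\<integral>\<^sup>+\<alpha>. h (moebius \<alpha> z) \<partial>count_space X) \<partial>hyp_measure) =
     (\<integral>\<^sup>+w. h w * (\<integral>\<^sup>+\<beta>. f (moebius \<beta> w) \<partial>count_space (adj2 ` X)) \<partial>hyp_measure)"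
proof -
  note f [measurable] h [measurable]
  have m: "(\<lambda>z. k (moebius \<alpha> z)) \<in> borel_measurable hyp_measure"
    if "k \<in> borel_measurable hyp_measure" "det \<alpha> > 0" for k :: "complex \<Rightarrow> ennreal" and \<alpha> :: "int^2^2"
    using measurable_compose[OF measurable_moebius_hyp[OF that(2)] that(1)] .
  have bij: "bij_betw adj2 X (adj2 ` X)" by (rule bij_betw_imageI) (metis adj2_adj2 inj_onI, rule refl)
  have "(\<integral>\<^sup>+z. f z * (\<integral>\<^sup>+\<alpha>. h (moebius \<alpha> z) \<partial>count_space X) \<partial>hyp_measure) =
    (\<integral>\<^sup>+z. (\<integral>\<^sup>+\<alpha>. f z * h (moebius \<alpha> z) \<partial>count_space X) \<partial>hyp_measure)"
    by (simp add: nn_integral_cmult)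
  also have "\<dots> = (\<integral>\<^sup>+\<alpha>. (\<integral>\<^sup>+z. f z * h (moebius \<alpha> z) \<partial>hyp_measure) \<partial>count_space X)"
    by (rule nn_integral_count_space_nn_integral[OF countable_mat2]) (use m[OF h X] f in auto)
  also have "\<dots> = (\<integral>\<^sup>+\<alpha>. (\<integral>\<^sup>+w. f (moebius (adj2 \<alpha>) w) * h w \<partial>hyp_measure) \<partial>count_space X)"
  proof (rule nn_integral_cong)
    fix \<alpha> assume "\<alpha> \<in> space (count_space X)"
    then have a: "det \<alpha> > 0" "det (adj2 \<alpha>) > 0" using X by auto
    have "(\<integral>\<^sup>+z. f z * h (moebius \<alpha> z) \<partial>hyp_measure) = (\<integral>\<^sup>+w. f (moebius (adj2 \<alpha>) w) * h (moebius \<alpha> (moebius (adj2 \<alpha>) w)) \<partial>hyp_measure)"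
      by (rule nn_integral_hyp_moebius[OF a(2), symmetric]) (use m[OF h a(1)] f in measurable)
    also have "\<dots> = (\<integral>\<^sup>+w. f (moebius (adj2 \<alpha>) w) * h w \<partial>hyp_measure)"
      by (rule nn_integral_cong) (use moebius_adj2[of _ "adj2 \<alpha>"] a in \<open>simp add: upper_half_plane_def\<close>)
    finally show "(\<integral>\<^sup>+z. f z * h (moebius \<alpha> z) \<partial>hyp_measure) = (\<integral>\<^sup>+w. f (moebius (adj2 \<alpha>) w) * h w \<partial>hyp_measure)" .
  qed
  also have "\<dots> = (\<integral>\<^sup>+w. (\<integral>\<^sup>+\<alpha>. f (moebius (adj2 \<alpha>) w) * h w \<partial>count_space X) \<partial>hyp_measure)"
    by (rule nn_integral_count_space_nn_integral[OF countable_mat2, symmetric]) (use m[OF f] X h in auto)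
  also have "\<dots> = (\<integral>\<^sup>+w. h w * (\<integral>\<^sup>+\<alpha>. f (moebius (adj2 \<alpha>) w) \<partial>count_space X) \<partial>hyp_measure)"
    by (intro nn_integral_cong) (simp add: nn_integral_multc, simp add: mult.commute)
  also have "\<dots> = (\<integral>\<^sup>+w. h w * (\<integral>\<^sup>+\<beta>. f (moebius \<beta> w) \<partial>count_space (adj2 ` X)) \<partial>hyp_measure)"
    by (intro nn_integral_cong arg_cong2[where f = "(*)"] refl nn_integral_bij_count_space[OF bij])
  finally show ?thesis .
qed

text \<open>Every point of D has a translate in the reduced domain. Unfolding moves the integral
  there, each w being counted once for each g in SL2Z with g w in D, that is
  \<open>central_order\<close> times the index of \<Gamma>. Overlaps at the boundary of the reduced
  domain are the reason for an inequality.\<close>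

lemma nn_integral_domain_le:
  fixes f :: "complex \<Rightarrow> ennreal"
  assumes f: "f \<in> borel_measurable hyp_measure"
    and inv: "\<And>g z. det g = (1::int) \<Longrightarrow> z \<in> upper_half_plane \<Longrightarrow> f (moebius g z) = f z"
  shows "(\<integral>\<^sup>+z. f z * indicator D z \<partial>hyp_measure) \<le>
    of_nat central_order * emeasure (count_space (coset ` {g. det g = 1})) (coset ` {g. det g = 1}) * (\<integral>\<^sup>+z. f z * indicator {w. reduced w} z \<partial>hyp_measure)"
proof -
  define G where "G = {g :: int^2^2. det g = 1}"
  define J where "J = emeasure (count_space (coset ` G)) (coset ` G)"
  have red: "{w. reduced w} \<in> sets borel" unfolding reduced_def by measurable
  have red' [measurable]: "(indicator {w. reduced w} :: complex \<Rightarrow> ennreal) \<in> borel_measurable hyp_measure"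
    by (rule measurable_hyp_measureI) (use red in measurable)
  note f [measurable]
  have adjG: "adj2 ` G = G"
    by (auto simp: G_def image_iff) (metis adj2_adj2 det_adj2)
  have "(\<integral>\<^sup>+z. f z * indicator D z \<partial>hyp_measure) \<le> (\<integral>\<^sup>+z. (f z * indicator D z) * (\<integral>\<^sup>+g. indicator {w. reduced w} (moebius g z) \<partial>count_space G) \<partial>hyp_measure)"
  proof (rule nn_integral_mono)
    fix z assume "z \<in> space hyp_measure"
    then have "Im z > 0" by (simp add: upper_half_plane_def)
    then obtain g :: "int^2^2" where g: "det g = 1" "reduced (moebius g z)" using reduction by blast
    have "1 = (\<integral>\<^sup>+g'. indicator {g} g' \<partial>count_space G)"
      using g by (subst nn_integral_indicator) (auto simp: G_def emeasure_count_space_finite)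
    also have "\<dots> \<le> (\<integral>\<^sup>+g. indicator {w. reduced w} (moebius g z) \<partial>count_space G)"
      using g by (intro nn_integral_mono) (auto simp: indicator_def)
    finally show "f z * indicator D z \<le> (f z * indicator D z) * (\<integral>\<^sup>+g. indicator {w. reduced w} (moebius g z) \<partial>count_space G)"
      using mult_left_mono[of 1 _ "f z * indicator D z"] by simp
  qed
  also have "\<dots> = (\<integral>\<^sup>+w. indicator {w. reduced w} w * (\<integral>\<^sup>+g. f (moebius g w) * indicator D (moebius g w) \<partial>count_space G) \<partial>hyp_measure)"
  proof -
    have "(\<integral>\<^sup>+z. (f z * indicator D z) * (\<integral>\<^sup>+g. indicator {w. reduced w} (moebius g z) \<partial>count_space G) \<partial>hyp_measure) =
      (\<integral>\<^sup>+w. indicator {w. reduced w} w * (\<integral>\<^sup>+g. f (moebius g w) * indicator D (moebius g w) \<partial>count_space (adj2 ` G)) \<partial>hyp_measure)"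
      by (rule unfold_sum) (auto simp: G_def)
    then show ?thesis by (simp only: adjG)
  qed
  also have "\<dots> = (\<integral>\<^sup>+w. indicator {w. reduced w} w * (f w * (of_nat central_order * J)) \<partial>hyp_measure)"
  proof (rule nn_integral_cong_AE)
    have "AE w in hyp_measure. (\<integral>\<^sup>+\<alpha>. indicator D (moebius \<alpha> w) * 1 \<partial>count_space G) = of_nat central_order * (\<integral>\<^sup>+c. 1 \<partial>count_space (coset ` G))"
      by (rule coset_sum) (auto simp: G_def det_mul det_eq_1)
    then show "AE w in hyp_measure. indicator {w. reduced w} w * (\<integral>\<^sup>+g. f (moebius g w) * indicator D (moebius g w) \<partial>count_space G) = 
      indicator {w. reduced w} w * (f w * (of_nat central_order * J))"
      using AE_space
    proof eventually_elim
      case (elim w)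
      have "(\<integral>\<^sup>+g. f (moebius g w) * indicator D (moebius g w) \<partial>count_space G) = (\<integral>\<^sup>+g. f w * indicator D (moebius g w) \<partial>count_space G)"
        using elim(2) by (intro nn_integral_cong) (simp add: inv G_def)
      also have "\<dots> = f w * (of_nat central_order * J)"
        using elim(1) by (simp add: nn_integral_cmult J_def)
      finally show ?case by simp
    qed
  qed
  also have "\<dots> = (\<integral>\<^sup>+w. (of_nat central_order * J) * (f w * indicator {w. reduced w} w) \<partial>hyp_measure)"
    by (simp add: mult_ac)
  also have "\<dots> = of_nat central_order * J * (\<integral>\<^sup>+w. f w * indicator {w. reduced w} w \<partial>hyp_measure)"
    by (rule nn_integral_cmult) measurable
  finally show ?thesis by (simp add: J_def G_def)
qed

end

subsection \<open>Hecke matrices\<close>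

lemma finite_image_factor:
  assumes "finite (r ` G)" "\<And>x y. x \<in> G \<Longrightarrow> y \<in> G \<Longrightarrow> r x = r y \<Longrightarrow> f x = f y"
  shows "finite (f ` G)"
proof (rule finite_surj[OF assms(1)])
  show "f ` G \<subseteq> (\<lambda>t. f (SOME x. x \<in> G \<and> r x = t)) ` r ` G"
  proof
    fix y assume "y \<in> f ` G"
    then obtain x where x: "x \<in> G" "y = f x" by blast
    have "(SOME x'. x' \<in> G \<and> r x' = r x) \<in> G \<and> r (SOME x'. x' \<in> G \<and> r x' = r x) = r x"
      by (rule someI[of "\<lambda>x'. x' \<in> G \<and> r x' = r x" x]) (use x in simp)
    then have "y = f (SOME x'. x' \<in> G \<and> r x' = r x)" using assms(2)[OF x(1)] x(2) by metis
    then show "y \<in> (\<lambda>t. f (SOME x. x \<in> G \<and> r x = t)) ` r ` G" using x(1) by blast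
  qed
qed

locale congruence_theta = modular_domain +
  fixes N :: nat
  assumes level: "congruence_subgroup_of_level \<Gamma> N" and Gamma0_4: "\<Gamma> \<subseteq> Gamma0 4"
begin

lemma N_pos: "N \<ge> 1" and principal: "principal_congruence_subgroup N \<subseteq> \<Gamma>"
  using level by (auto simp: congruence_subgroup_of_level_def)

lemma principal_mem: "det g = 1 \<Longrightarrow> mat_cong N g (mat 1) \<Longrightarrow> g \<in> \<Gamma>"
  using principal by (auto simp: principal_congruence_subgroup_def)

text \<open>The unipotent matrix with lower left entry N lies in the principal subgroup of level N,
  hence in \<open>Gamma0 4\<close>.\<close>

lemma four_dvd_level: "4 dvd int N"
proof -
  have "mat2 1 0 (int N) 1 \<in> \<Gamma>"
    by (rule principal_mem) (simp_all add: mat_1_eq_mat2 cong_iff_dvd_diff)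
  then show ?thesis using Gamma0_4 by (auto simp: Gamma0_def)
qed

text \<open>Matrices congruent modulo N differ by an element of the principal subgroup, so the coset
  depends only on residues.\<close>

lemma finite_cosets: "finite (coset ` {g. det g = 1})"
proof (rule finite_image_factor)
  let ?r = "\<lambda>g :: int^2^2. (g$1$1 mod int N, g$1$2 mod int N, g$2$1 mod int N, g$2$2 mod int N)"
  show "finite (?r ` {g. det g = 1})"
    by (rule finite_subset[of _ "{0..<int N} \<times> {0..<int N} \<times> {0..<int N} \<times> {0..<int N}"]) (use N_pos in auto)
  fix g g' :: "int^2^2" assume g: "g \<in> {g. det g = 1}" "g' \<in> {g. det g = 1}" and r: "?r g = ?r g'"
  have "mat_cong N g g'" using r by (simp add: mat_cong_def forall_2 cong_def)
  then have "mat_cong N (g ** adj2 g') (g' ** adj2 g')" by (rule mat_cong_mult) simp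
  then have "g ** adj2 g' \<in> \<Gamma>" using g by (intro principal_mem) (simp_all add: det_mul adj2_inverse)
  moreover have "g = (g ** adj2 g') ** g'" using g by (simp add: matrix_mul_assoc[symmetric] adj2_inverse)
  ultimately have "g \<in> coset g'" unfolding coset_def by blast
  then show "coset g = coset g'" by (rule coset_eq)
qed

lemma hecke_cosets_eq: "hecke_cosets \<Gamma> N n = coset ` hecke_matrices \<Gamma> N n"
  by (simp add: hecke_cosets_def coset_def)

lemma det_hecke_matrix: "\<alpha> \<in> hecke_matrices \<Gamma> N n \<Longrightarrow> det \<alpha> = int n"
  by (simp add: hecke_matrices_def)

lemma hecke_matrices_left:
  assumes "\<gamma> \<in> \<Gamma>" "\<alpha> \<in> hecke_matrices \<Gamma> N n"
  shows "\<gamma> ** \<alpha> \<in> hecke_matrices \<Gamma> N n"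
proof -
  obtain \<gamma>1 \<gamma>2 where *: "\<gamma>1 \<in> \<Gamma>" "\<gamma>2 \<in> \<Gamma>" "mat_cong N (\<gamma>1 ** \<alpha> ** \<gamma>2) (mat2 1 0 0 (int n))"
    using assms(2) by (auto simp: hecke_matrices_def mat2_def)
  have "(\<gamma>1 ** adj2 \<gamma>) ** (\<gamma> ** \<alpha>) ** \<gamma>2 = \<gamma>1 ** ((adj2 \<gamma> ** \<gamma>) ** \<alpha>) ** \<gamma>2"
    by (simp only: matrix_mul_assoc)
  also have "\<dots> = \<gamma>1 ** \<alpha> ** \<gamma>2" using adj2_inverse(2)[OF det_eq_1[OF assms(1)]] by simp
  finally have "mat_cong N ((\<gamma>1 ** adj2 \<gamma>) ** (\<gamma> ** \<alpha>) ** \<gamma>2) (mat2 1 0 0 (int n))" using *(3) by simp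
  moreover have "det (\<gamma> ** \<alpha>) = int n" using det_hecke_matrix[OF assms(2)] det_eq_1[OF assms(1)] by (simp add: det_mul)
  ultimately show ?thesis
    using mult_mem[OF *(1) adj2_mem[OF assms(1)]] *(2) unfolding hecke_matrices_def mat2_def by blast
qed

text \<open>The adjugates of the Hecke matrices: diag(1, n) is replaced by its adjugate diag(n, 1).
  They describe the inverse Moebius maps, which the change of variables produces.\<close>

definition adjoint_matrices :: "nat \<Rightarrow> (int^2^2) set" where
  "adjoint_matrices n = {\<beta>. det \<beta> = int n \<and> (\<exists>\<gamma>\<in>\<Gamma>. \<exists>\<gamma>'\<in>\<Gamma>. mat_cong N (\<gamma> ** \<beta> ** \<gamma>') (mat2 (int n) 0 0 1))}"

lemma adj2_hecke_matrices: "adj2 ` hecke_matrices \<Gamma> N n = adjoint_matrices n"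
proof -
  have 1: "adj2 \<alpha> \<in> adjoint_matrices n" if a: "\<alpha> \<in> hecke_matrices \<Gamma> N n" for \<alpha>
  proof -
    from a obtain \<gamma>1 \<gamma>2 where *: "\<gamma>1 \<in> \<Gamma>" "\<gamma>2 \<in> \<Gamma>" "mat_cong N (\<gamma>1 ** \<alpha> ** \<gamma>2) (mat2 1 0 0 (int n))"
      by (auto simp: hecke_matrices_def mat2_def)
    have "mat_cong N (adj2 \<gamma>2 ** adj2 \<alpha> ** adj2 \<gamma>1) (mat2 (int n) 0 0 1)"
      using mat_cong_adj2[OF *(3)] by (simp add: adj2_mult matrix_mul_assoc)
    then show ?thesis using adj2_mem *(1,2) det_hecke_matrix[OF a] unfolding adjoint_matrices_def by auto
  qed
  have 2: "adj2 \<beta> \<in> hecke_matrices \<Gamma> N n" if b: "\<beta> \<in> adjoint_matrices n" for \<beta>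
  proof -
    from b obtain \<gamma>1 \<gamma>2 where *: "\<gamma>1 \<in> \<Gamma>" "\<gamma>2 \<in> \<Gamma>" "mat_cong N (\<gamma>1 ** \<beta> ** \<gamma>2) (mat2 (int n) 0 0 1)"
      by (auto simp: adjoint_matrices_def)
    have "mat_cong N (adj2 \<gamma>2 ** adj2 \<beta> ** adj2 \<gamma>1) (mat2 1 0 0 (int n))"
      using mat_cong_adj2[OF *(3)] by (simp add: adj2_mult matrix_mul_assoc)
    moreover have "det \<beta> = int n" using b by (simp add: adjoint_matrices_def)
    ultimately show ?thesis using adj2_mem *(1,2) unfolding hecke_matrices_def mat2_def by auto
  qed
  show ?thesis
  proof (rule equalityI; rule subsetI)
    fix \<beta> assume "\<beta> \<in> adjoint_matrices n"
    then show "\<beta> \<in> adj2 ` hecke_matrices \<Gamma> N n" using 2 by (intro image_eqI[of _ _ "adj2 \<beta>"]) auto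
  qed (use 1 in auto)
qed

text \<open>A matrix \<open>g \<beta>\<close> with \<open>\<beta> \<equiv> diag(n, 1)\<close> modulo \<open>N\<close> lies in \<open>adjoint_matrices n\<close> iff \<open>g\<close> lies in
  \<open>transfer n\<close>; hence every sublattice of index \<open>n\<close> arises from equally many cosets.\<close>

definition transfer :: "nat \<Rightarrow> (int^2^2) set" where
  "transfer n = {g. det g = 1 \<and> (\<exists>\<gamma>\<in>\<Gamma>. \<exists>\<gamma>'\<in>\<Gamma>. mat_cong N (\<gamma> ** (g ** mat2 (int n) 0 0 1) ** \<gamma>') (mat2 (int n) 0 0 1))}"

text \<open>Another basis of the row lattice of h, chosen congruent to diag(n, 1) modulo N.\<close>

definition hermite_rep :: "nat \<Rightarrow> int^2^2 \<Rightarrow> int^2^2" where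
  "hermite_rep n h = (SOME g. det g = 1 \<and> mat_cong N (g ** h) (mat2 (int n) 0 0 1)) ** h"

lemma hermite_rep:
  assumes h: "h \<in> hermite_forms n" and n: "coprime n N"
  obtains g where "det g = 1" "hermite_rep n h = g ** h" "mat_cong N (hermite_rep n h) (mat2 (int n) 0 0 1)"
proof -
  have "\<exists>g. det g = (1::int) \<and> mat_cong N (g ** h) (mat2 (int n) 0 0 1)"
    using hermite_lift[OF h n] by metis
  from someI_ex[OF this] show ?thesis
    by (intro that[of "SOME g. det g = 1 \<and> mat_cong N (g ** h) (mat2 (int n) 0 0 1)"]) (auto simp: hermite_rep_def)
qed

lemma det_transfer: "g \<in> transfer n \<Longrightarrow> det g = 1"
  by (simp add: transfer_def)

lemma transfer_iff:
  assumes h: "h \<in> hermite_forms n" and n: "coprime n N" and g: "det g = 1"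
  shows "g ** hermite_rep n h \<in> adjoint_matrices n \<longleftrightarrow> g \<in> transfer n"
proof -
  obtain g0 where g0: "det g0 = 1" "hermite_rep n h = g0 ** h" "mat_cong N (hermite_rep n h) (mat2 (int n) 0 0 1)"
    using hermite_rep[OF h n] by blast
  have det: "det (g ** hermite_rep n h) = int n" using g g0 det_hermite[OF h] by (simp add: det_mul)
  have c: "mat_cong N (\<gamma> ** (g ** hermite_rep n h) ** \<gamma>') (\<gamma> ** (g ** mat2 (int n) 0 0 1) ** \<gamma>')" for \<gamma> \<gamma>'
    by (intro mat_cong_mult mat_cong_refl g0)
  have "mat_cong N (\<gamma> ** (g ** hermite_rep n h) ** \<gamma>') (mat2 (int n) 0 0 1) \<longleftrightarrow> mat_cong N (\<gamma> ** (g ** mat2 (int n) 0 0 1) ** \<gamma>') (mat2 (int n) 0 0 1)" for \<gamma> \<gamma>'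
    using c[of \<gamma> \<gamma>'] mat_cong_trans mat_cong_sym by blast
  then show ?thesis using det g unfolding adjoint_matrices_def transfer_def by simp
qed

lemma transfer_left:
  assumes "\<gamma> \<in> \<Gamma>" "g \<in> transfer n" shows "\<gamma> ** g \<in> transfer n"
proof -
  obtain \<gamma>1 \<gamma>2 where *: "\<gamma>1 \<in> \<Gamma>" "\<gamma>2 \<in> \<Gamma>" "mat_cong N (\<gamma>1 ** (g ** mat2 (int n) 0 0 1) ** \<gamma>2) (mat2 (int n) 0 0 1)"
    using assms(2) by (auto simp: transfer_def)
  have "(\<gamma>1 ** adj2 \<gamma>) ** ((\<gamma> ** g) ** mat2 (int n) 0 0 1) ** \<gamma>2 = \<gamma>1 ** ((adj2 \<gamma> ** \<gamma>) ** (g ** mat2 (int n) 0 0 1)) ** \<gamma>2"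
    by (simp only: matrix_mul_assoc)
  also have "\<dots> = \<gamma>1 ** (g ** mat2 (int n) 0 0 1) ** \<gamma>2" using adj2_inverse(2)[OF det_eq_1[OF assms(1)]] by simp
  finally have "mat_cong N ((\<gamma>1 ** adj2 \<gamma>) ** ((\<gamma> ** g) ** mat2 (int n) 0 0 1) ** \<gamma>2) (mat2 (int n) 0 0 1)" using *(3) by simp
  moreover have "det (\<gamma> ** g) = 1" using assms det_eq_1 by (simp add: det_mul transfer_def)
  ultimately show ?thesis using mult_mem[OF *(1) adj2_mem[OF assms(1)]] *(2) unfolding transfer_def by blast
qed

lemma one_transfer: "mat 1 \<in> transfer n"
proof -
  have "mat_cong N (mat 1 ** (mat 1 ** mat2 (int n) 0 0 1) ** mat 1) (mat2 (int n) 0 0 1)" by simp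
  then show ?thesis unfolding transfer_def mem_Collect_eq using one_mem det_I by blast
qed

lemma finite_transfer_cosets: "finite (coset ` transfer n)"
  by (rule finite_subset[OF _ finite_cosets]) (auto simp: transfer_def)

text \<open>The number of \<Gamma>-cosets in \<open>adjoint_matrices n\<close> that share a given
  row lattice. Only its independence of the lattice matters, since it cancels in the
  average.\<close>

definition transfer_index :: "nat \<Rightarrow> nat" where "transfer_index n = card (coset ` transfer n)"

lemma transfer_index_pos: "transfer_index n > 0"
  unfolding transfer_index_def using finite_transfer_cosets one_transfer by (subst card_gt_0_iff) auto

text \<open>A matrix of determinant n factors as k h with h in Hermite form; comparing k with the
  multiplier in \<open>hermite_rep n h\<close> yields g. Uniqueness of the Hermite form and
  cancellation make the pair unique.\<close>

lemma bij_adjoint_matrices: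
  assumes n: "n > 0" "coprime n N"
  shows "bij_betw (\<lambda>(h, g). g ** hermite_rep n h) (hermite_forms n \<times> transfer n) (adjoint_matrices n)"
proof (rule bij_betw_imageI)
  have det_rep: "det (hermite_rep n h) = int n" if h: "h \<in> hermite_forms n" for h
    using hermite_rep[OF h n(2)] det_hermite[OF h] by (metis det_mul mult_1)
  show "inj_on (\<lambda>(h, g). g ** hermite_rep n h) (hermite_forms n \<times> transfer n)"
  proof (rule inj_onI, clarify)
    fix h g h' g' assume h: "h \<in> hermite_forms n" "h' \<in> hermite_forms n" and g: "g \<in> transfer n" "g' \<in> transfer n"
      and eq: "g ** hermite_rep n h = g' ** hermite_rep n h'"
    have dg: "det g = 1" "det g' = 1" using g by (auto simp: transfer_def)
    obtain k where k: "det k = 1" "hermite_rep n h = k ** h" using hermite_rep[OF h(1) n(2)] by blast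
    obtain k' where k': "det k' = 1" "hermite_rep n h' = k' ** h'" using hermite_rep[OF h(2) n(2)] by blast
    have "adj2 (g' ** k') ** ((g ** k) ** h) = adj2 (g' ** k') ** ((g' ** k') ** h')"
      using eq k k' by (simp add: matrix_mul_assoc)
    also have "\<dots> = h'" using adj2_inverse(2)[of "g' ** k'"] dg k' by (simp add: det_mul matrix_mul_assoc)
    finally have "(adj2 (g' ** k') ** (g ** k)) ** h = h'" by (simp add: matrix_mul_assoc)
    moreover have "det (adj2 (g' ** k') ** (g ** k)) = 1" using dg k k' by (simp add: det_mul)
    ultimately have hh: "h = h'" using hermite_unique[OF _ h] by blast
    then have "g = g'" using mult_right_cancel_mat2[of "hermite_rep n h" g g'] det_rep[OF h(1)] n eq by simp
    then show "h = h' \<and> g = g'" using hh by simp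
  qed
  show "(\<lambda>(h, g). g ** hermite_rep n h) ` (hermite_forms n \<times> transfer n) = adjoint_matrices n"
  proof (rule equalityI; rule subsetI)
    fix \<beta> assume "\<beta> \<in> (\<lambda>(h, g). g ** hermite_rep n h) ` (hermite_forms n \<times> transfer n)"
    then obtain h g where "h \<in> hermite_forms n" "g \<in> transfer n" "\<beta> = g ** hermite_rep n h" by auto
    then show "\<beta> \<in> adjoint_matrices n" using transfer_iff[of h n g] n by (simp add: transfer_def)
  next
    fix \<beta> assume b: "\<beta> \<in> adjoint_matrices n"
    then have "det \<beta> = int n" by (simp add: adjoint_matrices_def)
    then obtain k h where k: "det k = 1" "h \<in> hermite_forms n" "\<beta> = k ** h" using hermite_exists n(1) by blast
    obtain k' where k': "det k' = 1" "hermite_rep n h = k' ** h" using hermite_rep[OF k(2) n(2)] by blast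
    define g where "g = k ** adj2 k'"
    have g: "det g = 1" using k k' by (simp add: g_def det_mul)
    have eq: "\<beta> = g ** hermite_rep n h"
      unfolding g_def k'(2) k(3) using adj2_inverse(2)[OF k'(1)] by (metis matrix_mul_assoc matrix_mul_lid)
    then have "g \<in> transfer n" using transfer_iff[OF k(2) n(2) g] b by simp
    then show "\<beta> \<in> (\<lambda>(h, g). g ** hermite_rep n h) ` (hermite_forms n \<times> transfer n)"
      using eq k(2) by (intro image_eqI[of _ _ "(h, g)"]) auto
  qed
qed

text \<open>Up to factors from \<Gamma>, which preserve \<chi>, the matrix is congruent to diag(n,
  1) modulo 4. It sends (x, y) to (n x, y) there, and n is odd.\<close>

lemma theta_char_adjoint:
  assumes b: "\<beta> \<in> adjoint_matrices n" and n: "odd n"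
  shows "theta_char (vact v \<beta>) = theta_char v"
proof -
  from b obtain \<gamma>1 \<gamma>2 where *: "\<gamma>1 \<in> \<Gamma>" "\<gamma>2 \<in> \<Gamma>" "mat_cong N (\<gamma>1 ** \<beta> ** \<gamma>2) (mat2 (int n) 0 0 1)"
    by (auto simp: adjoint_matrices_def)
  have inv: "theta_char (vact v \<gamma>) = theta_char v" if "\<gamma> \<in> \<Gamma>" for \<gamma> v
    using that Gamma0_4 by (intro theta_char_Gamma0_4) (auto simp: Gamma0_def)
  define v' where "v' = vact v (adj2 \<gamma>1)"
  have v: "v = vact v' \<gamma>1" unfolding v'_def using adj2_inverse(2)[OF det_eq_1[OF *(1)]] by (simp flip: vact_mult)
  obtain x y where xy: "v' = (x, y)" by (cases v')
  obtain a b c d where M: "\<gamma>1 ** \<beta> ** \<gamma>2 = mat2 a b c d" by (rule mat2_cases)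
  have cong: "[a = int n] (mod 4)" "[b = 0] (mod 4)" "[c = 0] (mod 4)" "[d = 1] (mod 4)"
    using *(3) four_dvd_level unfolding M mat_cong_mat2 by (auto intro: cong_dvd_modulus)
  have "theta_char (vact v \<beta>) = theta_char (vact (vact v \<beta>) \<gamma>2)" by (rule inv[OF *(2), symmetric])
  also have "vact (vact v \<beta>) \<gamma>2 = vact v' (mat2 a b c d)"
    unfolding M[symmetric] vact_mult v[symmetric] ..
  also have "theta_char \<dots> = theta_char (x * int n, y)"
  proof -
    have "[x * a + y * c = x * int n + y * 0] (mod 4)" "[x * b + y * d = x * 0 + y * 1] (mod 4)"
      by (intro cong_add cong_mult cong_refl cong)+
    then show ?thesis unfolding xy vact_def by (simp add: theta_char_cong4)
  qed
  also have "\<dots> = theta_char v'" unfolding xy using n by (intro theta_char_scale_fst) simp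
  also have "\<dots> = theta_char v" unfolding v using inv[OF *(1)] by simp
  finally show ?thesis .
qed

lemma odd_coprime_level: "coprime n N \<Longrightarrow> odd n"
proof
  assume "coprime n N" "even n"
  moreover have "even N" using four_dvd_level by (metis dvd_trans even_numeral even_of_nat)
  ultimately show False using coprime_common_divisor[of n N 2] by simp
qed

text \<open>The value depends on the row lattice alone, so g drops out; the determinant n turns the
  parameter 1 into 1/n.\<close>

lemma theta_lattice_transfer:
  assumes h: "h \<in> hermite_forms n" and g: "g \<in> transfer n" and n: "n > 0" "coprime n N" and z: "z \<in> upper_half_plane"
  shows "theta_lattice 1 (moebius (g ** hermite_rep n h) z) = theta_sublattice (1 / real n) z (range (\<lambda>v. vact v h))"
proof -
  have dg: "det g = 1" using g by (simp add: transfer_def)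
  obtain k where k: "det k = 1" "hermite_rep n h = k ** h" using hermite_rep[OF h n(2)] by blast
  have det: "det (g ** hermite_rep n h) = int n" using dg k det_hermite[OF h] by (simp add: det_mul)
  have mem: "g ** hermite_rep n h \<in> adjoint_matrices n" using transfer_iff[OF h n(2) dg] g by simp
  have "theta_lattice 1 (moebius (g ** hermite_rep n h) z) = theta_sublattice (1 / real_of_int (det (g ** hermite_rep n h))) z (range (\<lambda>v. vact v (g ** hermite_rep n h)))"
    by (rule theta_lattice_moebius) (use z det n theta_char_adjoint[OF mem odd_coprime_level[OF n(2)]] in \<open>auto simp: upper_half_plane_def\<close>)
  also have "range (\<lambda>v. vact v (g ** hermite_rep n h)) = range (\<lambda>v. vact v h)"
    using range_vact_SL2Z[of "g ** k" h] dg k by (simp add: det_mul matrix_mul_assoc)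
  finally show ?thesis by (simp add: det)
qed

text \<open>The sum over Hecke cosets is unfolded to all Hecke matrices, the variables are changed,
  and the adjoint matrices are sorted by Hermite form. The remaining sum over
  \<open>transfer n\<close> folds back, because F does not see g. Stating this for a general F with
  that property also covers constants.\<close>

lemma hecke_adjoint:
  fixes F \<phi> :: "complex \<Rightarrow> ennreal"
  assumes n: "n > 0" "coprime n N"
    and F: "F \<in> borel_measurable hyp_measure"
    and \<phi>: "\<phi> \<in> borel_measurable hyp_measure" "\<And>\<gamma> z. \<gamma> \<in> \<Gamma> \<Longrightarrow> z \<in> upper_half_plane \<Longrightarrow> \<phi> (moebius \<gamma> z) = \<phi> z"
    and Fh: "\<And>h g z. h \<in> hermite_forms n \<Longrightarrow> g \<in> transfer n \<Longrightarrow> z \<in> upper_half_plane \<Longrightarrow> F (moebius (g ** hermite_rep n h) z) = Fh h z"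
  shows "(\<integral>\<^sup>+z. F z * indicator D z * (\<integral>\<^sup>+c. \<phi> (moebius (SOME \<alpha>. \<alpha> \<in> c) z) \<partial>count_space (hecke_cosets \<Gamma> N n)) \<partial>hyp_measure) =
     (\<integral>\<^sup>+z. \<phi> z * indicator D z * (of_nat (transfer_index n) * (\<Sum>h\<in>hermite_forms n. Fh h z)) \<partial>hyp_measure)"
    (is "?L = ?R")
proof -
  let ?S = "hecke_matrices \<Gamma> N n"
  let ?m = "of_nat central_order :: ennreal"
  note F [measurable] \<phi>(1) [measurable]
  have det_rep: "det (hermite_rep n h) = int n" if h: "h \<in> hermite_forms n" for h
    using hermite_rep[OF h n(2)] det_hermite[OF h] by (metis det_mul mult_1)
  \<comment> \<open>Folding yields a factor \<open>central_order\<close> on both sides; scaling F by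
    its reciprocal cancels it inside each integrand.\<close>
  define q where "q = ennreal (1 / real central_order)"
  define F' where "F' = (\<lambda>z. q * F z)"
  have F' [measurable]: "F' \<in> borel_measurable hyp_measure" unfolding F'_def by measurable
  have Fh': "F' (moebius (g ** hermite_rep n h) z) = q * Fh h z"
    if "h \<in> hermite_forms n" "g \<in> transfer n" "z \<in> upper_half_plane" for h g z
    using Fh[OF that] by (simp add: F'_def)
  have "(\<integral>\<^sup>+z. (F' z * indicator D z) * (\<integral>\<^sup>+\<alpha>. indicator D (moebius \<alpha> z) * \<phi> (moebius \<alpha> z) \<partial>count_space ?S) \<partial>hyp_measure) =
     (\<integral>\<^sup>+w. (indicator D w * \<phi> w) * (\<integral>\<^sup>+\<beta>. F' (moebius \<beta> w) * indicator D (moebius \<beta> w) \<partial>count_space (adj2 ` ?S)) \<partial>hyp_measure)"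
    by (rule unfold_sum) (use det_hecke_matrix n in auto)
  also have "(\<integral>\<^sup>+z. (F' z * indicator D z) * (\<integral>\<^sup>+\<alpha>. indicator D (moebius \<alpha> z) * \<phi> (moebius \<alpha> z) \<partial>count_space ?S) \<partial>hyp_measure) =
     (\<integral>\<^sup>+z. (F' z * indicator D z) * (?m * (\<integral>\<^sup>+c. \<phi> (moebius (SOME \<alpha>. \<alpha> \<in> c) z) \<partial>count_space (coset ` ?S))) \<partial>hyp_measure)"
  proof (rule nn_integral_cong_AE)
    have "AE z in hyp_measure. (\<integral>\<^sup>+\<alpha>. indicator D (moebius \<alpha> z) * \<phi> (moebius \<alpha> z) \<partial>count_space ?S) = ?m * (\<integral>\<^sup>+c. \<phi> (moebius (SOME \<alpha>. \<alpha> \<in> c) z) \<partial>count_space (coset ` ?S))"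
      by (rule coset_sum) (use det_hecke_matrix hecke_matrices_left \<phi>(2) n in auto)
    then show "AE z in hyp_measure. (F' z * indicator D z) * (\<integral>\<^sup>+\<alpha>. indicator D (moebius \<alpha> z) * \<phi> (moebius \<alpha> z) \<partial>count_space ?S) = 
      (F' z * indicator D z) * (?m * (\<integral>\<^sup>+c. \<phi> (moebius (SOME \<alpha>. \<alpha> \<in> c) z) \<partial>count_space (coset ` ?S)))"
      by eventually_elim simp
  qed
  also have "(\<integral>\<^sup>+w. (indicator D w * \<phi> w) * (\<integral>\<^sup>+\<beta>. F' (moebius \<beta> w) * indicator D (moebius \<beta> w) \<partial>count_space (adj2 ` ?S)) \<partial>hyp_measure) =
     (\<integral>\<^sup>+w. (indicator D w * \<phi> w) * (?m * (of_nat (transfer_index n) * (\<Sum>h\<in>hermite_forms n. (q * Fh h w)))) \<partial>hyp_measure)"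
  proof (rule nn_integral_cong_AE)
    \<comment> \<open>With the constant 1 in place of f, this counts the elements of
      \<open>transfer n\<close> that carry a generic point into D.\<close>
    have "AE z in hyp_measure. (\<integral>\<^sup>+g. indicator D (moebius g z) * 1 \<partial>count_space (transfer n)) = ?m * (\<integral>\<^sup>+c. 1 \<partial>count_space (coset ` transfer n))"
      by (rule coset_sum) (use transfer_left det_transfer in auto)
    then have count: "AE z in hyp_measure. (\<integral>\<^sup>+g. indicator D (moebius g z) \<partial>count_space (transfer n)) = ?m * of_nat (transfer_index n)"
      using finite_transfer_cosets[of n] by (simp add: emeasure_count_space_finite transfer_index_def)
    have "AE z in hyp_measure. \<forall>h\<in>hermite_forms n. (\<integral>\<^sup>+g. indicator D (moebius g (moebius (hermite_rep n h) z)) \<partial>count_space (transfer n)) = ?m * of_nat (transfer_index n)"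
      unfolding AE_ball_countable[OF countable_mat2] using det_rep n by (intro ballI AE_hyp_moebius[OF _ count]) simp
    then show "AE w in hyp_measure. (indicator D w * \<phi> w) * (\<integral>\<^sup>+\<beta>. F' (moebius \<beta> w) * indicator D (moebius \<beta> w) \<partial>count_space (adj2 ` ?S)) =
      (indicator D w * \<phi> w) * (?m * (of_nat (transfer_index n) * (\<Sum>h\<in>hermite_forms n. (q * Fh h w))))"
      using AE_space
    proof eventually_elim
      case (elim w)
      then have wH: "w \<in> upper_half_plane" by simp
      let ?k = "\<lambda>\<beta>. F' (moebius \<beta> w) * indicator D (moebius \<beta> w)"
      have "(\<integral>\<^sup>+\<beta>. ?k \<beta> \<partial>count_space (adj2 ` ?S)) = (\<integral>\<^sup>+p. ?k ((\<lambda>(h, g). g ** hermite_rep n h) p) \<partial>count_space (hermite_forms n \<times> transfer n))"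
        unfolding adj2_hecke_matrices by (rule nn_integral_bij_count_space[OF bij_adjoint_matrices[OF n], symmetric])
      also have "\<dots> = (\<integral>\<^sup>+p. ?k (snd p ** hermite_rep n (fst p)) \<partial>(count_space (hermite_forms n) \<Otimes>\<^sub>M count_space (transfer n)))"
        by (simp add: pair_measure_countable[OF countable_mat2 countable_mat2] case_prod_unfold)
      also have "\<dots> = (\<integral>\<^sup>+h. (\<integral>\<^sup>+g. ?k (g ** hermite_rep n h) \<partial>count_space (transfer n)) \<partial>count_space (hermite_forms n))"
        using sigma_finite_measure.nn_integral_fst[OF sigma_finite_measure_count_space_countable[OF countable_mat2], of "\<lambda>p. ?k (snd p ** hermite_rep n (fst p))" "count_space (hermite_forms n)" "transfer n"]
        by (simp add: pair_measure_countable[OF countable_mat2 countable_mat2])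
      also have "\<dots> = (\<integral>\<^sup>+h. (q * Fh h w) * (?m * of_nat (transfer_index n)) \<partial>count_space (hermite_forms n))"
      proof (rule nn_integral_cong)
        fix h assume "h \<in> space (count_space (hermite_forms n))"
        then have h: "h \<in> hermite_forms n" by simp
        have "(\<integral>\<^sup>+g. ?k (g ** hermite_rep n h) \<partial>count_space (transfer n)) = (\<integral>\<^sup>+g. (q * Fh h w) * indicator D (moebius g (moebius (hermite_rep n h) w)) \<partial>count_space (transfer n))"
        proof (rule nn_integral_cong)
          fix g assume "g \<in> space (count_space (transfer n))"
          then have g: "g \<in> transfer n" by simp
          have "moebius (g ** hermite_rep n h) w = moebius g (moebius (hermite_rep n h) w)"
            using wH det_rep[OF h] n by (intro moebius_mult) (auto simp: upper_half_plane_def)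
          then show "?k (g ** hermite_rep n h) = (q * Fh h w) * indicator D (moebius g (moebius (hermite_rep n h) w))"
            using Fh'[OF h g wH] by simp
        qed
        also have "\<dots> = (q * Fh h w) * (?m * of_nat (transfer_index n))"
          using elim(1) h by (simp add: nn_integral_cmult)
        finally show "(\<integral>\<^sup>+g. ?k (g ** hermite_rep n h) \<partial>count_space (transfer n)) = (q * Fh h w) * (?m * of_nat (transfer_index n))" .
      qed
      also have "\<dots> = ?m * (of_nat (transfer_index n) * (\<Sum>h\<in>hermite_forms n. (q * Fh h w)))"
        by (simp add: nn_integral_count_space_finite[OF finite_hermite] sum_distrib_left mult_ac)
      finally show ?case by simp
    qed
  qed
  finally have eq: "(\<integral>\<^sup>+z. (F' z * indicator D z) * (?m * (\<integral>\<^sup>+c. \<phi> (moebius (SOME \<alpha>. \<alpha> \<in> c) z) \<partial>count_space (coset ` ?S))) \<partial>hyp_measure) =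
    (\<integral>\<^sup>+w. (indicator D w * \<phi> w) * (?m * (of_nat (transfer_index n) * (\<Sum>h\<in>hermite_forms n. (q * Fh h w)))) \<partial>hyp_measure)" .
  have qm: "q * ?m = 1"
    using central_order_pos by (simp add: q_def ennreal_of_nat_eq_real_of_nat ennreal_mult[symmetric])
  have 1: "q * x * y * (?m * t) = x * y * t" for x y t
    using qm by (metis (no_types, lifting) mult.assoc mult.commute mult_1)
  have 2: "x * y * (?m * (t * (q * u))) = y * x * (t * u)" for x y t u
    using qm by (metis (no_types, lifting) mult.assoc mult.commute mult_1)
  show ?thesis
    using eq unfolding F'_def sum_distrib_left[symmetric] 1 2 hecke_cosets_eq .
qed

text \<open>The adjoint identity for the constants 1 and 1 equates the number of cosets times the
  volume of D with \<open>transfer_index n\<close> times the number of Hermite forms times that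
  volume. Division by the positive finite volume gives finiteness and the count together.\<close>

lemma card_hecke_cosets:
  assumes n: "n > 0" "coprime n N" and D: "0 < emeasure hyp_measure D" "emeasure hyp_measure D < \<infinity>"
  shows "finite (hecke_cosets \<Gamma> N n)" "card (hecke_cosets \<Gamma> N n) = transfer_index n * (\<Sum>e\<in>{e. e dvd n}. e)"
proof -
  let ?Q = "hecke_cosets \<Gamma> N n"
  have "(\<integral>\<^sup>+z. 1 * indicator D z * (\<integral>\<^sup>+c. 1 \<partial>count_space ?Q) \<partial>hyp_measure) =
     (\<integral>\<^sup>+z. 1 * indicator D z * (of_nat (transfer_index n) * (\<Sum>h\<in>hermite_forms n. 1)) \<partial>hyp_measure)"
    by (rule hecke_adjoint[OF n]) auto
  then have eq: "emeasure (count_space ?Q) ?Q * emeasure hyp_measure D = of_nat (transfer_index n * card (hermite_forms n)) * emeasure hyp_measure D"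
    by (simp add: nn_integral_multc mult.commute)
  have e: "emeasure (count_space ?Q) ?Q = of_nat (transfer_index n * card (hermite_forms n))"
  proof -
    have "emeasure hyp_measure D * emeasure (count_space ?Q) ?Q = emeasure hyp_measure D * of_nat (transfer_index n * card (hermite_forms n))"
      using eq by (simp add: mult.commute)
    then show ?thesis using D by (subst (asm) ennreal_mult_cancel_left) auto
  qed
  show fin: "finite ?Q"
  proof (rule ccontr)
    assume "infinite ?Q"
    then have "emeasure (count_space ?Q) ?Q = \<infinity>" by (simp add: emeasure_count_space_infinite)
    then show False using e by (simp add: of_nat_mult[symmetric] del: of_nat_mult)
  qed
  have "of_nat (card ?Q) = (of_nat (transfer_index n * card (hermite_forms n)) :: ennreal)"
    using e fin by (simp add: emeasure_count_space_finite)
  then have "card ?Q = transfer_index n * card (hermite_forms n)" by (simp only: of_nat_eq_iff)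
  then show "card ?Q = transfer_index n * (\<Sum>e\<in>{e. e dvd n}. e)" using card_hermite[OF n(1)] by simp
qed

end

subsection \<open>Integrals over the quotient\<close>

lemma Im_moebius_le_ht:
  fixes g :: "int^2^2"
  assumes z: "Im z > 0" and g: "det g = 1"
  shows "Im (moebius g z) \<le> ht z"
proof -
  obtain k :: "int^2^2" where k: "det k = 1" "reduced (moebius k z)" using reduction[OF z] by blast
  have "moebius (g ** adj2 k) (moebius k z) = moebius (g ** adj2 k ** k) z"
    by (rule moebius_mult[symmetric]) (use z k in auto)
  also have "g ** adj2 k ** k = g" using k by (simp add: matrix_mul_assoc[symmetric] adj2_inverse)
  finally have "Im (moebius g z) \<le> Im (moebius k z)"
    using Im_moebius_reduced_le[OF k(2), of "g ** adj2 k"] g k by (simp add: det_mul)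
  also have "\<dots> = ht z" using ht_reduced[OF k(2)] ht_moebius[OF z k(1)] by simp
  finally show ?thesis .
qed

lemma measurable_ht [measurable]: "ht \<in> borel_measurable hyp_measure"
proof (rule borel_measurableI_greater)
  fix y
  have "{z \<in> space hyp_measure. y < ht z} = (\<Union>g\<in>{g :: int^2^2. det g = 1}. {z \<in> upper_half_plane. y < Im (moebius g z)})"
  proof (rule equalityI; rule subsetI)
    fix z assume z: "z \<in> {z \<in> space hyp_measure. y < ht z}"
    then have "Im z > 0" by (simp add: upper_half_plane_def)
    then obtain k :: "int^2^2" where k: "det k = 1" "reduced (moebius k z)" using reduction by blast
    then have "ht z = Im (moebius k z)" using ht_reduced[OF k(2)] ht_moebius[OF \<open>Im z > 0\<close> k(1)] by simp
    then show "z \<in> (\<Union>g\<in>{g :: int^2^2. det g = 1}. {z \<in> upper_half_plane. y < Im (moebius g z)})" using z k by auto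
  next
    fix z assume "z \<in> (\<Union>g\<in>{g :: int^2^2. det g = 1}. {z \<in> upper_half_plane. y < Im (moebius g z)})"
    then obtain g :: "int^2^2" where g: "det g = 1" "z \<in> upper_half_plane" "y < Im (moebius g z)" by auto
    then show "z \<in> {z \<in> space hyp_measure. y < ht z}" using Im_moebius_le_ht[of z g] by (auto simp: upper_half_plane_def)
  qed
  also have "\<dots> \<in> sets hyp_measure"
  proof (rule sets.countable_UN'[OF countable_mat2])
    have "{z \<in> upper_half_plane. y < Im (moebius g z)} \<in> sets borel" for g by measurable
    then show "(\<lambda>g. {z \<in> upper_half_plane. y < Im (moebius g z)}) ` {g. det g = 1} \<subseteq> sets hyp_measure"
      by (auto intro!: borel_sets_hyp_measure)
  qed
  finally show "{z \<in> space hyp_measure. y < ht z} \<in> sets hyp_measure" .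
qed

text \<open>Through |\<theta>|^2 the lattice sum becomes a power of Im z times a series over the
  naturals of continuous functions.\<close>

lemma measurable_theta_lattice [measurable]: "theta_lattice 1 \<in> borel_measurable hyp_measure"
proof -
  define a where "a = (\<lambda>n z. exp (2 * of_real pi * \<i> * (of_int (int_decode n))\<^sup>2 * z))"
  define \<theta> where "\<theta> = (\<lambda>z. (norm (complex_of_real (Im z powr (1/4)) * (\<Sum>n. a n z)))\<^sup>2)"
  have [measurable]: "a n \<in> borel_measurable borel" for n
    unfolding a_def by (intro borel_measurable_continuous_onI continuous_intros)
  have m: "\<theta> \<in> borel_measurable hyp_measure"
    by (rule measurable_hyp_measureI) (unfold \<theta>_def, measurable)
  have "theta_lattice 1 z = \<theta> z" if z: "z \<in> space hyp_measure" for z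
  proof -
    have Im: "Im z > 0" using z by (simp add: upper_half_plane_def)
    have na: "norm (a n z) = exp (- ((2 * pi * Im z) * (real_of_int (int_decode n))\<^sup>2))" for n
    proof -
      have "Re (2 * of_real pi * \<i> * (of_int (int_decode n))\<^sup>2 * z) = - ((2 * pi * Im z) * (real_of_int (int_decode n))\<^sup>2)"
        by (simp add: power2_eq_square mult_ac)
      then show ?thesis unfolding a_def norm_exp_eq_Re by simp
    qed
    have "(\<lambda>k::int. exp (- ((2 * pi * Im z) * (real_of_int k)\<^sup>2))) summable_on UNIV"
      using Im by (intro summable_on_int_gauss') simp
    then have "(\<lambda>n. norm (a n z)) summable_on UNIV"
      unfolding na using summable_on_reindex_bij_betw[OF bij_int_decode, of "\<lambda>k. exp (- ((2 * pi * Im z) * (real_of_int k)\<^sup>2))"] by simp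
    then have *: "summable (\<lambda>n. norm (a n z))" by (simp add: summable_on_UNIV_nonneg_real_iff)
    have "(\<Sum>\<^sub>\<infinity>m::int. exp (2 * of_real pi * \<i> * (of_int m)\<^sup>2 * z)) = (\<Sum>\<^sub>\<infinity>n. a n z)"
      unfolding a_def using infsum_reindex_bij_betw[OF bij_int_decode, of "\<lambda>m. exp (2 * of_real pi * \<i> * (of_int m)\<^sup>2 * z)"] by simp
    also have "\<dots> = (\<Sum>n. a n z)"
      using * by (intro infsumI norm_summable_imp_has_sum) (auto intro: summable_norm_cancel)
    finally show ?thesis
      using norm_jacobi_theta_squared[OF Im] by (simp add: \<theta>_def jacobi_theta_def)
  qed
  then show ?thesis using m by (subst measurable_cong) auto
qed

lemma theta_lattice_nonneg: "Im z > 0 \<Longrightarrow> theta_lattice 1 z \<ge> 0"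
  using norm_jacobi_theta_squared by (metis zero_le_power2)

context congruence_theta
begin

text \<open>The real-valued twin of \<open>hecke\<close>, for which positive and negative parts make
  sense.\<close>

definition hecke_real :: "nat \<Rightarrow> (complex \<Rightarrow> real) \<Rightarrow> complex \<Rightarrow> real" where
  "hecke_real n f z = (\<Sum>c\<in>hecke_cosets \<Gamma> N n. f (moebius (SOME \<alpha>. \<alpha> \<in> c) z)) / real (card (hecke_cosets \<Gamma> N n))"

lemma det_coset_rep:
  assumes "c \<in> hecke_cosets \<Gamma> N n"
  shows "det (SOME \<alpha>. \<alpha> \<in> c) = int n"
proof -
  obtain \<alpha> where \<alpha>: "\<alpha> \<in> hecke_matrices \<Gamma> N n" "c = coset \<alpha>" using assms by (auto simp: hecke_cosets_eq)
  have "(SOME \<alpha>. \<alpha> \<in> c) \<in> c" unfolding \<alpha>(2) by (rule someI[of "\<lambda>x. x \<in> coset \<alpha>", OF self_mem_coset])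
  then show ?thesis using \<alpha> hecke_matrices_left det_hecke_matrix by (auto simp: coset_def)
qed

lemma nn_integral_ht_powr_finite:
  assumes d: "\<delta> > 0"
  shows "(\<integral>\<^sup>+z. ennreal (ht z powr (1 - \<delta>)) * indicator D z \<partial>hyp_measure) < \<infinity>"
proof -
  have "(\<integral>\<^sup>+z. ennreal (ht z powr (1 - \<delta>)) * indicator D z \<partial>hyp_measure) \<le>
    of_nat central_order * emeasure (count_space (coset ` {g. det g = 1})) (coset ` {g. det g = 1}) * (\<integral>\<^sup>+z. ennreal (ht z powr (1 - \<delta>)) * indicator {w. reduced w} z \<partial>hyp_measure)"
    by (rule nn_integral_domain_le) (auto simp: ht_moebius upper_half_plane_def)
  also have "(\<integral>\<^sup>+z. ennreal (ht z powr (1 - \<delta>)) * indicator {w. reduced w} z \<partial>hyp_measure) = (\<integral>\<^sup>+z. ennreal (Im z powr (1 - \<delta>)) * indicator {w. reduced w} z \<partial>hyp_measure)"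
    by (intro nn_integral_cong) (auto simp: indicator_def ht_reduced)
  also have "of_nat central_order * emeasure (count_space (coset ` {g. det g = 1})) (coset ` {g. det g = 1}) * \<dots> < \<infinity>"
    using nn_integral_reduced_finite[OF d] finite_cosets
    by (simp add: emeasure_count_space_finite ennreal_mult_less_top of_nat_less_top)
  finally show ?thesis .
qed

definition ht_integral :: "real \<Rightarrow> real" where
  "ht_integral \<delta> = (\<integral>z. ht z powr (1 - \<delta>) * indicator D z \<partial>hyp_measure)"

lemma integrable_ht_powr:
  assumes "\<delta> > 0"
  shows "integrable hyp_measure (\<lambda>z. ht z powr (1 - \<delta>) * indicator D z)"
proof (rule integrableI_nonneg)
  show "(\<integral>\<^sup>+z. ennreal (ht z powr (1 - \<delta>) * indicator D z) \<partial>hyp_measure) < \<infinity>"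
    using nn_integral_ht_powr_finite[OF assms] by (simp add: ennreal_mult' ennreal_indicator)
qed auto

text \<open>\<open>measure\<close> is 0 on sets of infinite measure, so its positivity excludes both
  extremes.\<close>

lemma emeasure_domain:
  assumes "measure hyp_measure D > 0"
  shows "0 < emeasure hyp_measure D" "emeasure hyp_measure D < \<infinity>"
  using assms by (auto simp: measure_def enn2real_positive_iff)

text \<open>Nonnegativity makes the adjoint identity applicable without integrability. On the
  adjoint side |\<theta>|^2 has become a function within \<epsilon> sqrt(ht) of 1, and \<phi>
  sqrt(ht) is at most B ht^(1-\<delta>), which is integrable; integrability of the original
  integrand then follows from equality of the integrals.\<close>

lemma integral_theta_hecke_nonneg:
  fixes \<phi> :: "complex \<Rightarrow> real"
  assumes n: "n > 0" "coprime n N" and V: "measure hyp_measure D > 0"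
    and \<delta>: "0 < \<delta>" "\<delta> \<le> 1/2"
    and meas [measurable]: "\<phi> \<in> borel_measurable hyp_measure"
    and inv_all: "\<forall>\<gamma>\<in>\<Gamma>. \<forall>z\<in>upper_half_plane. \<phi> (moebius \<gamma> z) = \<phi> z"
    and nonneg_all: "\<forall>z\<in>upper_half_plane. 0 \<le> \<phi> z"
    and bound_all: "\<forall>z\<in>upper_half_plane. \<phi> z \<le> B * ht z powr (1/2 - \<delta>)"
  defines "\<epsilon> \<equiv> (theta_const + 1) * real (card {e. e dvd n}) * real n powr (-1/2)"
  shows "integrable hyp_measure (\<lambda>z. theta_lattice 1 z * hecke_real n \<phi> z * indicator D z)" (is ?A)
    and "integrable hyp_measure (\<lambda>z. \<phi> z * indicator D z)" (is ?B)
    and "\<bar>(\<integral>z. theta_lattice 1 z * hecke_real n \<phi> z * indicator D z \<partial>hyp_measure) - (\<integral>z. \<phi> z * indicator D z \<partial>hyp_measure)\<bar>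
      \<le> \<epsilon> * (B * ht_integral \<delta>)" (is ?C)
proof -
  note inv = inv_all[rule_format] and nonneg = nonneg_all[rule_format] and bound = bound_all[rule_format]
  let ?H = upper_half_plane and ?M = hyp_measure and ?Q = "hecke_cosets \<Gamma> N n"
  note emD = emeasure_domain[OF V]
  note finQ = card_hecke_cosets(1)[OF n emD] and cardQ = card_hecke_cosets(2)[OF n emD]
  define \<sigma> where "\<sigma> = real (\<Sum>e\<in>{e. e dvd n}. e)"
  have \<sigma>: "\<sigma> > 0"
  proof -
    have "n \<le> (\<Sum>e\<in>{e. e dvd n}. e)" using n by (intro member_le_sum) auto
    then have "0 < (\<Sum>e\<in>{e. e dvd n}. e)" using n by linarith
    then show ?thesis unfolding \<sigma>_def by (simp only: of_nat_0_less_iff)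
  qed
  define \<kappa> where "\<kappa> = real (transfer_index n)"
  have \<kappa>: "\<kappa> > 0" using transfer_index_pos by (simp add: \<kappa>_def)
  have cQ: "real (card ?Q) = \<kappa> * \<sigma>" by (simp add: cardQ \<kappa>_def \<sigma>_def)
  have eps0: "\<epsilon> \<ge> 0" using theta_const_nonneg by (simp add: \<epsilon>_def)
  \<comment> \<open>Divided by \<sigma>, this is the adjoint Hecke average of |\<theta>|^2. Taking
    the representatives with g = 1 suffices, since the value does not depend on g.\<close>
  define S where "S = (\<lambda>z. \<Sum>h\<in>hermite_forms n. theta_lattice 1 (moebius (hermite_rep n h) z))"
  have det_rep: "det (hermite_rep n h) = int n" if h: "h \<in> hermite_forms n" for h
    using hermite_rep[OF h n(2)] det_hermite[OF h] by (metis det_mul mult_1)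
  have S_meas [measurable]: "S \<in> borel_measurable ?M"
    unfolding S_def
  proof (rule borel_measurable_sum)
    fix h assume "h \<in> hermite_forms n"
    then have "det (hermite_rep n h) > 0" using det_rep n by simp
    from measurable_compose[OF measurable_moebius_hyp[OF this] measurable_theta_lattice]
    show "(\<lambda>z. theta_lattice 1 (moebius (hermite_rep n h) z)) \<in> borel_measurable ?M" .
  qed
  have moeb: "moebius A z \<in> ?H" if "det A = int n" "z \<in> ?H" for A z
    using Im_moebius_pos[of z A] that n by (simp add: upper_half_plane_def)
  have th0: "0 \<le> theta_lattice 1 z" if "z \<in> ?H" for z
    using theta_lattice_nonneg that by (simp add: upper_half_plane_def)
  have S0: "0 \<le> S z" if "z \<in> ?H" for z
    unfolding S_def using det_rep moeb that th0 by (intro sum_nonneg) blast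
  have S_eq: "S z = (\<Sum>e\<in>{e. e dvd n}. real e * theta_lattice ((real e)\<^sup>2 / real n) z)" if z: "z \<in> ?H" for z
  proof -
    have "S z = (\<Sum>h\<in>hermite_forms n. theta_sublattice (1 / real n) z (range (\<lambda>v. vact v h)))"
      unfolding S_def using theta_lattice_transfer[OF _ one_transfer n z] by (intro sum.cong) auto
    then show ?thesis using sum_theta_sublattice_hermite[of z n] z n odd_coprime_level by (simp add: upper_half_plane_def)
  qed
  have S_approx: "\<bar>S z / \<sigma> - 1\<bar> \<le> \<epsilon> * sqrt (ht z)" if z: "z \<in> ?H" for z
    using hecke_theta_approx[of z n] z n unfolding S_eq[OF z] \<epsilon>_def \<sigma>_def by (simp add: upper_half_plane_def)
  have ht_pos: "ht z \<ge> 3/4" if "z \<in> ?H" for z using ht_ge that by (simp add: upper_half_plane_def)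
  have B0: "B * ht z powr (1/2 - \<delta>) \<ge> 0" if "z \<in> ?H" for z using nonneg[OF that] bound[OF that] by linarith
  have half: "ht z powr (1/2 - \<delta>) * sqrt (ht z) = ht z powr (1 - \<delta>)" if "z \<in> ?H" for z
  proof -
    have "sqrt (ht z) = ht z powr (1/2)" using ht_pos[OF that] by (simp add: powr_half_sqrt)
    then show ?thesis by (simp add: powr_add[symmetric])
  qed
  have phi1: "\<phi> z * sqrt (ht z) \<le> B * ht z powr (1 - \<delta>)" if z: "z \<in> ?H" for z
  proof -
    have "\<phi> z * sqrt (ht z) \<le> (B * ht z powr (1/2 - \<delta>)) * sqrt (ht z)"
      using ht_pos[OF z] by (intro mult_right_mono bound[OF z]) auto
    then show ?thesis using half[OF z] by (simp add: mult.assoc)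
  qed
  \<comment> \<open>The 2 compensates for sqrt(ht z) possibly being as small as 1/2.\<close>
  have phi2: "\<phi> z \<le> 2 * B * ht z powr (1 - \<delta>)" if z: "z \<in> ?H" for z
  proof -
    have "(1/2)\<^sup>2 \<le> ht z" using ht_pos[OF z] by (simp add: power2_eq_square)
    then have "1/2 \<le> sqrt (ht z)" by (rule real_le_rsqrt)
    then have "\<phi> z * 1 \<le> \<phi> z * (2 * sqrt (ht z))" using nonneg[OF z] by (intro mult_left_mono) auto
    then show ?thesis using phi1[OF z] by simp
  qed
  note intH = integrable_ht_powr[OF \<delta>(1)]
  have D_H: "z \<in> ?H" if "z \<in> D" for z using sets.sets_into_space[OF D_sets] that by auto
  show B: ?B
  proof (rule Bochner_Integration.integrable_bound)
    show "integrable ?M (\<lambda>z. 2 * B * (ht z powr (1 - \<delta>) * indicator D z))" using intH by (rule integrable_mult_right)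
    show "AE z in ?M. norm (\<phi> z * indicator D z) \<le> norm (2 * B * (ht z powr (1 - \<delta>) * indicator D z))"
    proof (rule AE_I2)
      fix z assume "z \<in> space ?M"
      then have z: "z \<in> ?H" by simp
      have "\<bar>\<phi> z\<bar> \<le> \<bar>2 * B * ht z powr (1 - \<delta>)\<bar>" using phi2[OF z] nonneg[OF z] by linarith
      then show "norm (\<phi> z * indicator D z) \<le> norm (2 * B * (ht z powr (1 - \<delta>) * indicator D z))"
        by (simp add: indicator_def)
    qed
  qed measurable
  have E: "integrable ?M (\<lambda>z. \<phi> z * (S z / \<sigma> - 1) * indicator D z)"
    and E_le: "\<bar>\<integral>z. \<phi> z * (S z / \<sigma> - 1) * indicator D z \<partial>?M\<bar> \<le> \<epsilon> * (B * ht_integral \<delta>)"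
  proof -
    have int: "integrable ?M (\<lambda>z. \<epsilon> * (B * (ht z powr (1 - \<delta>) * indicator D z)))"
      using intH by (intro integrable_mult_right)
    have le: "norm (\<phi> z * (S z / \<sigma> - 1) * indicator D z) \<le> \<epsilon> * (B * (ht z powr (1 - \<delta>) * indicator D z))" if z: "z \<in> ?H" for z
    proof -
      have "\<bar>\<phi> z * (S z / \<sigma> - 1)\<bar> \<le> \<phi> z * (\<epsilon> * sqrt (ht z))"
        unfolding abs_mult using nonneg[OF z] S_approx[OF z] by (simp add: mult_left_mono)
      also have "\<dots> = \<epsilon> * (\<phi> z * sqrt (ht z))" by simp
      also have "\<dots> \<le> \<epsilon> * (B * ht z powr (1 - \<delta>))" by (intro mult_left_mono phi1[OF z] eps0)
      finally show ?thesis by (simp add: indicator_def)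
    qed
    show 1: "integrable ?M (\<lambda>z. \<phi> z * (S z / \<sigma> - 1) * indicator D z)"
    proof (rule Bochner_Integration.integrable_bound[OF int])
      show "AE z in ?M. norm (\<phi> z * (S z / \<sigma> - 1) * indicator D z) \<le> norm (\<epsilon> * (B * (ht z powr (1 - \<delta>) * indicator D z)))"
        by (rule AE_I2) (use le in \<open>force intro: order_trans[OF le]\<close>)
    qed measurable
    have "\<bar>\<integral>z. \<phi> z * (S z / \<sigma> - 1) * indicator D z \<partial>?M\<bar> \<le> (\<integral>z. norm (\<phi> z * (S z / \<sigma> - 1) * indicator D z) \<partial>?M)"
      using integral_norm_bound[of ?M "\<lambda>z. \<phi> z * (S z / \<sigma> - 1) * indicator D z"] by simp
    also have "\<dots> \<le> (\<integral>z. \<epsilon> * (B * (ht z powr (1 - \<delta>) * indicator D z)) \<partial>?M)"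
      using le by (intro integral_mono integrable_norm 1 int) simp
    also have "\<dots> = \<epsilon> * (B * ht_integral \<delta>)" by (simp add: ht_integral_def)
    finally show "\<bar>\<integral>z. \<phi> z * (S z / \<sigma> - 1) * indicator D z \<partial>?M\<bar> \<le> \<epsilon> * (B * ht_integral \<delta>)" .
  qed
  have F: "integrable ?M (\<lambda>z. \<phi> z * S z / \<sigma> * indicator D z)"
    and F_eq: "(\<integral>z. \<phi> z * S z / \<sigma> * indicator D z \<partial>?M) = (\<integral>z. \<phi> z * (S z / \<sigma> - 1) * indicator D z \<partial>?M) + (\<integral>z. \<phi> z * indicator D z \<partial>?M)"
  proof -
    have eq: "(\<lambda>z. \<phi> z * S z / \<sigma> * indicator D z) = (\<lambda>z. \<phi> z * (S z / \<sigma> - 1) * indicator D z + \<phi> z * indicator D z)"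
      by (auto simp: indicator_def algebra_simps)
    show "integrable ?M (\<lambda>z. \<phi> z * S z / \<sigma> * indicator D z)" unfolding eq by (rule Bochner_Integration.integrable_add[OF E B])
    show "(\<integral>z. \<phi> z * S z / \<sigma> * indicator D z \<partial>?M) = (\<integral>z. \<phi> z * (S z / \<sigma> - 1) * indicator D z \<partial>?M) + (\<integral>z. \<phi> z * indicator D z \<partial>?M)"
      unfolding eq by (rule Bochner_Integration.integral_add[OF E B])
  qed
  define T where "T = (\<lambda>z. \<Sum>c\<in>?Q. \<phi> (moebius (SOME \<alpha>. \<alpha> \<in> c) z))"
  have T_meas [measurable]: "T \<in> borel_measurable ?M"
    unfolding T_def
  proof (rule borel_measurable_sum)
    fix c assume "c \<in> ?Q"
    then have "det (SOME \<alpha>. \<alpha> \<in> c) > 0" using det_coset_rep n by simp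
    from measurable_compose[OF measurable_moebius_hyp[OF this] meas]
    show "(\<lambda>z. \<phi> (moebius (SOME \<alpha>. \<alpha> \<in> c) z)) \<in> borel_measurable ?M" .
  qed
  have T0: "0 \<le> T z" if "z \<in> ?H" for z
    unfolding T_def using det_coset_rep moeb that nonneg by (intro sum_nonneg) blast
  have "(\<integral>\<^sup>+z. ennreal (theta_lattice 1 z) * indicator D z * (\<integral>\<^sup>+c. ennreal (\<phi> (moebius (SOME \<alpha>. \<alpha> \<in> c) z)) \<partial>count_space ?Q) \<partial>?M) =
     (\<integral>\<^sup>+z. ennreal (\<phi> z) * indicator D z * (of_nat (transfer_index n) * (\<Sum>h\<in>hermite_forms n. ennreal (theta_lattice 1 (moebius (hermite_rep n h) z)))) \<partial>?M)"
  proof (rule hecke_adjoint[OF n])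
    fix h g z assume h: "h \<in> hermite_forms n" and g: "g \<in> transfer n" and z: "z \<in> ?H"
    show "ennreal (theta_lattice 1 (moebius (g ** hermite_rep n h) z)) = ennreal (theta_lattice 1 (moebius (hermite_rep n h) z))"
      using theta_lattice_transfer[OF h g n z] theta_lattice_transfer[OF h one_transfer n z] by simp
  qed (use inv in auto)
  also have "(\<integral>\<^sup>+z. ennreal (theta_lattice 1 z) * indicator D z * (\<integral>\<^sup>+c. ennreal (\<phi> (moebius (SOME \<alpha>. \<alpha> \<in> c) z)) \<partial>count_space ?Q) \<partial>?M) =
     (\<integral>\<^sup>+z. ennreal (\<kappa> * \<sigma> * (theta_lattice 1 z * hecke_real n \<phi> z * indicator D z)) \<partial>?M)"
  proof (rule nn_integral_cong)
    fix z assume "z \<in> space ?M"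
    then have z: "z \<in> ?H" by simp
    have nn: "0 \<le> \<phi> (moebius (SOME \<alpha>. \<alpha> \<in> c) z)" if "c \<in> ?Q" for c
      using nonneg moeb det_coset_rep[OF that] z by blast
    have "(\<integral>\<^sup>+c. ennreal (\<phi> (moebius (SOME \<alpha>. \<alpha> \<in> c) z)) \<partial>count_space ?Q) = ennreal (T z)"
      unfolding T_def using nn by (simp add: nn_integral_count_space_finite[OF finQ] sum_ennreal)
    moreover have "\<kappa> * \<sigma> * (theta_lattice 1 z * hecke_real n \<phi> z * indicator D z) = theta_lattice 1 z * indicator D z * T z"
      unfolding hecke_real_def cQ T_def using \<kappa> \<sigma> by simp
    moreover have "ennreal (theta_lattice 1 z) * indicator D z * ennreal (T z) = ennreal (theta_lattice 1 z * indicator D z * T z)"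
      using th0[OF z] T0[OF z] by (cases "z \<in> D") (simp_all add: ennreal_mult)
    ultimately show "ennreal (theta_lattice 1 z) * indicator D z * (\<integral>\<^sup>+c. ennreal (\<phi> (moebius (SOME \<alpha>. \<alpha> \<in> c) z)) \<partial>count_space ?Q) =
      ennreal (\<kappa> * \<sigma> * (theta_lattice 1 z * hecke_real n \<phi> z * indicator D z))"
      by (simp only:)
  qed
  also have "(\<integral>\<^sup>+z. ennreal (\<phi> z) * indicator D z * (of_nat (transfer_index n) * (\<Sum>h\<in>hermite_forms n. ennreal (theta_lattice 1 (moebius (hermite_rep n h) z)))) \<partial>?M) =
    (\<integral>\<^sup>+z. ennreal (\<kappa> * \<sigma> * (\<phi> z * S z / \<sigma> * indicator D z)) \<partial>?M)"
  proof (rule nn_integral_cong)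
    fix z assume "z \<in> space ?M"
    then have z: "z \<in> ?H" by simp
    have nn: "0 \<le> theta_lattice 1 (moebius (hermite_rep n h) z)" if "h \<in> hermite_forms n" for h
      using th0 moeb det_rep[OF that] z by blast
    have ind: "ennreal (\<phi> z) * indicator D z * (ennreal \<kappa> * ennreal (S z)) = ennreal (\<phi> z * indicator D z * (\<kappa> * S z))"
      using nonneg[OF z] S0[OF z] \<kappa> by (cases "z \<in> D") (simp_all add: ennreal_mult)
    have "(\<Sum>h\<in>hermite_forms n. ennreal (theta_lattice 1 (moebius (hermite_rep n h) z))) = ennreal (S z)"
      unfolding S_def using nn by (simp add: sum_ennreal)
    moreover have "\<kappa> * \<sigma> * (\<phi> z * S z / \<sigma> * indicator D z) = \<phi> z * indicator D z * (\<kappa> * S z)" using \<sigma> by simp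
    moreover have "of_nat (transfer_index n) = ennreal \<kappa>" by (simp add: \<kappa>_def ennreal_of_nat_eq_real_of_nat)
    ultimately show "ennreal (\<phi> z) * indicator D z * (of_nat (transfer_index n) * (\<Sum>h\<in>hermite_forms n. ennreal (theta_lattice 1 (moebius (hermite_rep n h) z)))) = 
      ennreal (\<kappa> * \<sigma> * (\<phi> z * S z / \<sigma> * indicator D z))"
      using ind by (simp only:)
  qed
  \<comment> \<open>Both integrands keep the factor \<kappa> \<sigma>, the number of Hecke cosets,
    so that division takes place only after passing to real integrals.\<close>
  finally have nneq: "(\<integral>\<^sup>+z. ennreal (\<kappa> * \<sigma> * (theta_lattice 1 z * hecke_real n \<phi> z * indicator D z)) \<partial>?M) =
    (\<integral>\<^sup>+z. ennreal (\<kappa> * \<sigma> * (\<phi> z * S z / \<sigma> * indicator D z)) \<partial>?M)" .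
  have F': "integrable ?M (\<lambda>z. \<kappa> * \<sigma> * (\<phi> z * S z / \<sigma> * indicator D z))" using F by (rule integrable_mult_right)
  have hr_meas [measurable]: "hecke_real n \<phi> \<in> borel_measurable ?M"
  proof -
    have "hecke_real n \<phi> = (\<lambda>z. T z / real (card ?Q))" by (auto simp: hecke_real_def T_def)
    then show ?thesis by simp
  qed
  have nn1: "AE z in ?M. 0 \<le> \<kappa> * \<sigma> * (theta_lattice 1 z * hecke_real n \<phi> z * indicator D z)"
  proof (rule AE_I2)
    fix z assume "z \<in> space ?M"
    then have z: "z \<in> ?H" by simp
    have "0 \<le> T z / real (card ?Q)" using T0[OF z] by simp
    then have "0 \<le> hecke_real n \<phi> z" by (simp only: hecke_real_def T_def)
    then show "0 \<le> \<kappa> * \<sigma> * (theta_lattice 1 z * hecke_real n \<phi> z * indicator D z)"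
      using th0[OF z] \<kappa> \<sigma> by (intro mult_nonneg_nonneg) auto
  qed
  have nn2: "AE z in ?M. 0 \<le> \<kappa> * \<sigma> * (\<phi> z * S z / \<sigma> * indicator D z)"
    using nonneg S0 \<kappa> \<sigma> by (intro AE_I2) (auto simp: indicator_def)
  have A': "integrable ?M (\<lambda>z. \<kappa> * \<sigma> * (theta_lattice 1 z * hecke_real n \<phi> z * indicator D z))"
  proof (rule integrableI_nonneg[OF _ nn1])
    have "(\<integral>\<^sup>+z. ennreal (\<kappa> * \<sigma> * (\<phi> z * S z / \<sigma> * indicator D z)) \<partial>?M) < \<infinity>"
      using nn_integral_eq_integral[OF F' nn2] by simp
    then show "(\<integral>\<^sup>+z. ennreal (\<kappa> * \<sigma> * (theta_lattice 1 z * hecke_real n \<phi> z * indicator D z)) \<partial>?M) < \<infinity>" using nneq by simp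
  qed measurable
  have ks: "\<kappa> * \<sigma> \<noteq> 0" using \<kappa> \<sigma> by simp
  have "integrable ?M (\<lambda>z. (1 / (\<kappa> * \<sigma>)) * (\<kappa> * \<sigma> * (theta_lattice 1 z * hecke_real n \<phi> z * indicator D z)))"
    using A' by (rule integrable_mult_right)
  then show ?A using ks by (simp add: mult.assoc[symmetric])
  have "(\<integral>z. \<kappa> * \<sigma> * (theta_lattice 1 z * hecke_real n \<phi> z * indicator D z) \<partial>?M) = (\<integral>z. \<kappa> * \<sigma> * (\<phi> z * S z / \<sigma> * indicator D z) \<partial>?M)"
    unfolding integral_eq_nn_integral[OF borel_measurable_integrable[OF A'] nn1] integral_eq_nn_integral[OF borel_measurable_integrable[OF F'] nn2] nneq ..
  then have "(\<integral>z. theta_lattice 1 z * hecke_real n \<phi> z * indicator D z \<partial>?M) = (\<integral>z. \<phi> z * S z / \<sigma> * indicator D z \<partial>?M)"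
    using ks unfolding integral_mult_right_zero mult_cancel_left by blast
  then show ?C using E_le F_eq by simp
qed

text \<open>The positive and negative parts inherit invariance and the growth bound, and the Hecke
  average is linear; each part contributes one error, hence the 2.\<close>

lemma integral_theta_hecke:
  fixes \<phi> :: "complex \<Rightarrow> real"
  assumes n: "n > 0" "coprime n N" and V: "measure hyp_measure D > 0"
    and \<delta>: "0 < \<delta>" "\<delta> \<le> 1/2"
    and meas [measurable]: "\<phi> \<in> borel_measurable hyp_measure"
    and inv_all: "\<forall>\<gamma>\<in>\<Gamma>. \<forall>z\<in>upper_half_plane. \<phi> (moebius \<gamma> z) = \<phi> z"
    and bound_all: "\<forall>z\<in>upper_half_plane. \<bar>\<phi> z\<bar> \<le> B * ht z powr (1/2 - \<delta>)"
  defines "\<epsilon> \<equiv> (theta_const + 1) * real (card {e. e dvd n}) * real n powr (-1/2)"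
  shows "integrable hyp_measure (\<lambda>z. theta_lattice 1 z * hecke_real n \<phi> z * indicator D z)" (is ?A)
    and "integrable hyp_measure (\<lambda>z. \<phi> z * indicator D z)" (is ?B)
    and "\<bar>(\<integral>z. theta_lattice 1 z * hecke_real n \<phi> z * indicator D z \<partial>hyp_measure) - (\<integral>z. \<phi> z * indicator D z \<partial>hyp_measure)\<bar>
      \<le> 2 * \<epsilon> * (B * ht_integral \<delta>)" (is ?C)
proof -
  note inv = inv_all[rule_format] and bound = bound_all[rule_format]
  define p where "p = (\<lambda>z. max (\<phi> z) 0)"
  define q where "q = (\<lambda>z. max (- \<phi> z) 0)"
  have pm: "p \<in> borel_measurable hyp_measure" "q \<in> borel_measurable hyp_measure" unfolding p_def q_def by measurable
  have pinv: "\<forall>\<gamma>\<in>\<Gamma>. \<forall>z\<in>upper_half_plane. p (moebius \<gamma> z) = p z" "\<forall>\<gamma>\<in>\<Gamma>. \<forall>z\<in>upper_half_plane. q (moebius \<gamma> z) = q z"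
    using inv by (simp_all add: p_def q_def)
  have p0: "\<forall>z\<in>upper_half_plane. 0 \<le> p z" "\<forall>z\<in>upper_half_plane. 0 \<le> q z" by (simp_all add: p_def q_def)
  have pB: "\<forall>z\<in>upper_half_plane. p z \<le> B * ht z powr (1/2 - \<delta>)" "\<forall>z\<in>upper_half_plane. q z \<le> B * ht z powr (1/2 - \<delta>)"
    using bound by (fastforce simp: p_def q_def abs_le_iff)+
  note P = integral_theta_hecke_nonneg[OF n V \<delta> pm(1) pinv(1) p0(1) pB(1)]
  note Q = integral_theta_hecke_nonneg[OF n V \<delta> pm(2) pinv(2) p0(2) pB(2)]
  have pq: "\<phi> z = p z - q z" for z by (simp add: p_def q_def)
  have hpq: "hecke_real n \<phi> z = hecke_real n p z - hecke_real n q z" for z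
    unfolding hecke_real_def pq by (simp add: sum_subtractf diff_divide_distrib)
  have e1: "(\<lambda>z. theta_lattice 1 z * hecke_real n \<phi> z * indicator D z) =
    (\<lambda>z. theta_lattice 1 z * hecke_real n p z * indicator D z - theta_lattice 1 z * hecke_real n q z * indicator D z)"
    unfolding hpq by (simp add: algebra_simps)
  have e2: "(\<lambda>z. \<phi> z * indicator D z) = (\<lambda>z. p z * indicator D z - q z * indicator D z :: real)"
    unfolding pq by (simp add: algebra_simps)
  show ?A unfolding e1 by (rule Bochner_Integration.integrable_diff[OF P(1) Q(1)])
  show ?B unfolding e2 by (rule Bochner_Integration.integrable_diff[OF P(2) Q(2)])
  show ?C
    unfolding e1 e2 Bochner_Integration.integral_diff[OF P(1) Q(1)] Bochner_Integration.integral_diff[OF P(2) Q(2)]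
    using P(3) Q(3) unfolding \<epsilon>_def by linarith
qed

text \<open>The mean value of \<open>|\<theta>|\<^sup>2\<close> is found by applying the estimate to \<open>\<phi> = 1\<close> and letting \<open>n\<close> tend
  to infinity through the primes.\<close>

lemma hecke_real_1:
  assumes "n > 0" "coprime n N" "measure hyp_measure D > 0" "0 < emeasure hyp_measure D" "emeasure hyp_measure D < \<infinity>"
  shows "hecke_real n (\<lambda>_. 1) z = 1"
proof -
  have "(\<Sum>e\<in>{e. e dvd n}. e) > 0" using assms(1) by (intro sum_pos2[of _ n]) auto
  then have "card (hecke_cosets \<Gamma> N n) > 0"
    using card_hecke_cosets(2)[OF assms(1,2,4,5)] transfer_index_pos[of n] by simp
  then show ?thesis by (simp add: hecke_real_def)
qed

lemma integral_theta:
  assumes V: "measure hyp_measure D > 0"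
  shows "integrable hyp_measure (\<lambda>z. theta_lattice 1 z * indicator D z)"
    and "(\<integral>z. theta_lattice 1 z * indicator D z \<partial>hyp_measure) = measure hyp_measure D"
proof -
  \<comment> \<open>At \<delta> = 1/2 the growth exponent is 0, which admits the constant 1.\<close>
  have b: "\<forall>z\<in>upper_half_plane. \<bar>1\<bar> \<le> 1 * ht z powr (1/2 - 1/2)"
    using ht_ge by (force simp: upper_half_plane_def)
  have T: "integrable hyp_measure (\<lambda>z. theta_lattice 1 z * hecke_real n (\<lambda>_. 1) z * indicator D z)"
    "\<bar>(\<integral>z. theta_lattice 1 z * hecke_real n (\<lambda>_. 1) z * indicator D z \<partial>hyp_measure) - (\<integral>z. 1 * indicator D z \<partial>hyp_measure)\<bar>
      \<le> 2 * ((theta_const + 1) * real (card {e. e dvd n}) * real n powr (-1/2)) * (1 * ht_integral (1/2))"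
    if n: "n > 0" "coprime n N" for n
    using integral_theta_hecke(1,3)[OF n V, of "1/2" "\<lambda>_. 1" 1] b by simp_all
  have DH: "D \<inter> upper_half_plane = D" using sets.sets_into_space[OF D_sets] by auto
  have one: "hecke_real n (\<lambda>_. 1) z = 1" if "n > 0" "coprime n N" for n z
    by (rule hecke_real_1[OF that V emeasure_domain[OF V]])
  \<comment> \<open>For n = 1 the average of the constant 1 is 1, so the earlier integrability
    statement is already about |\<theta>|^2.\<close>
  show int: "integrable hyp_measure (\<lambda>z. theta_lattice 1 z * indicator D z)"
    using T(1)[of 1] one[of 1] by simp
  define x where "x = (\<integral>z. theta_lattice 1 z * indicator D z \<partial>hyp_measure) - measure hyp_measure D"
  define K where "K = 4 * (theta_const + 1) * \<bar>ht_integral (1/2)\<bar>"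
  \<comment> \<open>Primes beyond N are coprime to N and have only two divisors, so the error decays
    like p^(-1/2) while x does not depend on p.\<close>
  have le: "\<bar>x\<bar> \<le> K * real p powr (-1/2)" if p: "prime p" "p > N" for p
  proof -
    have cop: "coprime p N" using p N_pos by (metis One_nat_def Suc_le_lessD nat_dvd_not_less prime_imp_coprime)
    have p0: "p > 0" using p by (simp add: prime_gt_0_nat)
    have "{e. e dvd p} = {1, p}" using p(1) by (auto simp: prime_nat_iff)
    then have card: "card {e. e dvd p} = 2" using prime_gt_1_nat[OF p(1)] by simp
    have "\<bar>x\<bar> \<le> 2 * ((theta_const + 1) * real (card {e. e dvd p}) * real p powr (-1/2)) * (1 * ht_integral (1/2))"
      using T(2)[OF p0 cop] one[OF p0 cop] DH by (simp add: x_def)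
    also have "\<dots> = 4 * (theta_const + 1) * real p powr (-1/2) * ht_integral (1/2)" by (simp add: card)
    also have "\<dots> \<le> 4 * (theta_const + 1) * real p powr (-1/2) * \<bar>ht_integral (1/2)\<bar>"
      using theta_const_nonneg by (intro mult_left_mono) auto
    finally show ?thesis by (simp add: K_def mult_ac)
  qed
  have "x = 0"
  proof (rule ccontr)
    assume "x \<noteq> 0"
    \<comment> \<open>The threshold is where K / sqrt p drops below |x|.\<close>
    obtain p where p: "prime p" "p > max N (nat \<lceil>(K / x)\<^sup>2\<rceil>)" using bigger_prime by blast
    have "(K / x)\<^sup>2 < real p" using p(2) by linarith
    have p0: "real p > 0" using p by (simp add: prime_gt_0_nat)
    have "real p powr (-1/2) = 1 / sqrt (real p)"
    proof -
      have "(-1/2 :: real) = - (1/2)" by simp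
      then have "real p powr (-1/2) = inverse (real p powr (1/2))" by (simp only: powr_minus)
      also have "real p powr (1/2) = sqrt (real p)" by (rule powr_half_sqrt) simp
      finally show ?thesis by (simp only: inverse_eq_divide)
    qed
    then have "\<bar>x\<bar> \<le> K / sqrt (real p)" using le[OF p(1)] p(2) by simp
    then have "\<bar>x\<bar> * sqrt (real p) \<le> K" using p0 by (simp add: field_simps)
    then have "sqrt (real p) \<le> K / \<bar>x\<bar>" using \<open>x \<noteq> 0\<close> by (simp add: field_simps)
    then have "(sqrt (real p))\<^sup>2 \<le> (K / \<bar>x\<bar>)\<^sup>2" by (intro power_mono) auto
    then show False using \<open>(K / x)\<^sup>2 < real p\<close> by (simp add: power_divide)
  qed
  then show "(\<integral>z. theta_lattice 1 z * indicator D z \<partial>hyp_measure) = measure hyp_measure D" by (simp add: x_def)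
qed

end

text \<open>Reduces to \<delta> <= 1/2: for larger \<delta> the power is decreasing, hence bounded
  by its value at 3/4, and the exponent on the right is 0.\<close>

lemma powr_ht_le:
  assumes z: "Im z > 0"
  shows "ht z powr (1/2 - \<delta>) \<le> max 1 ((3/4) powr (1/2 - \<delta>)) * ht z powr (1/2 - min \<delta> (1/2))"
proof (cases "\<delta> \<le> 1/2")
  case True
  then have "min \<delta> (1/2) = \<delta>" by simp
  moreover have "1 * ht z powr (1/2 - \<delta>) \<le> max 1 ((3/4) powr (1/2 - \<delta>)) * ht z powr (1/2 - \<delta>)"
    by (intro mult_right_mono) auto
  ultimately show ?thesis by simp
next
  case False
  have "ht z powr (1/2 - \<delta>) \<le> (3/4) powr (1/2 - \<delta>)"
    using ht_ge[OF z] False by (intro powr_mono2') auto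
  moreover have "ht z powr (1/2 - min \<delta> (1/2)) = 1" using False ht_ge[OF z] by simp
  ultimately show ?thesis by simp
qed

lemma theta_equidistribution:
  fixes \<phi> :: "complex \<Rightarrow> complex"
  assumes G: "congruence_subgroup_of_level \<Gamma> N" "\<Gamma> \<subseteq> Gamma0 4" and \<delta>: "\<delta> > 0"
    and meas: "\<phi> \<in> borel_measurable hyp_measure" and inv: "invariant_under \<Gamma> \<phi>"
    and bound: "\<And>z. z \<in> upper_half_plane \<Longrightarrow> norm (\<phi> z) \<le> B * ht z powr (1/2 - \<delta>)"
  defines "\<Theta> \<equiv> (\<lambda>z. complex_of_real ((norm (jacobi_theta z))\<^sup>2))"
  obtains C where "\<And>n. n \<ge> 1 \<Longrightarrow> coprime n N \<Longrightarrow>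
     norm (petersson \<Gamma> \<Theta> (hecke \<Gamma> N n \<phi>) - petersson \<Gamma> \<Theta> (\<lambda>_. 1) * petersson \<Gamma> (\<lambda>_. 1) \<phi>)
       \<le> C * real (card {d. d dvd n}) * real n powr (-1/2)"
proof -
  have sub: "modular_subgroup \<Gamma>" using G(1) by (intro modular_subgroup.intro) (simp add: congruence_subgroup_of_level_def)
  define D where "D = (SOME D. fundamental_domain \<Gamma> D)"
  have "fundamental_domain \<Gamma> D" unfolding D_def using modular_subgroup.fundamental_domain_exists[OF sub] by (rule someI_ex)
  then interpret congruence_theta \<Gamma> D N
    using sub G by (intro congruence_theta.intro modular_domain.intro modular_domain_axioms.intro congruence_theta_axioms.intro)
  define V where "V = measure hyp_measure D"
  have pet: "petersson \<Gamma> f g = (LINT z:D|hyp_measure. cnj (f z) * g z) / of_real V" for f g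
    by (simp add: petersson_def D_def[symmetric] V_def Let_def)
  show ?thesis
  proof (cases "V > 0")
    \<comment> \<open>This case also contains infinite volume, where \<open>measure\<close> is 0;
      division by 0 makes every pairing 0.\<close>
    case False
    then have "V = 0" unfolding V_def by (simp add: zero_less_measure_iff)
    then have "petersson \<Gamma> f g = 0" for f g by (simp add: pet)
    then show ?thesis using that[of 0] by simp
  next
    case True
    then have V: "measure hyp_measure D > 0" by (simp add: V_def)
    define \<delta>' where "\<delta>' = min \<delta> (1/2)"
    have \<delta>': "0 < \<delta>'" "\<delta>' \<le> 1/2" using \<delta> by (auto simp: \<delta>'_def)
    define B' where "B' = \<bar>B\<bar> * max 1 ((3/4) powr (1/2 - \<delta>))"
    have B': "norm (\<phi> z) \<le> B' * ht z powr (1/2 - \<delta>')" if z: "z \<in> upper_half_plane" for z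
    proof -
      have "norm (\<phi> z) \<le> \<bar>B\<bar> * ht z powr (1/2 - \<delta>)"
        using order_trans[OF bound[OF z] mult_right_mono[OF abs_ge_self]] by simp
      also have "\<dots> \<le> \<bar>B\<bar> * (max 1 ((3/4) powr (1/2 - \<delta>)) * ht z powr (1/2 - \<delta>'))"
        using z unfolding \<delta>'_def by (intro mult_left_mono powr_ht_le) (auto simp: upper_half_plane_def)
      finally show ?thesis by (simp add: B'_def mult.assoc)
    qed
    define f g where "f = (\<lambda>z. Re (\<phi> z))" and "g = (\<lambda>z. Im (\<phi> z))"
    have fm: "f \<in> borel_measurable hyp_measure" "g \<in> borel_measurable hyp_measure"
      unfolding f_def g_def using meas by measurable
    have finv: "\<forall>\<gamma>\<in>\<Gamma>. \<forall>z\<in>upper_half_plane. f (moebius \<gamma> z) = f z" "\<forall>\<gamma>\<in>\<Gamma>. \<forall>z\<in>upper_half_plane. g (moebius \<gamma> z) = g z"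
      using inv by (auto simp: invariant_under_def f_def g_def)
    have fB: "\<forall>z\<in>upper_half_plane. \<bar>f z\<bar> \<le> B' * ht z powr (1/2 - \<delta>')" "\<forall>z\<in>upper_half_plane. \<bar>g z\<bar> \<le> B' * ht z powr (1/2 - \<delta>')"
      unfolding f_def g_def using B' abs_Re_le_cmod abs_Im_le_cmod order_trans by blast+
    have \<Theta>: "\<Theta> z = complex_of_real (theta_lattice 1 z)" if "z \<in> upper_half_plane" for z
    proof -
      have "Im z > 0" using that by (simp add: upper_half_plane_def)
      from norm_jacobi_theta_squared[OF this] show ?thesis by (simp only: \<Theta>_def)
    qed
    have set_int: "(LINT z:D|hyp_measure. h z) = of_real (\<integral>z. u z * indicator D z \<partial>hyp_measure) + \<i> * of_real (\<integral>z. v z * indicator D z \<partial>hyp_measure)"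
      if "integrable hyp_measure (\<lambda>z. u z * indicator D z)" "integrable hyp_measure (\<lambda>z. v z * indicator D z)"
        "\<And>z. z \<in> upper_half_plane \<Longrightarrow> h z = of_real (u z) + \<i> * of_real (v z)" for h :: "complex \<Rightarrow> complex" and u v
    proof -
      have "(LINT z:D|hyp_measure. h z) = (\<integral>z. of_real (u z * indicator D z) + \<i> * of_real (v z * indicator D z) \<partial>hyp_measure)"
        unfolding set_lebesgue_integral_def using that(3)
        by (intro Bochner_Integration.integral_cong) (auto simp: indicator_def)
      also have "\<dots> = of_real (\<integral>z. u z * indicator D z \<partial>hyp_measure) + \<i> * of_real (\<integral>z. v z * indicator D z \<partial>hyp_measure)"
        using integrable_of_real[OF that(1), where 'a = complex] integrable_of_real[OF that(2), where 'a = complex]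
        by (subst Bochner_Integration.integral_add) (simp_all del: of_real_mult)
      finally show ?thesis .
    qed
    have hecke_eq: "hecke \<Gamma> N n \<phi> z = of_real (hecke_real n f z) + \<i> * of_real (hecke_real n g z)" for n z
    proof -
      have "(\<Sum>c\<in>hecke_cosets \<Gamma> N n. \<phi> (moebius (SOME \<alpha>. \<alpha> \<in> c) z)) =
        of_real (\<Sum>c\<in>hecke_cosets \<Gamma> N n. f (moebius (SOME \<alpha>. \<alpha> \<in> c) z)) + \<i> * of_real (\<Sum>c\<in>hecke_cosets \<Gamma> N n. g (moebius (SOME \<alpha>. \<alpha> \<in> c) z))"
        by (simp add: f_def g_def complex_eq_iff)
      then show ?thesis by (simp add: hecke_def hecke_real_def add_divide_distrib)
    qed
    have zero: "integrable hyp_measure (\<lambda>z. 0 * indicator D z :: real)" by simp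
    have "(LINT z:D|hyp_measure. cnj (\<Theta> z) * 1) = of_real (\<integral>z. theta_lattice 1 z * indicator D z \<partial>hyp_measure) + \<i> * of_real (\<integral>z. 0 * indicator D z \<partial>hyp_measure)"
      by (rule set_int[OF integral_theta(1)[OF V] zero]) (simp add: \<Theta>)
    then have mean: "petersson \<Gamma> \<Theta> (\<lambda>_. 1) = 1"
      using integral_theta(2)[OF V] True by (simp add: pet V_def)
    \<comment> \<open>The 4 is 2 for positive and negative parts times 2 for real and imaginary
      parts.\<close>
    define K where "K = 4 * (theta_const + 1) * (B' * ht_integral \<delta>') / V"
    have "norm (petersson \<Gamma> \<Theta> (hecke \<Gamma> N n \<phi>) - petersson \<Gamma> \<Theta> (\<lambda>_. 1) * petersson \<Gamma> (\<lambda>_. 1) \<phi>)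
       \<le> K * real (card {d. d dvd n}) * real n powr (-1/2)" if n: "n \<ge> 1" "coprime n N" for n
    proof -
      have n0: "n > 0" using n by simp
      note F = integral_theta_hecke[OF n0 n(2) V \<delta>' fm(1) finv(1) fB(1)]
      note G = integral_theta_hecke[OF n0 n(2) V \<delta>' fm(2) finv(2) fB(2)]
      define \<epsilon> where "\<epsilon> = 2 * ((theta_const + 1) * real (card {e. e dvd n}) * real n powr (-1/2)) * (B' * ht_integral \<delta>')"
      define x where "x = (\<integral>z. theta_lattice 1 z * hecke_real n f z * indicator D z \<partial>hyp_measure) - (\<integral>z. f z * indicator D z \<partial>hyp_measure)"
      define y where "y = (\<integral>z. theta_lattice 1 z * hecke_real n g z * indicator D z \<partial>hyp_measure) - (\<integral>z. g z * indicator D z \<partial>hyp_measure)"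
      have xy: "\<bar>x\<bar> \<le> \<epsilon>" "\<bar>y\<bar> \<le> \<epsilon>" using F(3) G(3) unfolding x_def y_def \<epsilon>_def by blast+
      have 1: "(LINT z:D|hyp_measure. cnj (\<Theta> z) * hecke \<Gamma> N n \<phi> z) =
        of_real (\<integral>z. theta_lattice 1 z * hecke_real n f z * indicator D z \<partial>hyp_measure) + \<i> * of_real (\<integral>z. theta_lattice 1 z * hecke_real n g z * indicator D z \<partial>hyp_measure)"
        by (rule set_int[OF F(1) G(1)]) (simp add: \<Theta> hecke_eq algebra_simps)
      have 2: "(LINT z:D|hyp_measure. cnj 1 * \<phi> z) = of_real (\<integral>z. f z * indicator D z \<partial>hyp_measure) + \<i> * of_real (\<integral>z. g z * indicator D z \<partial>hyp_measure)"
        by (rule set_int[OF F(2) G(2)]) (simp add: f_def g_def complex_eq_iff)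
      have "petersson \<Gamma> \<Theta> (hecke \<Gamma> N n \<phi>) - petersson \<Gamma> \<Theta> (\<lambda>_. 1) * petersson \<Gamma> (\<lambda>_. 1) \<phi> = (of_real x + \<i> * of_real y) / of_real V"
        unfolding mean unfolding pet 1 2 x_def y_def by (simp add: diff_divide_distrib[symmetric] algebra_simps)
      also have "norm \<dots> \<le> (\<bar>x\<bar> + \<bar>y\<bar>) / V"
        using True norm_triangle_ineq[of "of_real x" "\<i> * of_real y :: complex"]
        by (simp add: norm_divide norm_mult divide_right_mono)
      also have "\<dots> \<le> (\<epsilon> + \<epsilon>) / V" using xy True by (intro divide_right_mono add_mono) auto
      also have "\<dots> = K * real (card {d. d dvd n}) * real n powr (-1/2)" by (simp add: K_def \<epsilon>_def)
      finally show ?thesis .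
    qed
    then show ?thesis by (rule that)
  qed
qed

theorem theorem1:
  fixes \<Gamma> :: "(int^2^2) set" and N :: nat and \<delta> :: real and \<phi> :: "complex \<Rightarrow> complex"
  assumes "congruence_subgroup_of_level \<Gamma> N"
    and "\<Gamma> \<subseteq> Gamma0 4"
    and "\<delta> > 0"
    and "\<phi> \<in> borel_measurable hyp_measure"
    and "invariant_under \<Gamma> \<phi>"
    and "\<exists>B. \<forall>z\<in>upper_half_plane. norm (\<phi> z) \<le> B * ht z powr (1/2 - \<delta>)"
  defines "\<Theta> \<equiv> (\<lambda>z. complex_of_real ((norm (jacobi_theta z))\<^sup>2))"
  shows "\<exists>C. \<forall>n::nat. n \<ge> 1 \<and> coprime n N \<longrightarrow>
           norm (petersson \<Gamma> \<Theta> (hecke \<Gamma> N n \<phi>)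
                 - petersson \<Gamma> \<Theta> (\<lambda>_. 1) * petersson \<Gamma> (\<lambda>_. 1) \<phi>)
             \<le> C * real (card {d. d dvd n}) * real n powr (-1/2)"
proof -
  obtain B where B: "\<And>z. z \<in> upper_half_plane \<Longrightarrow> norm (\<phi> z) \<le> B * ht z powr (1/2 - \<delta>)"
    using assms(6) by blast
  show ?thesis
    using theta_equidistribution[OF assms(1-5) B] unfolding \<Theta>_def by metis
qed

end
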